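(* Let $\bm{p}=(p_i)_{i=1}^k$, $k\le\infty$, be a decreasing probability mass function with $m\le\infty$ flat regions of known lengths $\bm{w}=(w_1,w_2,\dots)$ and common values $p'_1>p'_2>\cdots$ on these regions, and let $X_1,\dots,X_n$ be i.i.d. with probability mass function $\bm{p}$. Let $\hat{\bm{p}}'^{G}_n$ be the order restricted maximum likelihood estimator of the grouped parameter $\bm{p}'=(p'_1,p'_2,\dots)$, and let $\hat{\bm{p}}^{*}_n=\bm{A}\hat{\bm{p}}'^{G}_n$. Then $\hat{\bm{p}}^{*}_n$ is consistent, $$\hat{\bm{p}}^{*}_n\stackrel{p}{\to}\bm{p},$$ and asymptotically normal, $$\sqrt{n}(\hat{\bm{p}}^{*}_n-\bm{p})\stackrel{d}{\to}\mathcal{N}(\bm{0},\Sigma^{*}),$$ as $n\to\infty$, where $\Sigma^{*}=\bm{A}\Sigma\bm{A}^{T}$, $\Sigma$ is the $m\times m$ matrix with $[\Sigma]_{ij}=\delta_{ij}\frac{p'_i}{w_i}-p'_ip'_j$, and $\delta_{ij}$ is $1$ if $i=j$ and $0$ otherwise.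
   Context: Setting. $\bm{p}$ is a probability mass function on $\mathbb{N}_+=\{1,2,\dots\}$, $k=\sup\{i:p_i>0\}\le\infty$, $p_i>0$ for all $i\in\mathbb{N}_+$ with $i\le k$, $\sum_i p_i=1$, and $$p_1=\dots=p_{w_1}>p_{w_1+1}=\dots=p_{w_1+w_2}>\dots,$$ ending, when $k<\infty$, with the last block $p_{\sum_{j=1}^{m-1}w_j+1}=\dots=p_k$. Here $m$ is the number of flat regions and $w_j\ge1$ (an integer) is the length of the $j$-th one, so $\sum_{j=1}^m w_j=k$; $m=\infty$ exactly when $k=\infty$. Let $q_j=1+\sum_{l<j}w_l$ be the first index of the $j$-th flat region and $p'_j=p_{q_j}$ the common value there, so $\sum_{j=1}^m w_jp'_j=1$. Grouped counts: $n'_j=\sum_{l=1}^n 1\{q_j\le X_l\le q_j+w_j-1\}$. Order restricted MLE of the grouped parameter: $$\hat{\bm{p}}'^{G}_n=\underset{\bm{f}'\in\mathcal{F}'_{m,\bm{w}}}{\mathrm{argmax}}\ \prod_{j=1}^m (f'_j)^{n'_j},\qquad \mathcal{F}'_{m,\bm{w}}=\Big\{\bm{f}'\in\mathbb{R}^m_+:\ \sum_{j=1}^m w_jf'_j=1,\ f'_1\ge f'_2\ge\dots\ge f'_m\Big\},$$ where $\mathbb{R}_+=[0,\infty)$ and $0^0=1$ (if $m=\infty$, sequences with the analogous constraints). $\bm{A}$ is the $k\times m$ matrix with $[\bm{A}]_{i,j}=1$ if $q_j\le i\le q_j+w_j-1$ and $0$ otherwise; thus $\hat{\bm{p}}^*_n$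 takes the value $\hat p'^{G}_{n,j}$ at every index of the $j$-th flat region. Equivalently, $\hat{\bm{p}}^*_n$ is the maximum likelihood estimator of $\bm{p}$ over probability mass functions on $\{i\le k\}$ that are decreasing and constant on each of the given flat regions. When $k=\infty$, convergence in probability and in distribution are understood in the sequence space $\ell_2$ (with its norm and Borel $\sigma$-algebra), and $\mathcal{N}(\bm{0},\Sigma^* )$ is the centred Gaussian law on $\ell_2$ with covariance matrix $\Sigma^*$. *)

theory Defs
  imports "HOL-Probability.Probability"
begin

section \<open>The Hilbert space of square-summable sequences\<close>

typedef ell2 = "{x :: nat \<Rightarrow> real. summable (\<lambda>i. (x i)\<^sup>2)}"
  morphisms coord Abs_ell2
  by (rule exI[of _ "\<lambda>_. 0"]) simp

setup_lifting type_definition_ell2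

lemma summable_mult_ell2:
  fixes x y :: "nat \<Rightarrow> real"
  assumes "summable (\<lambda>i. (x i)\<^sup>2)" "summable (\<lambda>i. (y i)\<^sup>2)"
  shows "summable (\<lambda>i. x i * y i)"
proof (rule summable_comparison_test')
  show "summable (\<lambda>i. (x i)\<^sup>2 + (y i)\<^sup>2)"
    using assms by (rule summable_add)
  have "2 * \<bar>x i * y i\<bar> \<le> (x i)\<^sup>2 + (y i)\<^sup>2" for i
    using sum_squares_bound[of "\<bar>x i\<bar>" "\<bar>y i\<bar>"] by (simp add: abs_mult mult.assoc)
  moreover have "0 \<le> \<bar>x i * y i\<bar>" for i
    by simp
  ultimately show "norm (x i * y i) \<le> (x i)\<^sup>2 + (y i)\<^sup>2" if "0 \<le> i" for i
    by (smt (verit) real_norm_def)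
qed

lemma summable_add_ell2:
  fixes x y :: "nat \<Rightarrow> real"
  assumes "summable (\<lambda>i. (x i)\<^sup>2)" "summable (\<lambda>i. (y i)\<^sup>2)"
  shows "summable (\<lambda>i. (x i + y i)\<^sup>2)"
proof -
  have "summable (\<lambda>i. (x i)\<^sup>2 + (y i)\<^sup>2 + 2 * (x i * y i))"
    using assms by (intro summable_add summable_mult summable_mult_ell2)
  then show ?thesis
    by (simp add: power2_sum mult.assoc)
qed

lemma summable_scale_ell2:
  fixes x :: "nat \<Rightarrow> real"
  assumes "summable (\<lambda>i. (x i)\<^sup>2)"
  shows "summable (\<lambda>i. (c * x i)\<^sup>2)"
  using summable_mult[OF assms, of "c\<^sup>2"] by (simp add: power_mult_distrib)

instantiation ell2 :: real_vector
begin

lift_definition zero_ell2 :: ell2 is "\<lambda>_. 0"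
  by simp

lift_definition plus_ell2 :: "ell2 \<Rightarrow> ell2 \<Rightarrow> ell2" is "\<lambda>x y i. x i + y i"
  by (rule summable_add_ell2)

lift_definition uminus_ell2 :: "ell2 \<Rightarrow> ell2" is "\<lambda>x i. - x i"
  by simp

lift_definition minus_ell2 :: "ell2 \<Rightarrow> ell2 \<Rightarrow> ell2" is "\<lambda>x y i. x i - y i"
  subgoal for x y
    using summable_add_ell2[of x "\<lambda>i. - y i"] by simp
  done

lift_definition scaleR_ell2 :: "real \<Rightarrow> ell2 \<Rightarrow> ell2" is "\<lambda>c x i. c * x i"
  by (rule summable_scale_ell2)

instance
proof
  fix x y z :: ell2 and a b :: real
  show "x + y + z = x + (y + z)" by transfer (simp add: add.assoc)
  show "x + y = y + x" by transfer (simp add: add.commute)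
  show "0 + x = x" by transfer simp
  show "- x + x = 0" by transfer simp
  show "x - y = x + - y" by transfer simp
  show "a *\<^sub>R (x + y) = a *\<^sub>R x + a *\<^sub>R y" by transfer (simp add: distrib_left)
  show "(a + b) *\<^sub>R x = a *\<^sub>R x + b *\<^sub>R x" by transfer (simp add: distrib_right)
  show "a *\<^sub>R b *\<^sub>R x = (a * b) *\<^sub>R x" by transfer (simp add: mult.assoc)
  show "1 *\<^sub>R x = x" by transfer simp
qed

end

instantiation ell2 :: real_inner
begin

lift_definition inner_ell2 :: "ell2 \<Rightarrow> ell2 \<Rightarrow> real" is "\<lambda>x y. \<Sum>i. x i * y i" .

definition norm_ell2 :: "ell2 \<Rightarrow> real" where
  "norm_ell2 x = sqrt (x \<bullet> x)"

definition sgn_ell2 :: "ell2 \<Rightarrow> ell2" where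
  "sgn_ell2 x = x /\<^sub>R norm x"

definition dist_ell2 :: "ell2 \<Rightarrow> ell2 \<Rightarrow> real" where
  "dist_ell2 x y = norm (x - y)"

definition uniformity_ell2 :: "(ell2 \<times> ell2) filter" where
  "uniformity_ell2 = (INF e\<in>{0<..}. principal {(x, y). dist x y < e})"

definition open_ell2 :: "ell2 set \<Rightarrow> bool" where
  "open_ell2 U = (\<forall>x\<in>U. eventually (\<lambda>(x', y). x' = x \<longrightarrow> y \<in> U) uniformity)"

instance
proof
  fix x y z :: ell2 and a :: real
  show "sgn x = x /\<^sub>R norm x" by (rule sgn_ell2_def)
  show "dist x y = norm (x - y)" by (rule dist_ell2_def)
  show "uniformity = (INF e\<in>{0<..}. principal {(x::ell2, y). dist x y < e})"
    by (rule uniformity_ell2_def)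
  show "open U = (\<forall>x\<in>U. eventually (\<lambda>(x', y). x' = x \<longrightarrow> y \<in> U) uniformity)"
    for U :: "ell2 set"
    by (rule open_ell2_def)
  show "x \<bullet> y = y \<bullet> x" by transfer (simp add: mult.commute)
  show "(x + y) \<bullet> z = x \<bullet> z + y \<bullet> z"
    by transfer (simp add: distrib_right suminf_add summable_mult_ell2)
  show "a *\<^sub>R x \<bullet> y = a * (x \<bullet> y)"
    by transfer (simp add: mult.assoc suminf_mult summable_mult_ell2)
  show "0 \<le> x \<bullet> x"
    by transfer (auto intro!: suminf_nonneg simp: power2_eq_square)
  show "x \<bullet> x = 0 \<longleftrightarrow> x = 0"
    by transfer (auto simp: suminf_eq_zero_iff power2_eq_square fun_eq_iff)
  show "norm x = sqrt (x \<bullet> x)" by (rule norm_ell2_def)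
qed

end


section \<open>Convergence of random elements\<close>

text \<open>
  Measurability is part of both notions: Isabelle's measure of a non-measurable set and Bochner
  integral of a non-measurable function are 0 by convention.
\<close>

definition tendsto_in_prob ::
  "'a measure \<Rightarrow> (nat \<Rightarrow> 'a \<Rightarrow> 'b::metric_space) \<Rightarrow> 'b \<Rightarrow> bool" where
  "tendsto_in_prob M Y c \<longleftrightarrow>
     (\<forall>n. Y n \<in> borel_measurable M) \<and>
     (\<forall>\<epsilon>>0. (\<lambda>n. measure M {\<omega> \<in> space M. dist (Y n \<omega>) c > \<epsilon>}) \<longlonglongrightarrow> 0)"

definition tendsto_in_distr ::
  "'a measure \<Rightarrow> (nat \<Rightarrow> 'a \<Rightarrow> 'b::topological_space) \<Rightarrow> 'b measure \<Rightarrow> bool" where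
  "tendsto_in_distr M Y N \<longleftrightarrow>
     (\<forall>n. Y n \<in> borel_measurable M) \<and> prob_space N \<and> sets N = sets borel \<and>
     (\<forall>f :: 'b \<Rightarrow> real. continuous_on UNIV f \<and> bounded (range f) \<longrightarrow>
        (\<lambda>n. \<integral>\<omega>. f (Y n \<omega>) \<partial>M) \<longlonglongrightarrow> (\<integral>x. f x \<partial>N))"


section \<open>Centred Gaussian laws\<close>

text \<open>Normal laws on the line; the standard deviation 0 gives the point mass at 0.\<close>

definition centred_normal :: "real \<Rightarrow> real measure" where
  "centred_normal \<sigma> =
     (if \<sigma> = 0 then return borel 0 else density lborel (\<lambda>x. ennreal (normal_density 0 \<sigma> x)))"

definition centred_gaussian :: "ell2 measure \<Rightarrow> (nat \<Rightarrow> nat \<Rightarrow> real) \<Rightarrow> bool" where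
  "centred_gaussian N S \<longleftrightarrow>
     prob_space N \<and> sets N = sets borel \<and>
     (\<forall>h. \<exists>\<sigma>\<ge>0. distr N borel (\<lambda>x. h \<bullet> x) = centred_normal \<sigma>) \<and>
     (\<forall>i i'. has_bochner_integral N (\<lambda>x. coord x i * coord x i') (S i i'))"


section \<open>Decreasing probability mass functions with known flat regions\<close>

text \<open>
  All indices start at 1. A vector indexed by \<open>1, \<dots>, k\<close> with \<open>k \<le> \<infinity>\<close> is a function on the
  naturals that vanishes outside \<open>idx k\<close>; for finite \<open>k\<close> this embeds Euclidean \<open>k\<close>-space
  isometrically as a closed subspace of \<^typ>\<open>ell2\<close>.
\<close>

definition idx :: "enat \<Rightarrow> nat set" where
  "idx k = {i. 1 \<le> i \<and> enat i \<le> k}"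

definition region_start :: "(nat \<Rightarrow> nat) \<Rightarrow> nat \<Rightarrow> nat" where
  "region_start w j = 1 + (\<Sum>l\<in>{1..<j}. w l)"

definition in_region :: "(nat \<Rightarrow> nat) \<Rightarrow> nat \<Rightarrow> nat \<Rightarrow> bool" where
  "in_region w j i \<longleftrightarrow> region_start w j \<le> i \<and> i \<le> region_start w j + w j - 1"

definition grouped_param :: "nat pmf \<Rightarrow> (nat \<Rightarrow> nat) \<Rightarrow> nat \<Rightarrow> real" where
  "grouped_param p w j = pmf p (region_start w j)"

definition decreasing_with_flat_regions ::
  "nat pmf \<Rightarrow> enat \<Rightarrow> enat \<Rightarrow> (nat \<Rightarrow> nat) \<Rightarrow> bool" where
  "decreasing_with_flat_regions p k m w \<longleftrightarrow>
     set_pmf p = idx k \<and>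
     (\<forall>j\<in>idx m. 1 \<le> w j) \<and>
     k = (case m of enat m' \<Rightarrow> enat (\<Sum>j\<in>{1..m'}. w j) | \<infinity> \<Rightarrow> \<infinity>) \<and>
     (\<forall>j\<in>idx m. \<forall>i. in_region w j i \<longrightarrow> pmf p i = grouped_param p w j) \<and>
     (\<forall>j. j \<in> idx m \<and> Suc j \<in> idx m \<longrightarrow> grouped_param p w (Suc j) < grouped_param p w j)"


section \<open>The order restricted maximum likelihood estimator\<close>

definition grouped_count ::
  "(nat \<Rightarrow> nat) \<Rightarrow> (nat \<Rightarrow> 'a \<Rightarrow> nat) \<Rightarrow> nat \<Rightarrow> 'a \<Rightarrow> nat \<Rightarrow> nat" where
  "grouped_count w X n \<omega> j = (\<Sum>l\<in>{1..n}. of_bool (in_region w j (X l \<omega>)))"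

definition grouped_simplex :: "enat \<Rightarrow> (nat \<Rightarrow> nat) \<Rightarrow> (nat \<Rightarrow> real) set" where
  "grouped_simplex m w =
     {f. (\<forall>j\<in>idx m. 0 \<le> f j) \<and> (\<forall>j. j \<notin> idx m \<longrightarrow> f j = 0) \<and>
         ((\<lambda>j. real (w j) * f j) has_sum 1) (idx m) \<and>
         (\<forall>j. j \<in> idx m \<and> Suc j \<in> idx m \<longrightarrow> f (Suc j) \<le> f j)}"

text \<open>
  Factors with count 0 are equal to 1 (also for \<open>f j = 0\<close>) and are left out, so that the product
  is finite for \<open>m = \<infinity>\<close> as well.
\<close>

definition grouped_likelihood :: "enat \<Rightarrow> (nat \<Rightarrow> nat) \<Rightarrow> (nat \<Rightarrow> real) \<Rightarrow> real" where
  "grouped_likelihood m c f = (\<Prod>j\<in>{j \<in> idx m. c j \<noteq> 0}. f j ^ c j)"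

text \<open>
  The maximiser is unique as soon as some count is nonzero, hence almost surely for \<open>n \<ge> 1\<close>. If all
  counts are 0, the likelihood is constant and an arbitrary feasible vector is chosen.
\<close>

definition grouped_mle ::
  "enat \<Rightarrow> (nat \<Rightarrow> nat) \<Rightarrow> (nat \<Rightarrow> 'a \<Rightarrow> nat) \<Rightarrow> nat \<Rightarrow> 'a \<Rightarrow> nat \<Rightarrow> real" where
  "grouped_mle m w X n \<omega> =
     arg_max_on (grouped_likelihood m (grouped_count w X n \<omega>)) (grouped_simplex m w)"

definition region_matrix :: "(nat \<Rightarrow> nat) \<Rightarrow> nat \<Rightarrow> nat \<Rightarrow> real" where
  "region_matrix w i j = of_bool (in_region w j i)"

text \<open>
  For \<open>m = \<infinity>\<close> the sums over \<open>idx m\<close> below are infinite sums with at most one nonzero term,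
  since \<open>i\<close> lies in at most one region.
\<close>

definition restricted_estimator ::
  "enat \<Rightarrow> (nat \<Rightarrow> nat) \<Rightarrow> (nat \<Rightarrow> 'a \<Rightarrow> nat) \<Rightarrow> nat \<Rightarrow> 'a \<Rightarrow> ell2" where
  "restricted_estimator m w X n \<omega> =
     Abs_ell2 (\<lambda>i. \<Sum>\<^sub>\<infinity>j\<in>idx m. region_matrix w i j * grouped_mle m w X n \<omega> j)"

definition pmf_ell2 :: "nat pmf \<Rightarrow> ell2" where
  "pmf_ell2 p = Abs_ell2 (pmf p)"


section \<open>The asymptotic covariance\<close>

definition grouped_cov :: "nat pmf \<Rightarrow> (nat \<Rightarrow> nat) \<Rightarrow> nat \<Rightarrow> nat \<Rightarrow> real" where
  "grouped_cov p w i j =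
     of_bool (i = j) * (grouped_param p w i / real (w i)) - grouped_param p w i * grouped_param p w j"

definition restricted_cov :: "nat pmf \<Rightarrow> enat \<Rightarrow> (nat \<Rightarrow> nat) \<Rightarrow> nat \<Rightarrow> nat \<Rightarrow> real" where
  "restricted_cov p m w i i' =
     (\<Sum>\<^sub>\<infinity>j\<in>idx m. \<Sum>\<^sub>\<infinity>j'\<in>idx m. region_matrix w i j * grouped_cov p w j j' * region_matrix w i' j')"

end

theory Submission
  imports Defs
begin

text \<open>
  Let \<open>g j = n'\<^sub>j / (n w\<^sub>j)\<close> be the unrestricted estimator of the grouped parameter. The first order
  conditions of the likelihood problem say that the restricted estimator is the weighted least squares
  projection of \<open>g\<close> onto the decreasing sequences. Hence it is at least as close to the true parameter
  as \<open>g\<close>, and it agrees with \<open>g\<close> on the first \<open>K\<close> regions as soon as \<open>g\<close> is so close to the strictly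
  decreasing true parameter that no order violation involves them.

  Consistency follows from the first property and \<open>n E \<parallel>A g - p\<parallel>\<^sup>2 \<le> 1\<close>. For asymptotic normality the two
  properties together give that, up to an error that is small uniformly in \<open>n\<close>, only finitely many
  coordinates matter, and that on these the restricted estimator equals \<open>A g\<close>, a normalised sum of
  i.i.d. vectors. Their joint convergence is the one-dimensional central limit theorem applied to linear
  combinations. The Gaussian limit is built from a Brownian bridge at the times \<open>\<Sum>l\<le>j. w\<^sub>l p'\<^sub>l\<close>, whose
  increments have the multinomial covariance.
\<close>

section \<open>Random elements of the sequence space\<close>

text \<open>For \<open>m = \<infinity>\<close> the gaps between consecutive true values have infimum
  0, so no closeness of \<open>g\<close> excludes order violations everywhere; only the finitely
  many gaps up to a cut-off \<open>T\<close> have a positive lower bound. Beyond \<open>T\<close>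
  the restricted estimator has no formula and its tail is controlled indirectly: its error has at
  most the norm of the error of \<open>A g\<close>, and the two agree below \<open>T\<close>, so the
  rest of its squared norm is at most the tail for \<open>A g\<close>. After rescaling, that tail
  has expectation at most the probability of the indices from \<open>T\<close> on, for every
  \<open>n\<close>, since each coordinate has variance at most \<open>pmf p i\<close>; the limit law
  obeys the same bound. As tails are small in mean square, Lipschitz test functions are the right
  ones. Linear combinations only yield limits of expectations of \<open>cos (h x + b)\<close>. Sums
  of such functions form an algebra, and Stone-Weierstrass on a cube, with second moments bounding
  the mass outside, reaches all bounded continuous functions of finitely many coordinates. The
  bridge gives a triangular factor of the covariance, so each coordinate of the limit is a finite
  combination of independent normals.\<close>

lemma coord_summable: "summable (\<lambda>i. (coord x i)\<^sup>2)"
  using coord[of x] by simp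

lemma coord_Abs: "summable (\<lambda>i. (y i)\<^sup>2) \<Longrightarrow> coord (Abs_ell2 y) = y"
  by (simp add: Abs_ell2_inverse)

lemma ell2_eqI: "(\<And>i. coord x i = coord y i) \<Longrightarrow> x = y"
  by (metis coord_inject ext)

lemmas coord_simps = zero_ell2.rep_eq plus_ell2.rep_eq uminus_ell2.rep_eq minus_ell2.rep_eq
  scaleR_ell2.rep_eq

lemma norm_ell2_sq: "(norm x)\<^sup>2 = (\<Sum>i. (coord x i)\<^sup>2)"
  by (simp add: power2_norm_eq_inner inner_ell2.rep_eq power2_eq_square[of "coord x _"])

lemma inner_ell2_sums: "(\<lambda>i. coord x i * coord y i) sums (x \<bullet> y)"
  unfolding inner_ell2.rep_eq by (intro summable_sums summable_mult_ell2 coord_summable)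

lemma abs_coord_le_norm: "\<bar>coord x i\<bar> \<le> norm x"
proof -
  have "(\<Sum>j\<in>{i}. (coord x j)\<^sup>2) \<le> (norm x)\<^sup>2"
    unfolding norm_ell2_sq by (rule sum_le_suminf[OF coord_summable]) auto
  then show ?thesis by (simp add: abs_le_square_iff[of "coord x i" "norm x", simplified])
qed


lemma bounded_linear_coord: "bounded_linear (\<lambda>x. coord x i)"
  by (rule bounded_linear_intro[where K = 1]) (simp_all add: coord_simps abs_coord_le_norm)

lemma measurable_coord [measurable]: "(\<lambda>x. coord x i) \<in> borel_measurable borel"
  by (intro borel_measurable_continuous_onI linear_continuous_on bounded_linear_coord)

definition unit_ell2 :: "nat \<Rightarrow> ell2" where
  "unit_ell2 i = Abs_ell2 (\<lambda>j. of_bool (j = i))"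

lemma coord_unit: "coord (unit_ell2 i) j = of_bool (j = i)"
proof -
  have "summable (\<lambda>j. (of_bool (j = i) :: real)\<^sup>2)"
    by (rule summable_finite[of "{i}"]) auto
  then show ?thesis by (simp add: unit_ell2_def coord_Abs)
qed

text \<open>The argument is a bare function, not an element of \<open>ell2\<close>: truncation is
  then continuous for the product topology, in which measurability and the convergence of finitely
  many coordinates are treated.\<close>

definition head_ell2 :: "nat \<Rightarrow> (nat \<Rightarrow> real) \<Rightarrow> ell2" where
  "head_ell2 T y = (\<Sum>i<T. y i *\<^sub>R unit_ell2 i)"

lemma coord_head: "coord (head_ell2 T y) j = (if j < T then y j else 0)"
  unfolding head_ell2_def by (induction T) (auto simp: coord_simps coord_unit less_Suc_eq)

lemma continuous_on_head: "continuous_on UNIV (head_ell2 T)"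
  unfolding head_ell2_def by (intro continuous_intros continuous_on_product_coordinates)

definition tail_sq :: "nat \<Rightarrow> ell2 \<Rightarrow> real" where
  "tail_sq T x = (\<Sum>i. (coord x (i + T))\<^sup>2)"

lemma norm_sq_split: "(norm x)\<^sup>2 = tail_sq T x + (\<Sum>i<T. (coord x i)\<^sup>2)"
  unfolding norm_ell2_sq tail_sq_def by (rule suminf_split_initial_segment[OF coord_summable])

lemma norm_diff_head: "(norm (x - head_ell2 T (coord x)))\<^sup>2 = tail_sq T x"
  by (subst norm_sq_split[where T = T]) (simp add: tail_sq_def coord_simps coord_head)

lemma tail_sq_nonneg: "0 \<le> tail_sq T x"
  using norm_diff_head[of x T] by (metis zero_le_power2)

lemma tail_sq_tendsto_0: "(\<lambda>T. tail_sq T x) \<longlonglongrightarrow> 0"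
  unfolding tail_sq_def using suminf_exist_split2[OF coord_summable, of x] by simp

lemma head_tendsto: "(\<lambda>T. head_ell2 T (coord x)) \<longlonglongrightarrow> x"
proof -
  have "(\<lambda>T. sqrt ((norm (x - head_ell2 T (coord x)))\<^sup>2)) \<longlonglongrightarrow> sqrt 0"
    unfolding norm_diff_head by (intro tendsto_intros tail_sq_tendsto_0)
  then have "(\<lambda>T. norm (head_ell2 T (coord x) - x)) \<longlonglongrightarrow> 0"
    by (simp add: norm_minus_commute)
  then show ?thesis by (rule Lim_null[THEN iffD2, OF tendsto_norm_zero_cancel])
qed

text \<open>The Borel sets of the norm are reached from the coordinates: every element is the norm
  limit of its truncations, and these depend continuously on the coordinate sequence.\<close>

lemma measurable_ell2I:
  assumes "\<And>i. (\<lambda>\<omega>. coord (Z \<omega>) i) \<in> borel_measurable M"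
  shows "Z \<in> borel_measurable M"
proof (rule borel_measurable_LIMSEQ_metric)
  show "(\<lambda>T. head_ell2 T (coord (Z \<omega>))) \<longlonglongrightarrow> Z \<omega>" for \<omega> by (rule head_tendsto)
  have "(\<lambda>\<omega>. coord (Z \<omega>)) \<in> borel_measurable M"
    using assms by (rule measurable_coordinatewise_then_product)
  then show "(\<lambda>\<omega>. head_ell2 T (coord (Z \<omega>))) \<in> borel_measurable M" for T
    by (rule measurable_compose[OF _ borel_measurable_continuous_onI[OF continuous_on_head]])
qed

lemma inner_head: "h \<bullet> head_ell2 T y = (\<Sum>i<T. coord h i * y i)"
proof -
  have "(\<lambda>i. coord h i * coord (head_ell2 T y) i) sums (\<Sum>i<T. coord h i * coord (head_ell2 T y) i)"
    by (rule sums_finite) (auto simp: coord_head)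
  then show ?thesis using inner_ell2_sums[of h "head_ell2 T y"]
    by (auto dest: sums_unique2 simp: coord_head)
qed

section \<open>Lipschitz test functions determine convergence in distribution\<close>

text \<open>The inf-convolutions \<open>INF y. f y + k * dist x y\<close> are Lipschitz and increase to \<open>f\<close>.\<close>

lemma lipschitz_approx_below:
  fixes f :: "'b::metric_space \<Rightarrow> real"
  assumes cont: "continuous_on UNIV f" and B: "\<And>x. \<bar>f x\<bar> \<le> B"
  defines "g \<equiv> \<lambda>k x. INF y. f y + real k * dist x y"
  shows "\<bar>g k x - g k y\<bar> \<le> real k * dist x y" "g k x \<le> f x" "\<bar>g k x\<bar> \<le> B" "(\<lambda>k. g k x) \<longlonglongrightarrow> f x"
proof -
  have lb: "- B \<le> f y + real k * dist x y" for k x y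
    using B[of y] by (smt (verit) mult_nonneg_nonneg of_nat_0_le_iff zero_le_dist)
  then have bdd: "bdd_below (range (\<lambda>y. f y + real k * dist x y))" for k x
    by (intro bdd_belowI[of _ "- B"]) auto
  have up: "g k x \<le> f y + real k * dist x y" for k x y
    unfolding g_def by (rule cINF_lower[OF bdd]) simp
  have low: "c \<le> g k x" if "\<And>y. c \<le> f y + real k * dist x y" for c k x
    unfolding g_def by (rule cINF_greatest) (use that in auto)
  have "g k x - real k * dist x y \<le> g k y" for k x y
  proof (rule low)
    fix z
    have "g k x \<le> f z + real k * dist x z" by (rule up)
    also have "\<dots> \<le> f z + real k * (dist x y + dist y z)"
      by (intro add_left_mono mult_left_mono dist_triangle) auto
    finally show "g k x - real k * dist x y \<le> f z + real k * dist y z" by (simp add: algebra_simps)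
  qed
  from this[of k x y] this[of k y x] show "\<bar>g k x - g k y\<bar> \<le> real k * dist x y"
    by (simp add: dist_commute abs_le_iff)
  show le: "g k x \<le> f x" for k using up[of k x x] by simp
  show "\<bar>g k x\<bar> \<le> B" using le[of k] low[of "- B" k x] lb B[of x] by (simp add: abs_le_iff)
  show "(\<lambda>k. g k x) \<longlonglongrightarrow> f x"
  proof (rule LIMSEQ_I)
    fix e :: real assume "0 < e"
    then obtain d where d: "d > 0" "\<And>y. dist y x < d \<Longrightarrow> dist (f y) (f x) < e / 2"
      using cont unfolding continuous_on_iff by (metis UNIV_I half_gt_zero)
    obtain K :: nat where K: "2 * B / d \<le> real K" using real_arch_simple by blast
    have "norm (g k x - f x) < e" if "K \<le> k" for k
    proof -
      have "f x - e / 2 \<le> g k x"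
      proof (rule low)
        fix y
        show "f x - e / 2 \<le> f y + real k * dist x y"
        proof (cases "dist y x < d")
          case True
          then have "f x - e / 2 \<le> f y" using d(2)[of y] unfolding dist_real_def by linarith
          moreover have "0 \<le> real k * dist x y" by simp
          ultimately show ?thesis by linarith
        next
          case False
          have "2 * B \<le> real K * d" using K d by (simp add: divide_le_eq)
          also have "\<dots> \<le> real k * dist x y" using False that d
            by (intro mult_mono) (auto simp: dist_commute)
          finally show ?thesis using B[of x] B[of y] \<open>0 < e\<close> by (simp add: abs_le_iff)
        qed
      qed
      then show ?thesis using le[of k] \<open>0 < e\<close> by (simp add: abs_less_iff)
    qed
    then show "\<exists>K. \<forall>k\<ge>K. norm (g k x - f x) < e" by blast
  qed
qed

lemma (in prob_space) integrable_bounded: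
  fixes f :: "'a \<Rightarrow> real"
  assumes "f \<in> borel_measurable M" "\<And>x. \<bar>f x\<bar> \<le> B"
  shows "integrable M f"
  by (rule integrable_const_bound[of _ B]) (use assms in auto)

text \<open>The Lipschitz minorants \<open>g k\<close> increase to \<open>f\<close>, so by dominated
  convergence one of them has almost the same integral under \<open>N\<close>. Minorants bound
  \<open>f\<close> from one side only; the upper bound is the lower bound for
  \<open>- f\<close>.\<close>

lemma tendsto_in_distr_lipschitzI:
  fixes Y :: "nat \<Rightarrow> 'a \<Rightarrow> 'b::metric_space"
  assumes "prob_space M" and [measurable]: "\<And>n. Y n \<in> borel_measurable M"
    and "prob_space N" and setsN: "sets N = sets borel"
    and conv: "\<And>(f :: 'b \<Rightarrow> real) L B. 0 \<le> L \<Longrightarrow> (\<And>x y. \<bar>f x - f y\<bar> \<le> L * dist x y) \<Longrightarrow> (\<And>x. \<bar>f x\<bar> \<le> B) \<Longrightarrow>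
       continuous_on UNIV f \<Longrightarrow> (\<lambda>n. \<integral>\<omega>. f (Y n \<omega>) \<partial>M) \<longlonglongrightarrow> (\<integral>x. f x \<partial>N)"
  shows "tendsto_in_distr M Y N"
proof -
  interpret M: prob_space M by fact
  interpret N: prob_space N by fact
  have meas [measurable]: "f \<in> borel_measurable borel" if "continuous_on UNIV f" for f :: "'b \<Rightarrow> real"
    using that by (rule borel_measurable_continuous_onI)
  have measN: "f \<in> borel_measurable N" if "continuous_on UNIV f" for f :: "'b \<Rightarrow> real"
    using meas[OF that] setsN by (simp cong: measurable_cong_sets)
  have lower: "\<forall>\<^sub>F n in sequentially. (\<integral>x. f x \<partial>N) - e < (\<integral>\<omega>. f (Y n \<omega>) \<partial>M)"
    if cont: "continuous_on UNIV f" and B: "\<And>x. \<bar>f x\<bar> \<le> B" and e: "0 < e" for f :: "'b \<Rightarrow> real" and B e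
  proof -
    define g where "g k x = (INF y. f y + real k * dist x y)" for k x
    note g = lipschitz_approx_below[OF cont B, folded g_def]
    have gc: "continuous_on UNIV (g k)" for k
    proof (rule lipschitz_on_continuous_on[of "real k"], rule lipschitz_onI)
      show "dist (g k x) (g k y) \<le> real k * dist x y" for x y using g(1)[of k x y] by (simp add: dist_real_def)
    qed simp
    have "(\<lambda>k. \<integral>x. g k x \<partial>N) \<longlonglongrightarrow> (\<integral>x. f x \<partial>N)"
      by (rule integral_dominated_convergence[where w = "\<lambda>_. B"])
        (use g(3,4) in \<open>auto intro: measN gc cont\<close>)
    then have "\<forall>\<^sub>F k in sequentially. (\<integral>x. f x \<partial>N) - e / 2 < (\<integral>x. g k x \<partial>N)"
      by (rule order_tendstoD(1)) (use e in auto)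
    then obtain k where k: "(\<integral>x. f x \<partial>N) - e / 2 < (\<integral>x. g k x \<partial>N)" by (auto dest: eventually_happens)
    have "(\<lambda>n. \<integral>\<omega>. g k (Y n \<omega>) \<partial>M) \<longlonglongrightarrow> (\<integral>x. g k x \<partial>N)"
      by (rule conv[of "real k" _ B]) (use g gc in auto)
    then have "\<forall>\<^sub>F n in sequentially. (\<integral>x. g k x \<partial>N) - e / 2 < (\<integral>\<omega>. g k (Y n \<omega>) \<partial>M)"
      by (rule order_tendstoD(1)) (use e in auto)
    then show ?thesis
    proof eventually_elim
      case (elim n)
      have "(\<integral>\<omega>. g k (Y n \<omega>) \<partial>M) \<le> (\<integral>\<omega>. f (Y n \<omega>) \<partial>M)"
        by (intro integral_mono M.integrable_bounded[of _ B] g(2) g(3) B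
            measurable_compose[OF _ meas[OF gc]] measurable_compose[OF _ meas[OF cont]]) measurable
      then show ?case using elim k by linarith
    qed
  qed
  have "(\<lambda>n. \<integral>\<omega>. f (Y n \<omega>) \<partial>M) \<longlonglongrightarrow> (\<integral>x. f x \<partial>N)"
    if cont: "continuous_on UNIV f" and "bounded (range f)" for f :: "'b \<Rightarrow> real"
  proof -
    obtain B where B: "\<And>x. \<bar>f x\<bar> \<le> B" using \<open>bounded (range f)\<close> by (auto simp: bounded_iff)
    show ?thesis
    proof (rule order_tendstoI)
      fix a assume "a < (\<integral>x. f x \<partial>N)"
      then show "\<forall>\<^sub>F n in sequentially. a < (\<integral>\<omega>. f (Y n \<omega>) \<partial>M)"
        using lower[OF cont B, of "(\<integral>x. f x \<partial>N) - a"] by simp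
    next
      fix a assume "(\<integral>x. f x \<partial>N) < a"
      then show "\<forall>\<^sub>F n in sequentially. (\<integral>\<omega>. f (Y n \<omega>) \<partial>M) < a"
        using lower[of "\<lambda>x. - f x" B "a - (\<integral>x. f x \<partial>N)"] B cont by (simp add: continuous_on_minus)
    qed
  qed
  then show ?thesis unfolding tendsto_in_distr_def using assms by simp
qed

section \<open>Convergence of finitely many coordinates\<close>

text \<open>Real trigonometric polynomials in the first \<open>T\<close> coordinates. The free phase
  \<open>b\<close> covers the sines. The generators see \<open>x\<close> only through one linear
  combination, which is what a one-dimensional limit theorem controls.\<close>

inductive trig :: "nat \<Rightarrow> ((nat \<Rightarrow> real) \<Rightarrow> real) \<Rightarrow> bool" for T where
  cos: "trig T (\<lambda>x. cos ((\<Sum>i<T. h i * x i) + b))"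
| add: "trig T f \<Longrightarrow> trig T g \<Longrightarrow> trig T (\<lambda>x. f x + g x)"
| scale: "trig T f \<Longrightarrow> trig T (\<lambda>x. a * f x)"

text \<open>The product-to-sum formula writes the product of two generators as a sum of generators;
  the span is therefore an algebra, as Stone-Weierstrass requires.\<close>

lemma trig_mult_cos: "trig T g \<Longrightarrow> trig T (\<lambda>x. cos ((\<Sum>i<T. h i * x i) + b) * g x)"
proof (induction rule: trig.induct)
  case (cos h' b')
  have "cos ((\<Sum>i<T. h i * x i) + b) * cos ((\<Sum>i<T. h' i * x i) + b') =
     1 / 2 * cos ((\<Sum>i<T. (h i - h' i) * x i) + (b - b')) + 1 / 2 * cos ((\<Sum>i<T. (h i + h' i) * x i) + (b + b'))"
    for x :: "nat \<Rightarrow> real"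
    by (simp add: cos_times_cos sum.distrib sum_subtractf algebra_simps add_divide_distrib)
  then show ?case by (simp only:) (intro trig.intros)
next
  case (add f g)
  then show ?case by (simp only: distrib_left) (intro trig.intros)
next
  case (scale f a)
  then have "trig T (\<lambda>x. a * (cos ((\<Sum>i<T. h i * x i) + b) * f x))" by (intro trig.intros)
  then show ?case by (simp only: mult.left_commute)
qed

lemma trig_mult: "trig T f \<Longrightarrow> trig T g \<Longrightarrow> trig T (\<lambda>x. f x * g x)"
proof (induction rule: trig.induct)
  case (cos h b)
  then show ?case by (rule trig_mult_cos)
next
  case (add f f')
  then have "trig T (\<lambda>x. f x * g x + f' x * g x)" by (intro trig.intros) auto
  then show ?case by (simp only: distrib_right)
next
  case (scale f a)
  then have "trig T (\<lambda>x. a * (f x * g x))" by (intro trig.intros)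
  then show ?case by (simp only: mult.assoc)
qed

lemma trig_const: "trig T (\<lambda>x. c)"
  using trig.scale[OF trig.cos[of T "\<lambda>_. 0" 0], of c] by simp

lemma trig_sin: "i < T \<Longrightarrow> trig T (\<lambda>x. sin (x i / R))"
  using trig.cos[of T "\<lambda>j. if j = i then 1 / R else 0" "- (pi / 2)"]
  by (simp add: if_distrib[where f = "\<lambda>a. a * _"] cos_diff cong: if_cong)

lemma trig_continuous: "trig T g \<Longrightarrow> continuous_on UNIV g"
  by (induction rule: trig.induct)
    (intro continuous_intros continuous_on_product_coordinates; assumption)+

lemma trig_bounded: "trig T g \<Longrightarrow> \<exists>B. \<forall>x. \<bar>g x\<bar> \<le> B"
proof (induction rule: trig.induct)
  case (cos h b)
  then show ?case by (intro exI[of _ 1]) auto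
next
  case (add f g)
  then obtain B B' where "\<forall>x. \<bar>f x\<bar> \<le> B" "\<forall>x. \<bar>g x\<bar> \<le> B'" by blast
  then have "\<bar>f x + g x\<bar> \<le> B + B'" for x
    by (intro order_trans[OF abs_triangle_ineq add_mono]) auto
  then show ?case by blast
next
  case (scale f a)
  then obtain B where "\<forall>x. \<bar>f x\<bar> \<le> B" by blast
  then have "\<bar>a * f x\<bar> \<le> \<bar>a\<bar> * B" for x by (simp add: abs_mult mult_left_mono)
  then show ?case by blast
qed

lemma (in prob_space) trig_integrable:
  assumes "trig T g" and [measurable]: "X \<in> borel_measurable M"
  shows "integrable M (\<lambda>\<omega>. g (X \<omega>))"
proof -
  obtain B where B: "\<And>x. \<bar>g x\<bar> \<le> B" using trig_bounded[OF assms(1)] by blast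
  show ?thesis
    by (rule integrable_bounded[of _ B])
      (use B measurable_compose[OF assms(2) borel_measurable_continuous_onI[OF trig_continuous[OF assms(1)]]] in auto)
qed

lemma trig_convergence:
  assumes "prob_space M" "prob_space N"
    and [measurable]: "\<And>n. X n \<in> borel_measurable M" "Y \<in> borel_measurable N"
    and conv: "\<And>h b. (\<lambda>n. \<integral>\<omega>. cos ((\<Sum>i<T. h i * X n \<omega> i) + b) \<partial>M) \<longlonglongrightarrow> (\<integral>x. cos ((\<Sum>i<T. h i * Y x i) + b) \<partial>N)"
    and "trig T g"
  shows "(\<lambda>n. \<integral>\<omega>. g (X n \<omega>) \<partial>M) \<longlonglongrightarrow> (\<integral>x. g (Y x) \<partial>N)"
  using \<open>trig T g\<close>
proof (induction rule: trig.induct)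
  case (cos h b)
  show ?case by (rule conv)
next
  case (add f g)
  then show ?case
    using prob_space.trig_integrable[OF assms(1) _ assms(3)] prob_space.trig_integrable[OF assms(2) _ assms(4)]
    by (simp add: tendsto_add)
next
  case (scale f a)
  then show ?case by (simp add: tendsto_mult_left)
qed

text \<open>In the coordinates \<open>s = sin (x / R)\<close>, which are injective for \<open>\<bar>x\<bar> \<le> R\<close>, trigonometric
  polynomials become polynomials on a cube. The error bound is global because \<open>s\<close> never leaves
  the cube.\<close>

lemma trig_approximation:
  fixes F :: "(nat \<Rightarrow> real) \<Rightarrow> real"
  assumes cont: "continuous_on UNIV F" and B: "\<And>x. \<bar>F x\<bar> \<le> B" and R: "0 < R" and e: "0 < e"
  obtains g where "trig T g" "\<And>x. \<bar>g x\<bar> \<le> B + e"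
    "\<And>x. (\<forall>i<T. \<bar>x i\<bar> \<le> R) \<Longrightarrow> \<bar>F (\<lambda>i. if i < T then x i else 0) - g x\<bar> \<le> e"
proof -
  \<comment> \<open>Coordinates from \<open>T\<close> on are pinned to 0, so that the coordinates
    below \<open>T\<close>, which turn into sines under \<open>\<sigma>\<close>, separate the points
    of \<open>S\<close>.\<close>
  define S :: "(nat \<Rightarrow> real) set" where "S = {y. \<forall>i. y i \<in> (if i < T then {-1..1} else {0})}"
  define \<sigma> where "\<sigma> x i = (if i < T then sin (x i / R) else 0)" for x :: "nat \<Rightarrow> real" and i
  define \<A> where "\<A> = {f. continuous_on S f \<and> trig T (\<lambda>x. f (\<sigma> x))}"
  \<comment> \<open>This is \<open>F\<close> read in sine coordinates. For
    \<open>\<bar>x i\<bar> \<le> R\<close> the quotient \<open>x i / R\<close> lies in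
    \<open>[-1, 1]\<close>, where \<open>arcsin\<close> inverts \<open>sin\<close> because
    \<open>1 \<le> pi / 2\<close>.\<close>
  define G where "G s = F (\<lambda>i. if i < T then R * arcsin (s i) else 0)" for s :: "nat \<Rightarrow> real"
  have \<sigma>S: "\<sigma> x \<in> S" for x by (simp add: S_def \<sigma>_def)
  have cS: "compact S"
    using compactin_PiE[of "\<lambda>_. euclidean" "UNIV::nat set" "\<lambda>i. if i < T then {-1..1::real} else {0}"]
    by (simp add: euclidean_product_topology PiE_UNIV_domain Pi_def S_def)
  interpret function_ring_on \<A> S
  proof
    show "compact S" by fact
  next
    fix f assume "f \<in> \<A>"
    then show "continuous_on S f" by (simp add: \<A>_def)
  next
    fix f g assume "f \<in> \<A>" "g \<in> \<A>"
    then show "(\<lambda>x. f x + g x) \<in> \<A>" "(\<lambda>x. f x * g x) \<in> \<A>"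
      unfolding \<A>_def by (auto intro!: continuous_intros trig.add trig_mult)
  next
    show "(\<lambda>_. c) \<in> \<A>" for c by (simp add: \<A>_def trig_const)
  next
    fix x y assume "x \<in> S" "y \<in> S" "x \<noteq> y"
    then obtain i where "x i \<noteq> y i" by blast
    then have "i < T" using \<open>x \<in> S\<close> \<open>y \<in> S\<close> by (force simp: S_def split: if_splits)
    then have "(\<lambda>s. s i) \<in> \<A>"
      by (simp add: \<A>_def \<sigma>_def trig_sin continuous_on_subset[OF continuous_on_product_coordinates])
    then show "\<exists>f\<in>\<A>. f x \<noteq> f y" using \<open>x i \<noteq> y i\<close> by (intro bexI[of _ "\<lambda>s. s i"])
  qed
  have "continuous_on S (\<lambda>s i. if i < T then R * arcsin (s i) else 0)"
  proof (rule continuous_on_coordinatewise_then_product)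
    fix i
    show "continuous_on S (\<lambda>s. if i < T then R * arcsin (s i) else 0)"
    proof (cases "i < T")
      case True
      have "\<forall>s\<in>S. - 1 \<le> s i \<and> s i \<le> 1"
        unfolding S_def using True by (smt (verit) atLeastAtMost_iff mem_Collect_eq)
      then have "continuous_on S (\<lambda>s. R * arcsin (s i))"
        by (intro continuous_intros continuous_on_arcsin continuous_on_subset[OF continuous_on_product_coordinates]) auto
      then show ?thesis using True by simp
    qed simp
  qed
  then have "continuous_on S G"
    unfolding G_def by (rule continuous_on_compose2[OF cont]) auto
  then obtain p where p: "p \<in> \<A>" "\<And>s. s \<in> S \<Longrightarrow> \<bar>G s - p s\<bar> < e"
    using Stone_Weierstrass_basic e by blast
  show ?thesis
  proof (rule that[of "\<lambda>x. p (\<sigma> x)"])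
    show "trig T (\<lambda>x. p (\<sigma> x))" using p(1) by (simp add: \<A>_def)
    show "\<bar>p (\<sigma> x)\<bar> \<le> B + e" for x
      using p(2)[OF \<sigma>S, of x] B[of "\<lambda>i. if i < T then R * arcsin (\<sigma> x i) else 0"] unfolding G_def by linarith
    fix x :: "nat \<Rightarrow> real" assume x: "\<forall>i<T. \<bar>x i\<bar> \<le> R"
    have "R * arcsin (\<sigma> x i) = x i" if "i < T" for i
    proof -
      have "\<bar>x i / R\<bar> \<le> 1" using x that R by (simp add: abs_divide)
      moreover have "1 \<le> pi / 2" using pi_ge_two by simp
      ultimately have "- (pi / 2) \<le> x i / R" "x i / R \<le> pi / 2" by linarith+
      then have "arcsin (sin (x i / R)) = x i / R" by (rule arcsin_sin)
      then show ?thesis using that R by (simp add: \<sigma>_def)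
    qed
    then have "G (\<sigma> x) = F (\<lambda>i. if i < T then x i else 0)" unfolding G_def by (metis (no_types, lifting))
    then show "\<bar>F (\<lambda>i. if i < T then x i else 0) - p (\<sigma> x)\<bar> \<le> e" using p(2)[OF \<sigma>S, of x] by simp
  qed
qed

text \<open>Chebyshev's inequality in pointwise form: outside the cube the difference is still at
  most \<open>2 * B + e\<close>, and some coordinate exceeds \<open>R\<close>, so the factor
  \<open>(\<Sum>i<T. (x i)\<^sup>2) / R\<^sup>2\<close> is at least 1.\<close>

lemma (in prob_space) trig_approximation_expectation:
  fixes X :: "'a \<Rightarrow> nat \<Rightarrow> real"
  assumes [measurable]: "X \<in> borel_measurable M"
    and int: "integrable M (\<lambda>\<omega>. \<Sum>i<T. (X \<omega> i)\<^sup>2)" and C: "(\<integral>\<omega>. (\<Sum>i<T. (X \<omega> i)\<^sup>2) \<partial>M) \<le> C"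
    and cont: "continuous_on UNIV F" and B: "\<And>x. \<bar>F x\<bar> \<le> B" and R: "0 < R" and e: "0 < e"
    and g: "trig T g" "\<And>x. \<bar>g x\<bar> \<le> B + e"
      "\<And>x. (\<forall>i<T. \<bar>x i\<bar> \<le> R) \<Longrightarrow> \<bar>F (\<lambda>i. if i < T then x i else 0) - g x\<bar> \<le> e"
  shows "\<bar>(\<integral>\<omega>. F (\<lambda>i. if i < T then X \<omega> i else 0) \<partial>M) - (\<integral>\<omega>. g (X \<omega>) \<partial>M)\<bar> \<le> e + (2 * B + e) * (C / R\<^sup>2)"
proof -
  let ?t = "\<lambda>x i. if i < T then x i else (0::real)"
  have B0: "0 \<le> B" using B[of "\<lambda>_. 0"] by linarith
  have ct: "continuous_on UNIV ?t"
    by (rule continuous_on_coordinatewise_then_product, rename_tac i, case_tac "i < T")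
      (simp_all add: continuous_on_product_coordinates)
  have "continuous_on UNIV (\<lambda>x. F (?t x))"
    by (rule continuous_on_compose2[OF cont ct]) auto
  then have "(\<lambda>\<omega>. F (?t (X \<omega>))) \<in> borel_measurable M"
    by (intro measurable_compose[OF assms(1)] borel_measurable_continuous_onI)
  then have iF: "integrable M (\<lambda>\<omega>. F (?t (X \<omega>)))" using B by (rule integrable_bounded)
  have ig: "integrable M (\<lambda>\<omega>. g (X \<omega>))" by (rule trig_integrable[OF g(1)]) measurable
  have pt: "\<bar>F (?t x) - g x\<bar> \<le> e + (2 * B + e) * ((\<Sum>i<T. (x i)\<^sup>2) / R\<^sup>2)" for x
  proof (cases "\<forall>i<T. \<bar>x i\<bar> \<le> R")
    case True
    have "0 \<le> (2 * B + e) * ((\<Sum>i<T. (x i)\<^sup>2) / R\<^sup>2)"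
      using B0 e by (intro mult_nonneg_nonneg divide_nonneg_nonneg sum_nonneg) auto
    then show ?thesis using g(3)[OF True] by linarith
  next
    case False
    then obtain i where i: "i < T" "R < \<bar>x i\<bar>" by (auto simp: not_le)
    have "R\<^sup>2 \<le> (x i)\<^sup>2" using i R by (metis abs_le_square_iff abs_of_pos less_imp_le)
    also have "\<dots> \<le> (\<Sum>i<T. (x i)\<^sup>2)" by (rule member_le_sum) (use i in auto)
    finally have "1 \<le> (\<Sum>i<T. (x i)\<^sup>2) / R\<^sup>2" using R by simp
    then have "(2 * B + e) * 1 \<le> (2 * B + e) * ((\<Sum>i<T. (x i)\<^sup>2) / R\<^sup>2)"
      using B0 e by (intro mult_left_mono) auto
    then have "2 * B + e \<le> (2 * B + e) * ((\<Sum>i<T. (x i)\<^sup>2) / R\<^sup>2)" by (simp only: mult_1_right)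
    moreover have "\<bar>F (?t x) - g x\<bar> \<le> 2 * B + e"
      using abs_triangle_ineq4[of "F (?t x)" "g x"] B[of "?t x"] g(2)[of x] by linarith
    ultimately show ?thesis using e by linarith
  qed
  have "\<bar>(\<integral>\<omega>. F (?t (X \<omega>)) \<partial>M) - (\<integral>\<omega>. g (X \<omega>) \<partial>M)\<bar> = \<bar>\<integral>\<omega>. F (?t (X \<omega>)) - g (X \<omega>) \<partial>M\<bar>"
    using iF ig by simp
  also have "\<dots> \<le> (\<integral>\<omega>. \<bar>F (?t (X \<omega>)) - g (X \<omega>)\<bar> \<partial>M)" by (rule integral_abs_bound)
  also have "\<dots> \<le> (\<integral>\<omega>. e + (2 * B + e) * ((\<Sum>i<T. (X \<omega> i)\<^sup>2) / R\<^sup>2) \<partial>M)"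
    by (intro integral_mono integrable_abs Bochner_Integration.integrable_add Bochner_Integration.integrable_diff iF ig
        integrable_mult_right integrable_divide int pt) auto
  also have "\<dots> = e + (2 * B + e) * ((\<integral>\<omega>. (\<Sum>i<T. (X \<omega> i)\<^sup>2) \<partial>M) / R\<^sup>2)"
    using int by (simp add: prob_space)
  also have "\<dots> \<le> e + (2 * B + e) * (C / R\<^sup>2)"
    using B0 e C by (intro add_left_mono mult_left_mono divide_right_mono) auto
  finally show ?thesis .
qed

text \<open>The Cramer-Wold device, with tightness supplied by the common second moment bound
  \<open>C\<close>. Replacing \<open>F\<close> by one trigonometric polynomial costs
  \<open>r / 4\<close> under each law, uniformly in \<open>n\<close>; what remains is the
  convergence for that polynomial.\<close>

lemma fdd_convergence:
  fixes X :: "nat \<Rightarrow> 'a \<Rightarrow> nat \<Rightarrow> real" and Y :: "'b \<Rightarrow> nat \<Rightarrow> real"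
    and F :: "(nat \<Rightarrow> real) \<Rightarrow> real"
  assumes M: "prob_space M" and N: "prob_space N"
    and meas: "\<And>n. X n \<in> borel_measurable M" "Y \<in> borel_measurable N"
    and conv: "\<And>h b. (\<lambda>n. \<integral>\<omega>. cos ((\<Sum>i<T. h i * X n \<omega> i) + b) \<partial>M) \<longlonglongrightarrow> (\<integral>x. cos ((\<Sum>i<T. h i * Y x i) + b) \<partial>N)"
    and X2: "\<And>n. integrable M (\<lambda>\<omega>. \<Sum>i<T. (X n \<omega> i)\<^sup>2)" "\<And>n. (\<integral>\<omega>. (\<Sum>i<T. (X n \<omega> i)\<^sup>2) \<partial>M) \<le> C"
    and Y2: "integrable N (\<lambda>x. \<Sum>i<T. (Y x i)\<^sup>2)" "(\<integral>x. (\<Sum>i<T. (Y x i)\<^sup>2) \<partial>N) \<le> C"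
    and cont: "continuous_on UNIV F" and B: "\<And>x. \<bar>F x\<bar> \<le> B"
  shows "(\<lambda>n. \<integral>\<omega>. F (\<lambda>i. if i < T then X n \<omega> i else 0) \<partial>M) \<longlonglongrightarrow> (\<integral>x. F (\<lambda>i. if i < T then Y x i else 0) \<partial>N)"
proof (rule LIMSEQ_I)
  fix r :: real assume r: "0 < r"
  define e where "e = min 1 (r / 8)"
  have e: "0 < e" "e \<le> 1" "e \<le> r / 8" using r by (auto simp: e_def)
  have B0: "0 \<le> B" using B[of "\<lambda>_. 0"] by linarith
  have C0: "0 \<le> C"
    using Y2(2) by (rule order_trans[rotated]) (auto intro!: integral_nonneg_AE sum_nonneg)
  \<comment> \<open>Chosen so that \<open>(2 * B + 1) * (C / R\<^sup>2) \<le> r / 8\<close>; the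
    summand 1 keeps \<open>R\<close> positive when \<open>C = 0\<close>.\<close>
  define R where "R = sqrt ((2 * B + 1) * C * 8 / r + 1)"
  have R2: "R\<^sup>2 = (2 * B + 1) * C * 8 / r + 1"
    unfolding R_def using B0 C0 r by (intro real_sqrt_pow2) auto
  have R: "0 < R" unfolding R_def using B0 C0 r by (intro real_sqrt_gt_zero add_nonneg_pos) auto
  have "(2 * B + 1) * C \<le> r / 8 * R\<^sup>2"
    unfolding R2 using r by (simp add: field_simps)
  then have "(2 * B + 1) * (C / R\<^sup>2) \<le> r / 8"
    using R by (simp add: divide_le_eq)
  moreover have "(2 * B + e) * (C / R\<^sup>2) \<le> (2 * B + 1) * (C / R\<^sup>2)"
    using e C0 by (intro mult_right_mono) auto
  ultimately have small: "e + (2 * B + e) * (C / R\<^sup>2) \<le> r / 4" using e by linarith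
  obtain g where g: "trig T g" "\<And>x. \<bar>g x\<bar> \<le> B + e"
      "\<And>x. (\<forall>i<T. \<bar>x i\<bar> \<le> R) \<Longrightarrow> \<bar>F (\<lambda>i. if i < T then x i else 0) - g x\<bar> \<le> e"
    using trig_approximation[OF cont B R e(1)] by blast
  let ?EF = "\<lambda>n. \<integral>\<omega>. F (\<lambda>i. if i < T then X n \<omega> i else 0) \<partial>M"
  let ?NF = "\<integral>x. F (\<lambda>i. if i < T then Y x i else 0) \<partial>N"
  have 1: "\<bar>?EF n - (\<integral>\<omega>. g (X n \<omega>) \<partial>M)\<bar> \<le> r / 4" for n
    using prob_space.trig_approximation_expectation[OF M meas(1) X2 cont B R e(1) g] small by (rule order_trans)
  have 2: "\<bar>?NF - (\<integral>x. g (Y x) \<partial>N)\<bar> \<le> r / 4"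
    using prob_space.trig_approximation_expectation[OF N meas(2) Y2 cont B R e(1) g] small by (rule order_trans)
  have "(\<lambda>n. \<integral>\<omega>. g (X n \<omega>) \<partial>M) \<longlonglongrightarrow> (\<integral>x. g (Y x) \<partial>N)"
    using M N meas conv g(1) by (rule trig_convergence)
  then obtain n0 where n0: "\<And>n. n \<ge> n0 \<Longrightarrow> norm ((\<integral>\<omega>. g (X n \<omega>) \<partial>M) - (\<integral>x. g (Y x) \<partial>N)) < r / 4"
    using LIMSEQ_D[of _ _ "r / 4"] r by (metis zero_less_divide_iff zero_less_numeral)
  have "norm (?EF n - ?NF) < r" if "n \<ge> n0" for n
    using 1[of n] 2 n0[OF that] r unfolding real_norm_def by linarith
  then show "\<exists>n0. \<forall>n\<ge>n0. norm (?EF n - ?NF) < r" by blast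
qed

section \<open>Gaussian laws on the sequence space\<close>

lemma real_distribution_centred_normal: "real_distribution (centred_normal \<sigma>)"
proof (cases "\<sigma> = 0")
  case True
  interpret prob_space "return borel (0::real)" by (rule prob_space_return) simp
  show ?thesis using True
    by (simp add: centred_normal_def real_distribution_def real_distribution_axioms_def prob_space_axioms)
next
  case False
  show ?thesis
  proof (cases "0 < \<sigma>")
    case True
    then show ?thesis using prob_space_normal_density[OF True, of 0] False
      by (simp add: centred_normal_def real_distribution_def real_distribution_axioms_def)
  next
    case neg: False
    have "normal_density 0 \<sigma> = normal_density 0 (- \<sigma>)" by (simp add: normal_density_def fun_eq_iff)
    then show ?thesis using prob_space_normal_density[of "- \<sigma>" 0] False neg
      by (simp add: centred_normal_def real_distribution_def real_distribution_axioms_def)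
  qed
qed

lemma char_centred_normal:
  assumes "0 \<le> \<sigma>"
  shows "char (centred_normal \<sigma>) t = complex_of_real (exp (- (\<sigma>\<^sup>2 * t\<^sup>2 / 2)))"
proof (cases "\<sigma> = 0")
  case True
  then show ?thesis by (simp add: centred_normal_def char_def integral_return)
next
  case False
  then have \<sigma>: "0 < \<sigma>" using assms by simp
  let ?M = "density lborel (\<lambda>x. ennreal (normal_density 0 \<sigma> x))"
  interpret prob_space ?M by (rule prob_space_normal_density[OF \<sigma>])
  have "distributed ?M lborel (\<lambda>x. x) (\<lambda>x. ennreal (normal_density 0 \<sigma> x))"
    by (simp add: distributed_def distr_id2)
  then have "distributed ?M lborel (\<lambda>x. x / \<sigma>) (\<lambda>x. ennreal (std_normal_density x))"
    using normal_standard_normal_convert[OF \<sigma>, of "\<lambda>x. x" 0] by simp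
  then have d: "distr ?M lborel (\<lambda>x. x / \<sigma>) = std_normal_distribution"
    by (simp add: distributed_def)
  have "char (centred_normal \<sigma>) t = (\<integral>x. iexp ((t * \<sigma>) * (x / \<sigma>)) \<partial>?M)"
    using False by (simp add: centred_normal_def char_def)
  also have "\<dots> = (\<integral>x. iexp ((t * \<sigma>) * x) \<partial>distr ?M lborel (\<lambda>x. x / \<sigma>))"
    by (rule integral_distr[symmetric]) auto
  also have "\<dots> = char std_normal_distribution (t * \<sigma>)" unfolding d char_def ..
  finally show ?thesis by (simp add: char_std_normal_distribution power_mult_distrib mult.commute)
qed

text \<open>Expectation and sum of squares are interchanged. The bound depends on \<open>s\<close>
  alone: with \<open>s = pmf p\<close> it serves all sample sizes and the limit law at once.\<close>

lemma tail_sq_expectation: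
  assumes "prob_space P" and Z: "Z \<in> borel_measurable P"
    and int: "\<And>i. integrable P (\<lambda>\<omega>. (coord (Z \<omega>) i)\<^sup>2)"
    and le: "\<And>i. (\<integral>\<omega>. (coord (Z \<omega>) i)\<^sup>2 \<partial>P) \<le> s i" and s: "summable s"
  shows "integrable P (\<lambda>\<omega>. tail_sq T (Z \<omega>))" "(\<integral>\<omega>. tail_sq T (Z \<omega>) \<partial>P) \<le> (\<Sum>i. s (i + T))"
proof -
  have sT: "summable (\<lambda>i. s (i + T))" using s by (rule summable_ignore_initial_segment)
  have nonneg: "0 \<le> (\<integral>\<omega>. (coord (Z \<omega>) (i + T))\<^sup>2 \<partial>P)" for i by (rule integral_nonneg_AE) simp
  have sm: "summable (\<lambda>i. \<integral>\<omega>. (coord (Z \<omega>) (i + T))\<^sup>2 \<partial>P)"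
    by (rule summable_comparison_test'[OF sT, of 0]) (use nonneg le in auto)
  have ae: "AE \<omega> in P. summable (\<lambda>i. norm ((coord (Z \<omega>) (i + T))\<^sup>2))"
    by (simp add: summable_ignore_initial_segment[OF coord_summable])
  show "integrable P (\<lambda>\<omega>. tail_sq T (Z \<omega>))"
    unfolding tail_sq_def by (rule integrable_suminf[OF int ae]) (use sm in simp)
  have "(\<integral>\<omega>. tail_sq T (Z \<omega>) \<partial>P) = (\<Sum>i. \<integral>\<omega>. (coord (Z \<omega>) (i + T))\<^sup>2 \<partial>P)"
    unfolding tail_sq_def by (rule integral_suminf[OF int ae]) (use sm in simp)
  also have "\<dots> \<le> (\<Sum>i. s (i + T))" by (rule suminf_le[OF le sm sT])
  finally show "(\<integral>\<omega>. tail_sq T (Z \<omega>) \<partial>P) \<le> (\<Sum>i. s (i + T))" .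
qed

lemma norm_head_le: "norm (head_ell2 T (coord x)) \<le> norm x"
proof -
  have "(norm (head_ell2 T (coord x)))\<^sup>2 = (\<Sum>i<T. (coord x i)\<^sup>2)"
    by (subst norm_sq_split[where T = T]) (simp add: tail_sq_def coord_head)
  also have "\<dots> \<le> (norm x)\<^sup>2" using norm_sq_split[of x T] tail_sq_nonneg[of T x] by simp
  finally show ?thesis by (rule power2_le_imp_le) simp
qed

text \<open>The finite trace of \<open>S\<close> means that the sum of the squares of the
  \<open>G i\<close> has finite expectation, so the sequence lies in \<open>ell2\<close> almost
  surely. A general functional \<open>h\<close> is the limit of finite combinations, and its law is
  identified by the limit of their characteristic functions.\<close>

lemma gaussian_ell2_exists:
  fixes G :: "nat \<Rightarrow> 'c \<Rightarrow> real"
  assumes P: "prob_space P" and G [measurable]: "\<And>i. G i \<in> borel_measurable P"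
    and cov: "\<And>i i'. has_bochner_integral P (\<lambda>\<omega>. G i \<omega> * G i' \<omega>) (S i i')"
    and S: "summable (\<lambda>i. S i i)"
    and chr: "\<And>h T. (\<integral>\<omega>. iexp (\<Sum>i<T. h i * G i \<omega>) \<partial>P) =
       complex_of_real (exp (- ((\<Sum>i<T. \<Sum>i'<T. h i * h i' * S i i') / 2)))"
  obtains N where "centred_gaussian N S"
    "\<And>h T b. (\<integral>x. cos ((\<Sum>i<T. h i * coord x i) + b) \<partial>N) =
       cos b * exp (- ((\<Sum>i<T. \<Sum>i'<T. h i * h i' * S i i') / 2))"
proof -
  interpret P: prob_space P by (rule P)
  define A where "A = {\<omega> \<in> space P. (\<Sum>i. ennreal ((G i \<omega>)\<^sup>2)) \<noteq> \<top>}"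
  have A [measurable]: "A \<in> sets P" unfolding A_def by measurable
  \<comment> \<open>On the null set where the squares are not summable \<open>Abs_ell2\<close> would
    return an unspecified value, hence the default 0.\<close>
  define Z where "Z \<omega> = (if \<omega> \<in> A then Abs_ell2 (\<lambda>i. G i \<omega>) else 0)" for \<omega>
  have cZ: "coord (Z \<omega>) i = (if \<omega> \<in> A then G i \<omega> else 0)" for \<omega> i
    by (auto simp: Z_def coord_Abs coord_simps A_def summable_suminf_not_top)
  have Z [measurable]: "Z \<in> borel_measurable P"
    by (rule measurable_ell2I) (simp only: cZ, measurable)
  have "(\<integral>\<^sup>+\<omega>. (\<Sum>i. ennreal ((G i \<omega>)\<^sup>2)) \<partial>P) = (\<Sum>i. \<integral>\<^sup>+\<omega>. ennreal ((G i \<omega>)\<^sup>2) \<partial>P)"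
    by (rule nn_integral_suminf) measurable
  also have "\<dots> = (\<Sum>i. ennreal (S i i))"
  proof (rule suminf_cong)
    fix i
    have h: "has_bochner_integral P (\<lambda>\<omega>. (G i \<omega>)\<^sup>2) (S i i)" using cov[of i i] by (simp add: power2_eq_square)
    then show "(\<integral>\<^sup>+\<omega>. ennreal ((G i \<omega>)\<^sup>2) \<partial>P) = ennreal (S i i)"
      by (subst nn_integral_eq_integral)
        (auto dest: has_bochner_integral_integral_eq intro: has_bochner_integral_integrable integrable.intros)
  qed
  also have "\<dots> = ennreal (\<Sum>i. S i i)"
  proof (rule suminf_ennreal2[OF _ S])
    fix i
    have "S i i = (\<integral>\<omega>. (G i \<omega>)\<^sup>2 \<partial>P)"
      using cov[of i i] by (simp add: power2_eq_square has_bochner_integral_integral_eq)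
    then show "0 \<le> S i i" by simp
  qed
  finally have "AE \<omega> in P. (\<Sum>i. ennreal ((G i \<omega>)\<^sup>2)) \<noteq> \<infinity>"
    by (intro nn_integral_PInf_AE) auto
  then have AE_A: "AE \<omega> in P. \<omega> \<in> A" using AE_space by eventually_elim (simp add: A_def)

  define N where "N = distr P borel Z"
  interpret N: prob_space N unfolding N_def by (rule P.prob_space_distr) measurable
  have sN [measurable_cong]: "sets N = sets borel" by (simp add: N_def)
  have covN: "has_bochner_integral N (\<lambda>x. coord x i * coord x i') (S i i')" for i i'
    unfolding N_def
  proof (rule has_bochner_integral_distr)
    have "AE \<omega> in P. G i \<omega> * G i' \<omega> = coord (Z \<omega>) i * coord (Z \<omega>) i'"
      using AE_A by eventually_elim (simp add: cZ)
    then show "has_bochner_integral P (\<lambda>\<omega>. coord (Z \<omega>) i * coord (Z \<omega>) i') (S i i')"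
      using cov[of i i'] by (subst has_bochner_integral_cong_AE[symmetric]) auto
  qed measurable
  have chrN: "(\<integral>x. iexp (\<Sum>i<T. h i * coord x i) \<partial>N) =
       complex_of_real (exp (- ((\<Sum>i<T. \<Sum>i'<T. h i * h i' * S i i') / 2)))" for h T
  proof -
    have "(\<integral>x. iexp (\<Sum>i<T. h i * coord x i) \<partial>N) = (\<integral>\<omega>. iexp (\<Sum>i<T. h i * coord (Z \<omega>) i) \<partial>P)"
      unfolding N_def by (rule integral_distr) measurable
    also have "\<dots> = (\<integral>\<omega>. iexp (\<Sum>i<T. h i * G i \<omega>) \<partial>P)"
    proof (rule integral_cong_AE)
      show "AE \<omega> in P. iexp (\<Sum>i<T. h i * coord (Z \<omega>) i) = iexp (\<Sum>i<T. h i * G i \<omega>)"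
        using AE_A by eventually_elim (simp add: cZ)
    qed measurable
    finally show ?thesis unfolding chr .
  qed
  have int2: "integrable N (\<lambda>x. (coord x i)\<^sup>2)" "(\<integral>x. (coord x i)\<^sup>2 \<partial>N) \<le> S i i" for i
    using covN[of i i] by (auto simp: power2_eq_square has_bochner_integral_iff)
  have normN: "integrable N (\<lambda>x. (norm x)\<^sup>2)"
    using tail_sq_expectation(1)[OF N.prob_space_axioms _ int2 S, of 0] norm_sq_split[where T = 0]
    by (simp add: sN)
  have gauss: "\<exists>\<sigma>\<ge>0. distr N borel (\<lambda>x. h \<bullet> x) = centred_normal \<sigma>" for h
  proof -
    \<comment> \<open>The variance is taken as an integral. Dominated convergence, with
      \<open>(norm h)\<^sup>2 * (norm x)\<^sup>2\<close> as the bound, shows that it is the limit of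
      the finite double sums that occur in the characteristic functions.\<close>
    define V where "V = (\<integral>x. (h \<bullet> x)\<^sup>2 \<partial>N)"
    have V0: "0 \<le> V" unfolding V_def by simp
    have inner_meas [measurable]: "(\<lambda>x. h \<bullet> x) \<in> borel_measurable N"
      by (subst measurable_cong_sets[OF sN refl])
        (intro borel_measurable_continuous_onI continuous_intros)
    have lim: "(\<lambda>T. \<Sum>i<T. coord h i * coord x i) \<longlonglongrightarrow> h \<bullet> x" for x
      using inner_ell2_sums[of h x] by (simp add: sums_def)
    have bnd: "(\<Sum>i<T. coord h i * coord x i)\<^sup>2 \<le> (norm h)\<^sup>2 * (norm x)\<^sup>2" for T x
    proof -
      have "\<bar>\<Sum>i<T. coord h i * coord x i\<bar> \<le> norm h * norm (head_ell2 T (coord x))"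
        using Cauchy_Schwarz_ineq2[of h "head_ell2 T (coord x)"] by (simp add: inner_head)
      also have "\<dots> \<le> norm h * norm x" by (intro mult_left_mono norm_head_le) simp
      finally show ?thesis by (simp add: abs_le_square_iff[symmetric] flip: power_mult_distrib)
    qed
    have VT: "(\<integral>x. (\<Sum>i<T. coord h i * coord x i)\<^sup>2 \<partial>N) =
        (\<Sum>i<T. \<Sum>i'<T. coord h i * coord h i' * S i i')" for T
    proof -
      have "has_bochner_integral N (\<lambda>x. \<Sum>i<T. \<Sum>i'<T. coord h i * coord h i' * (coord x i * coord x i'))
         (\<Sum>i<T. \<Sum>i'<T. coord h i * coord h i' * S i i')"
        by (intro has_bochner_integral_sum has_bochner_integral_mult_right covN)
      moreover have "(\<Sum>i<T. \<Sum>i'<T. coord h i * coord h i' * (coord x i * coord x i')) =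
          (\<Sum>i<T. coord h i * coord x i)\<^sup>2" for x
        unfolding power2_eq_square sum_product by (intro sum.cong) auto
      ultimately show ?thesis by (simp add: has_bochner_integral_integral_eq)
    qed
    have Vlim: "(\<lambda>T. \<Sum>i<T. \<Sum>i'<T. coord h i * coord h i' * S i i') \<longlonglongrightarrow> V"
      unfolding VT[symmetric] V_def
    proof (rule integral_dominated_convergence[where w = "\<lambda>x. (norm h)\<^sup>2 * (norm x)\<^sup>2"])
      show "AE x in N. (\<lambda>T. (\<Sum>i<T. coord h i * coord x i)\<^sup>2) \<longlonglongrightarrow> (h \<bullet> x)\<^sup>2"
        by (intro AE_I2 tendsto_power lim)
      show "integrable N (\<lambda>x. (norm h)\<^sup>2 * (norm x)\<^sup>2)" using normN by simp
    qed (use bnd in auto)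
    let ?Q = "distr N borel (\<lambda>x. h \<bullet> x)"
    have "char ?Q t = char (centred_normal (sqrt V)) t" for t
    proof (rule LIMSEQ_unique)
      have "(\<lambda>T. \<integral>x. iexp (\<Sum>i<T. (t * coord h i) * coord x i) \<partial>N) \<longlonglongrightarrow> (\<integral>x. iexp (t * (h \<bullet> x)) \<partial>N)"
      proof (rule integral_dominated_convergence[where w = "\<lambda>_. 1"])
        have "(\<lambda>T. \<Sum>i<T. (t * coord h i) * coord x i) \<longlonglongrightarrow> t * (h \<bullet> x)" for x
          using tendsto_mult_left[OF lim, of t x] by (simp add: sum_distrib_left mult.assoc)
        then show "AE x in N. (\<lambda>T. iexp (\<Sum>i<T. (t * coord h i) * coord x i)) \<longlonglongrightarrow> iexp (t * (h \<bullet> x))"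
          by (intro AE_I2 isCont_tendsto_compose[OF isCont_iexp])
      qed auto
      then show "(\<lambda>T. \<integral>x. iexp (\<Sum>i<T. (t * coord h i) * coord x i) \<partial>N) \<longlonglongrightarrow> char ?Q t"
        by (simp add: char_def integral_distr)
      have "(\<lambda>T. complex_of_real (exp (- (t\<^sup>2 * (\<Sum>i<T. \<Sum>i'<T. coord h i * coord h i' * S i i') / 2)))) \<longlonglongrightarrow>
          complex_of_real (exp (- (t\<^sup>2 * V / 2)))"
        by (intro tendsto_intros Vlim) simp
      moreover have "(\<Sum>i<T. \<Sum>i'<T. t * coord h i * (t * coord h i') * S i i') =
          t\<^sup>2 * (\<Sum>i<T. \<Sum>i'<T. coord h i * coord h i' * S i i')" for T
        by (simp add: sum_distrib_left power2_eq_square mult_ac)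
      ultimately show "(\<lambda>T. \<integral>x. iexp (\<Sum>i<T. (t * coord h i) * coord x i) \<partial>N) \<longlonglongrightarrow> char (centred_normal (sqrt V)) t"
        unfolding chrN using V0 by (simp add: char_centred_normal mult.commute)
    qed
    then have "char ?Q = char (centred_normal (sqrt V))" by (rule ext)
    then have "?Q = centred_normal (sqrt V)"
      by (intro Levy_uniqueness real_distribution_centred_normal N.real_distribution_distr inner_meas)
    then show ?thesis using V0 by (intro exI[of _ "sqrt V"]) simp
  qed
  have "centred_gaussian N S"
    unfolding centred_gaussian_def using N.prob_space_axioms sN gauss covN by blast
  moreover have "(\<integral>x. cos ((\<Sum>i<T. h i * coord x i) + b) \<partial>N) =
       cos b * exp (- ((\<Sum>i<T. \<Sum>i'<T. h i * h i' * S i i') / 2))" for h T b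
  proof -
    have "(\<integral>x. cos ((\<Sum>i<T. h i * coord x i) + b) \<partial>N) = (\<integral>x. Re (iexp b * iexp (\<Sum>i<T. h i * coord x i)) \<partial>N)"
      by (intro Bochner_Integration.integral_cong) (simp_all add: Re_exp cos_add flip: exp_add distrib_left)
    also have "\<dots> = Re (\<integral>x. iexp b * iexp (\<Sum>i<T. h i * coord x i) \<partial>N)"
      by (intro integral_Re integrable_mult_right N.integrable_iexp) measurable
    also have "\<dots> = Re (iexp b * (\<integral>x. iexp (\<Sum>i<T. h i * coord x i) \<partial>N))"
      by (subst integral_mult_right_zero) simp
    finally show ?thesis unfolding chrN by (simp add: Re_exp)
  qed
  ultimately show ?thesis by (rule that)
qed

section \<open>The order restricted maximum likelihood estimator\<close>

lemma idx_downward: "j \<in> idx m \<Longrightarrow> 1 \<le> i \<Longrightarrow> i \<le> j \<Longrightarrow> i \<in> idx m"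
  by (auto simp: idx_def intro: order_trans[of "enat i" "enat j"])

text \<open>All factors equal 1 at \<open>e = 0\<close>, so the product rule leaves a plain sum.
  This is the score of the likelihood, obtained without logarithms.\<close>

lemma has_derivative_prod_at_0:
  fixes h :: "'b \<Rightarrow> real"
  assumes "finite A"
  shows "((\<lambda>e. \<Prod>j\<in>A. (1 + e * h j) ^ c j) has_real_derivative (\<Sum>j\<in>A. real (c j) * h j)) (at 0)"
  using assms by induction (auto intro!: derivative_eq_intros)

locale counts =
  fixes m :: enat and w c :: "nat \<Rightarrow> nat"
  assumes w_pos: "j \<in> idx m \<Longrightarrow> 1 \<le> w j"
    and fin: "finite {j \<in> idx m. c j \<noteq> 0}"
    and ne: "{j \<in> idx m. c j \<noteq> 0} \<noteq> {}"
begin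

text \<open>The last observed region. Maximisers vanish beyond it, so that also for
  \<open>m = \<infinity>\<close> the problem has only \<open>J\<close> variables.\<close>

definition J where "J = Max {j \<in> idx m. c j \<noteq> 0}"
definition n where "n = (\<Sum>j\<in>{1..J}. c j)"

lemma J_in: "J \<in> idx m" "c J \<noteq> 0"
  using Max_in[OF fin ne] by (auto simp: J_def)

lemma J_pos: "1 \<le> J" using J_in by (simp add: idx_def)

lemma D_idx: "j \<in> {1..J} \<Longrightarrow> j \<in> idx m"
  using idx_downward[OF J_in(1)] by auto

lemma supp_D: "j \<in> idx m \<Longrightarrow> c j \<noteq> 0 \<Longrightarrow> j \<in> {1..J}"
  using Max_ge[OF fin, of j] unfolding J_def by (auto simp: idx_def)

lemma w_pos_D: "j \<in> {1..J} \<Longrightarrow> 0 < real (w j)"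
  using w_pos[OF D_idx, of j] by simp

lemma likelihood_eq: "grouped_likelihood m c f = (\<Prod>j\<in>{1..J}. f j ^ c j)"
  unfolding grouped_likelihood_def
proof (rule prod.mono_neutral_left)
  show "{j \<in> idx m. c j \<noteq> 0} \<subseteq> {1..J}" using supp_D by blast
  show "\<forall>j\<in>{1..J} - {j \<in> idx m. c j \<noteq> 0}. f j ^ c j = 1" using D_idx by auto
qed simp

lemma likelihood_pos_last:
  assumes "0 < grouped_likelihood m c f"
  shows "f J \<noteq> 0"
proof
  assume "f J = 0"
  then have "grouped_likelihood m c f = 0"
    unfolding likelihood_eq by (intro prod_zero bexI[of _ J]) (use J_in J_pos in auto)
  then show False using assms by simp
qed

lemma n_pos: "0 < n"
proof -
  have "J \<in> {1..J}" using J_pos by simp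
  then have "c J \<le> n" unfolding n_def by (rule member_le_sum) auto
  then show ?thesis using J_in by simp
qed

section \<open>Reduction to the observed regions and existence of a maximiser\<close>

definition D_simplex where
  "D_simplex = {f. (\<forall>j. 0 \<le> f j) \<and> (\<forall>j. j \<notin> {1..J} \<longrightarrow> f j = 0) \<and>
      (\<Sum>j\<in>{1..J}. real (w j) * f j) = 1 \<and> (\<forall>j\<in>{1..<J}. f (Suc j) \<le> (f j::real))}"

lemma D_simplex_sub: "f \<in> D_simplex \<Longrightarrow> f \<in> grouped_simplex m w"
proof -
  assume f: "f \<in> D_simplex"
  have "(\<Sum>j\<in>{1..J}. real (w j) * f j) = 1" "\<And>j. j \<notin> {1..J} \<Longrightarrow> f j = 0"
    using f unfolding D_simplex_def by blast+
  then have "((\<lambda>j. real (w j) * f j) has_sum 1) (idx m)"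
    by (intro has_sum_finite_neutralI[of "{1..J}"]) (auto simp del: atLeastAtMost_iff intro: D_idx)
  moreover have "f (Suc j) \<le> f j" if "j \<in> idx m" for j
  proof (cases "Suc j \<le> J")
    case True then show ?thesis using f that by (auto simp: D_simplex_def idx_def)
  next
    case False then show ?thesis using f by (auto simp: D_simplex_def)
  qed
  ultimately show ?thesis
    using f D_idx by (auto simp: D_simplex_def grouped_simplex_def)
qed

text \<open>Mass beyond the last observed region is wasted: dropping it and renormalising increases every
  factor of the likelihood.\<close>

lemma truncate:
  assumes f: "f \<in> grouped_simplex m w" and pos: "0 < grouped_likelihood m c f"
  defines "S \<equiv> \<Sum>j\<in>{1..J}. real (w j) * f j"
  defines "g \<equiv> \<lambda>j. if j \<in> {1..J} then f j / S else 0"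
  shows "g \<in> D_simplex" "0 < S" "S \<le> 1" "grouped_likelihood m c f = S ^ n * grouped_likelihood m c g"
    "S = 1 \<Longrightarrow> g = f"
proof -
  have f0: "0 \<le> f j" for j using f by (cases "j \<in> idx m") (auto simp: grouped_simplex_def)
  have fJ: "f J \<noteq> 0"
    by (rule likelihood_pos_last[OF pos])
  have hs: "((\<lambda>j. real (w j) * f j) has_sum 1) (idx m)" using f by (simp add: grouped_simplex_def)
  have "real (w J) * f J \<le> S" unfolding S_def
    by (rule member_le_sum) (use J_pos f0 in auto)
  moreover have "0 < real (w J) * f J" using w_pos_D[of J] J_pos fJ f0[of J] by simp
  ultimately show S0: "0 < S" by linarith
  have hS: "((\<lambda>j. real (w j) * f j) has_sum S) {1..J}"
    unfolding S_def by (rule has_sum_finite) simp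
  have hd: "((\<lambda>j. real (w j) * f j) has_sum (1 - S)) (idx m - {1..J})"
    using has_sum_Diff[OF hs hS] D_idx by blast
  show S1: "S \<le> 1" using has_sum_nonneg[OF hd] f0 by simp
  show "g \<in> D_simplex"
    unfolding D_simplex_def
  proof (intro CollectI conjI allI impI ballI)
    show "0 \<le> g j" "j \<notin> {1..J} \<Longrightarrow> g j = 0" for j using f0 S0 by (auto simp: g_def)
    have "(\<Sum>j\<in>{1..J}. real (w j) * g j) = S / S"
      unfolding S_def sum_divide_distrib by (rule sum.cong) (auto simp: g_def S_def)
    then show "(\<Sum>j\<in>{1..J}. real (w j) * g j) = 1" using S0 by simp
    show "g (Suc j) \<le> g j" if "j \<in> {1..<J}" for j
    proof -
      have "f (Suc j) \<le> f j"
        using f D_idx[of j] D_idx[of "Suc j"] that by (auto simp: grouped_simplex_def)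
      then show ?thesis using S0 that by (simp add: g_def divide_right_mono)
    qed
  qed
  have "grouped_likelihood m c f = (\<Prod>j\<in>{1..J}. S ^ c j * g j ^ c j)"
    unfolding likelihood_eq by (rule prod.cong) (use S0 in \<open>auto simp: g_def power_divide\<close>)
  also have "\<dots> = S ^ n * grouped_likelihood m c g"
    unfolding likelihood_eq prod.distrib n_def power_sum ..
  finally show "grouped_likelihood m c f = S ^ n * grouped_likelihood m c g" .
  show "g = f" if "S = 1"
  proof
    fix j
    have "f j = 0" if "j \<in> idx m" "j \<notin> {1..J}"
    proof -
      \<comment> \<open>A single term beyond \<open>J\<close> is at most the mass
        \<open>1 - S\<close> lying there, which is 0 in this case.\<close>
      have "real (w j) * f j \<le> 1 - S"
        using has_sum_mono2[OF has_sum_finite[of "{j}" "\<lambda>j. real (w j) * f j"] hd] that f0 by simp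
      then have "real (w j) * f j \<le> 0" using \<open>S = 1\<close> by simp
      moreover have "0 < real (w j)" using w_pos[OF that(1)] by simp
      ultimately show ?thesis using f0[of j] by (simp add: mult_le_0_iff)
    qed
    then show "g j = f j" using f that by (auto simp: g_def grouped_simplex_def)
  qed
qed

text \<open>A closed subset of a product of unit intervals, compact by Tychonoff; coordinates are at
  most 1 because \<open>w j \<ge> 1\<close>.\<close>

lemma compact_D_simplex: "compact D_simplex"
proof -
  have "compact {y::nat\<Rightarrow>real. \<forall>i. y i \<in> {0..1}}"
    using compactin_PiE[of "\<lambda>_. euclidean" "UNIV::nat set" "\<lambda>_. {0..1::real}"]
    by (simp add: euclidean_product_topology PiE_UNIV_domain Pi_def)
  moreover have "closed D_simplex"
    unfolding D_simplex_def Ball_def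
    by (intro closed_Collect_conj closed_Collect_all closed_Collect_imp closed_Collect_le closed_Collect_eq
        continuous_intros open_Collect_const continuous_on_product_coordinates)
  moreover have "D_simplex \<subseteq> {y. \<forall>i. y i \<in> {0..1}}"
  proof (intro subsetI CollectI allI)
    fix f i assume f: "f \<in> D_simplex"
    then have f0: "0 \<le> f j" for j unfolding D_simplex_def by blast
    show "f i \<in> {0..1}"
    proof (cases "i \<in> {1..J}")
      case True
      have "f i \<le> real (w i) * f i"
        using f0[of i] w_pos[OF D_idx[OF True]] by (simp add: mult_le_cancel_right1)
      also have "\<dots> \<le> (\<Sum>j\<in>{1..J}. real (w j) * f j)"
        by (rule member_le_sum[OF True]) (use f in \<open>auto simp: D_simplex_def\<close>)
      finally show ?thesis using f by (auto simp: D_simplex_def)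
    next
      case False then show ?thesis using f by (auto simp: D_simplex_def)
    qed
  qed
  ultimately show ?thesis by (metis compact_Int_closed inf.absorb_iff2)
qed

text \<open>A feasible vector with positive likelihood. It forces the maximum to be positive, so
  that a maximiser has no zero among the regions up to \<open>J\<close> and multiplicative
  perturbations reach all of them.\<close>

definition unif where "unif j = (if j \<in> {1..J} then 1 / (\<Sum>j\<in>{1..J}. real (w j)) else 0)"

lemma sum_w_pos: "0 < (\<Sum>j\<in>{1..J}. real (w j))"
  by (rule sum_pos) (use w_pos_D J_pos in auto)

lemma unif_in: "unif \<in> D_simplex"
proof -
  have "(\<Sum>j\<in>{1..J}. real (w j) * unif j) = (\<Sum>j\<in>{1..J}. real (w j) / (\<Sum>j\<in>{1..J}. real (w j)))"
    by (rule sum.cong) (auto simp: unif_def)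
  also have "\<dots> = 1" using sum_w_pos by (simp flip: sum_divide_distrib)
  finally show ?thesis using sum_w_pos by (auto simp: D_simplex_def unif_def)
qed

lemma unif_pos: "0 < grouped_likelihood m c unif"
  unfolding likelihood_eq
proof (rule prod_pos)
  fix j assume "j \<in> {1..J}"
  then have "0 < unif j" unfolding unif_def using sum_w_pos by (simp only: if_True zero_less_divide_1_iff)
  then show "0 < unif j ^ c j" by simp
qed

lemma likelihood_le_trunc:
  assumes f: "f \<in> grouped_simplex m w"
  shows "\<exists>g\<in>D_simplex. grouped_likelihood m c f \<le> grouped_likelihood m c g"
proof (cases "0 < grouped_likelihood m c f")
  case True
  define S where "S = (\<Sum>j\<in>{1..J}. real (w j) * f j)"
  define g where "g = (\<lambda>j. if j \<in> {1..J} then f j / S else 0)"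
  note t = truncate[of f, folded S_def, folded g_def, OF f True]
  have "0 < S ^ n" using t(2) by simp
  moreover have "0 < S ^ n * grouped_likelihood m c g" using True unfolding t(4) .
  ultimately have "0 \<le> grouped_likelihood m c g" by (metis less_imp_le zero_less_mult_pos)
  moreover have "S ^ n \<le> 1" using t(2,3) by (simp add: power_le_one)
  ultimately have "grouped_likelihood m c f \<le> grouped_likelihood m c g"
    unfolding t(4) using \<open>0 < S ^ n\<close> by (intro mult_left_le_one_le) auto
  then show ?thesis using t(1) by blast
next
  case False
  then have "grouped_likelihood m c f \<le> grouped_likelihood m c unif" using unif_pos by linarith
  then show ?thesis using unif_in by blast
qed

definition is_mle where "is_mle f \<longleftrightarrow> f \<in> grouped_simplex m w \<and>
  (\<forall>g\<in>grouped_simplex m w. grouped_likelihood m c g \<le> grouped_likelihood m c f)"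

lemma mle_exists: "\<exists>f. is_mle f"
proof -
  have "continuous_on D_simplex (grouped_likelihood m c)"
    unfolding likelihood_eq
    by (intro continuous_intros continuous_on_product_coordinates continuous_on_subset[OF continuous_on_product_coordinates subset_UNIV])
  from continuous_attains_sup[OF compact_D_simplex _ this] unif_in
  obtain f where "f \<in> D_simplex" "\<forall>g\<in>D_simplex. grouped_likelihood m c g \<le> grouped_likelihood m c f"
    by blast
  then have "is_mle f" unfolding is_mle_def using D_simplex_sub likelihood_le_trunc by (meson order_trans)
  then show ?thesis by (rule exI[of is_mle f])
qed

text \<open>The properties below are proved for an arbitrary \<open>f\<close> with
  \<open>is_mle f\<close>; existence transfers them to the vector selected by
  \<open>arg_max_on\<close>.\<close>

lemma is_mle_arg_max: "is_mle (arg_max_on (grouped_likelihood m c) (grouped_simplex m w))"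
proof -
  obtain f where "is_mle f" using mle_exists by blast
  then have "is_arg_max (grouped_likelihood m c) (\<lambda>f. f \<in> grouped_simplex m w) f"
    by (auto simp: is_mle_def is_arg_max_linorder)
  then have "is_arg_max (grouped_likelihood m c) (\<lambda>f. f \<in> grouped_simplex m w)
      (arg_max_on (grouped_likelihood m c) (grouped_simplex m w))"
    unfolding arg_max_on_def arg_max_def by (rule someI[of "is_arg_max (grouped_likelihood m c) (\<lambda>f. f \<in> grouped_simplex m w)"])
  then show ?thesis by (auto simp: is_mle_def is_arg_max_linorder)
qed

section \<open>First order conditions for a maximiser and their consequences\<close>

context fixes f assumes mle: "is_mle f" begin

lemma mle_likelihood_pos: "0 < grouped_likelihood m c f"
  using mle unif_pos D_simplex_sub[OF unif_in] unfolding is_mle_def by (meson order_less_le_trans)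

text \<open>If a maximiser had mass beyond \<open>J\<close>, then \<open>S < 1\<close>, and the
  truncated and renormalised vector would have a likelihood larger by the factor
  \<open>1 / S ^ n\<close>, where \<open>n > 0\<close>.\<close>

lemma mle_in_D: "f \<in> D_simplex"
proof -
  define S where "S = (\<Sum>j\<in>{1..J}. real (w j) * f j)"
  define g where "g = (\<lambda>j. if j \<in> {1..J} then f j / S else 0)"
  note t = truncate[of f, folded S_def, folded g_def]
  have f: "f \<in> grouped_simplex m w" using mle by (simp add: is_mle_def)
  note t = t[OF f mle_likelihood_pos]
  have "grouped_likelihood m c g \<le> S ^ n * grouped_likelihood m c g"
    using mle D_simplex_sub[OF t(1)] t(4) by (auto simp: is_mle_def)
  moreover have "0 < grouped_likelihood m c g"
    using t(2,4) mle_likelihood_pos by (metis zero_less_mult_pos zero_less_power)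
  ultimately have "1 \<le> S ^ n" by simp
  then have "S = 1" using t(2,3) n_pos
    by (metis less_eq_real_def linorder_not_less power_less_one_iff)
  then show ?thesis using t(1,5) by simp
qed

lemma mle_pos: "j \<in> {1..J} \<Longrightarrow> 0 < f j"
proof -
  assume j: "j \<in> {1..J}"
  have "f J \<noteq> 0"
    by (rule likelihood_pos_last[OF mle_likelihood_pos])
  then have "0 < f J" using mle_in_D by (auto simp: D_simplex_def less_le)
  also have "f J \<le> f j" using j
  proof (induction "J - j" arbitrary: j)
    case 0 then show ?case by simp
  next
    case (Suc d)
    then have "f J \<le> f (Suc j)" "f (Suc j) \<le> f j" using mle_in_D by (auto simp: D_simplex_def)
    then show ?case by simp
  qed
  finally show ?thesis .
qed

text \<open>First order condition for the feasible direction \<open>f j * h j\<close>, followed by renormalisation.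
  It is feasible as soon as \<open>h\<close> is decreasing wherever \<open>f\<close> is constant.\<close>

lemma mle_variational:
  assumes h: "\<And>j. j \<in> {1..<J} \<Longrightarrow> f (Suc j) = f j \<Longrightarrow> h (Suc j) \<le> h j"
  shows "(\<Sum>j\<in>{1..J}. (real (c j) - real n * real (w j) * f j) * h j) \<le> 0"
proof -
  define lam where "lam = (\<Sum>j\<in>{1..J}. real (w j) * f j * h j)"
  \<comment> \<open>Multiplying \<open>f j\<close> by \<open>1 + e * h j\<close> preserves
    positivity for small \<open>e\<close>, and \<open>1 + e * lam\<close> is the total mass after
    this perturbation.\<close>
  define u where "u e j = (if j \<in> {1..J} then f j * (1 + e * h j) / (1 + e * lam) else 0)" for e j
  \<comment> \<open>The comparison of the likelihoods of \<open>u e\<close> and \<open>f\<close>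
    with denominators cleared. Maximality gives \<open>\<phi> e \<le> 0\<close> for small positive
    \<open>e\<close>, and with \<open>\<phi> 0 = 0\<close> the derivative at 0 cannot be
    positive.\<close>
  define \<phi> where "\<phi> e = (\<Prod>j\<in>{1..J}. (1 + e * h j) ^ c j) - (1 + e * lam) ^ n" for e
  have ev1: "\<forall>\<^sub>F e in at_right 0. 0 < 1 + e * a" for a :: real
  proof -
    have "((\<lambda>e. 1 + e * a) \<longlongrightarrow> 1 + 0 * a) (at_right 0)" by (intro tendsto_intros)
    then show ?thesis by (rule order_tendstoD(1)) simp
  qed
  have ev2: "\<forall>\<^sub>F e in at_right 0. f (Suc j) * (1 + e * h (Suc j)) \<le> f j * (1 + e * h j)"
    if j: "j \<in> {1..<J}" for j
  proof (cases "f (Suc j) = f j")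
    case True
    have "\<forall>\<^sub>F e in at_right (0::real). 0 < e" by (rule eventually_at_right_less)
    then show ?thesis
    proof eventually_elim
      case (elim e)
      then show ?case using True h[OF j True] mle_pos[of j] j by (simp add: mult_left_mono)
    qed
  next
    case False
    then have "f (Suc j) < f j" using mle_in_D j by (auto simp: D_simplex_def less_le)
    moreover have "((\<lambda>e. f j * (1 + e * h j) - f (Suc j) * (1 + e * h (Suc j))) \<longlongrightarrow>
       f j * (1 + 0 * h j) - f (Suc j) * (1 + 0 * h (Suc j))) (at_right 0)" by (intro tendsto_intros)
    ultimately have "\<forall>\<^sub>F e in at_right 0. 0 < f j * (1 + e * h j) - f (Suc j) * (1 + e * h (Suc j))"
      by (intro order_tendstoD(1)) auto
    then show ?thesis by eventually_elim simp
  qed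
  have "\<forall>\<^sub>F e in at_right 0. (\<forall>j\<in>{1..J}. 0 < 1 + e * h j) \<and>
     (\<forall>j\<in>{1..<J}. f (Suc j) * (1 + e * h (Suc j)) \<le> f j * (1 + e * h j)) \<and> 0 < 1 + e * lam"
    by (intro eventually_conj eventually_ball_finite) (auto intro: ev1 ev2)
  then have ev: "\<forall>\<^sub>F e in at_right 0. \<phi> e \<le> 0"
  proof eventually_elim
    case (elim e)
    have "(\<Sum>j\<in>{1..J}. real (w j) * u e j) = (\<Sum>j\<in>{1..J}. real (w j) * f j + e * (real (w j) * f j * h j)) / (1 + e * lam)"
      unfolding sum_divide_distrib by (rule sum.cong) (auto simp: u_def algebra_simps)
    also have "\<dots> = 1"
      using elim mle_in_D by (simp add: sum.distrib D_simplex_def lam_def flip: sum_distrib_left)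
    finally have "u e \<in> D_simplex"
      using elim mle_pos by (auto simp: D_simplex_def u_def divide_right_mono less_imp_le)
    then have "grouped_likelihood m c (u e) \<le> grouped_likelihood m c f"
      using mle D_simplex_sub by (auto simp: is_mle_def)
    moreover have "grouped_likelihood m c (u e) =
        grouped_likelihood m c f * (\<Prod>j\<in>{1..J}. (1 + e * h j) ^ c j) / (1 + e * lam) ^ n"
      unfolding likelihood_eq n_def power_sum prod.distrib[symmetric] prod_dividef[symmetric]
      by (rule prod.cong) (auto simp: u_def power_mult_distrib power_divide)
    ultimately show ?case
      using mle_likelihood_pos elim by (simp add: \<phi>_def divide_le_eq mult_le_cancel_left)
  qed
  have "((\<lambda>e. \<Prod>j\<in>{1..J}. (1 + e * h j) ^ c j) has_real_derivative (\<Sum>j\<in>{1..J}. real (c j) * h j)) (at 0)"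
    by (rule has_derivative_prod_at_0) simp
  then have "(\<phi> has_real_derivative ((\<Sum>j\<in>{1..J}. real (c j) * h j) - real n * lam)) (at 0)"
    unfolding \<phi>_def by (auto intro!: derivative_eq_intros)
  moreover have "\<phi> 0 = 0" by (simp add: \<phi>_def)
  moreover have "\<exists>e>0. \<phi> e \<le> 0 \<and> e < d" if "d > 0" for d
  proof -
    have "\<forall>\<^sub>F e in at_right 0. e < d" using that by (rule eventually_at_rightI[of 0 d, rotated]) auto
    then have "\<forall>\<^sub>F e in at_right 0. \<phi> e \<le> 0 \<and> e < d \<and> 0 < e"
      using ev eventually_at_right_less[of 0] by eventually_elim auto
    then show ?thesis by (auto dest!: eventually_happens)
  qed
  ultimately have "(\<Sum>j\<in>{1..J}. real (c j) * h j) - real n * lam \<le> 0"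
    using DERIV_pos_inc_right[of \<phi> "(\<Sum>j\<in>{1..J}. real (c j) * h j) - real n * lam" 0] by force
  then show ?thesis
    by (simp add: lam_def sum_distrib_left sum_subtractf[symmetric] algebra_simps)
qed

text \<open>The direction \<open>q - f\<close> is admissible, since it decreases with
  \<open>q\<close> wherever \<open>f\<close> is constant. The variational inequality then bounds the
  weighted inner product of \<open>g - f\<close> and \<open>q - f\<close> by 0, and the identity
  \<open>(f - q)^2 - (g - q)^2 = 2 (g - f) (q - f) - (g - f)^2\<close> gives the
  contraction.\<close>

lemma mle_contraction:
  assumes q: "\<And>j. j \<in> {1..<J} \<Longrightarrow> q (Suc j) \<le> (q j::real)"
  shows "(\<Sum>j\<in>{1..J}. real (w j) * (f j - q j)\<^sup>2) \<le>
         (\<Sum>j\<in>{1..J}. real (w j) * (real (c j) / (real n * real (w j)) - q j)\<^sup>2)"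
proof -
  define g where "g j = real (c j) / (real n * real (w j))" for j
  have v: "(\<Sum>j\<in>{1..J}. (real (c j) - real n * real (w j) * f j) * (q j - f j)) \<le> 0"
    by (rule mle_variational) (use q in fastforce)
  have "(\<Sum>j\<in>{1..J}. real (w j) * (f j - q j)\<^sup>2) - (\<Sum>j\<in>{1..J}. real (w j) * (g j - q j)\<^sup>2)
    = (\<Sum>j\<in>{1..J}. 2 / real n * ((real (c j) - real n * real (w j) * f j) * (q j - f j))
        - real (w j) * (g j - f j)\<^sup>2)"
    unfolding sum_subtractf[symmetric]
  proof (rule sum.cong)
    fix j assume j: "j \<in> {1..J}"
    have "real (c j) = real n * real (w j) * g j" using w_pos_D[OF j] n_pos by (simp add: g_def)
    then have "2 / real n * ((real (c j) - real n * real (w j) * f j) * (q j - f j))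
      = 2 / real n * (real n * real (w j) * (g j - f j) * (q j - f j))"
      by (simp add: algebra_simps)
    also have "\<dots> = 2 * real (w j) * (g j - f j) * (q j - f j)" using n_pos by simp
    finally show "real (w j) * (f j - q j)\<^sup>2 - real (w j) * (g j - q j)\<^sup>2 =
      2 / real n * ((real (c j) - real n * real (w j) * f j) * (q j - f j)) - real (w j) * (g j - f j)\<^sup>2"
      by (simp add: power2_eq_square algebra_simps)
  qed simp
  also have "\<dots> \<le> (\<Sum>j\<in>{1..J}. 2 / real n * ((real (c j) - real n * real (w j) * f j) * (q j - f j)))"
    by (rule sum_mono) simp
  also have "\<dots> \<le> 0"
    unfolding sum_distrib_left[symmetric] using v by (intro mult_nonneg_nonpos) auto
  finally show ?thesis by (simp add: g_def)
qed

text \<open>Where \<open>g\<close> exceeds all its later values, pooling across that place would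
  average values that are already in the right order. So \<open>f\<close> drops strictly at each
  \<open>l \<le> K\<close> with \<open>l < J\<close>, the order constraint is slack around
  \<open>i\<close>, and the first order condition becomes an equation.\<close>

lemma mle_local:
  assumes g: "\<And>i j. 1 \<le> i \<Longrightarrow> i \<le> K \<Longrightarrow> i < j \<Longrightarrow> j \<in> idx m \<Longrightarrow>
      real (c j) / (real n * real (w j)) < real (c i) / (real n * real (w i))"
    and i: "i \<in> idx m" "i \<le> K"
  shows "f i = real (c i) / (real n * real (w i))"
proof (cases "i \<le> J")
  case False
  \<comment> \<open>Region \<open>i\<close> lies beyond the last observed one, so both sides are
    0.\<close>
  then show ?thesis using mle_in_D supp_D[OF i(1)] by (force simp: D_simplex_def)
next
  case True
  let ?g = "\<lambda>j. real (c j) / (real n * real (w j))"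
  have c_eq: "real (c j) - real n * real (w j) * f j = real n * real (w j) * (?g j - f j)" if "j \<in> {1..J}" for j
    using w_pos_D[OF that] n_pos by (simp add: field_simps)
  have strict: "f (Suc l) < f l" if l: "1 \<le> l" "l \<le> K" "Suc l \<le> J" for l
  proof (rule ccontr)
    assume "\<not> f (Suc l) < f l"
    then have eq: "f (Suc l) = f l" using mle_in_D l by (force simp: D_simplex_def)
    define v where "v = f l"
    \<comment> \<open>The block on which \<open>f\<close> takes the value \<open>v\<close>, cut
      after \<open>l\<close>. Raising the front part \<open>B1\<close> alone and lowering the whole
      block are both admissible directions; they give a nonpositive excess of \<open>g\<close> over
      \<open>v\<close> on \<open>B1\<close> and a nonnegative one on the whole block, hence a
      nonnegative one on \<open>B2\<close>. But \<open>g\<close> is smallest on \<open>B1\<close> at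
      \<open>l\<close>, so \<open>?g l \<le> v\<close>, and all values on \<open>B2\<close> are
      smaller still.\<close>
    define B1 where "B1 = {j\<in>{1..J}. j \<le> l \<and> f j = v}"
    define B2 where "B2 = {j\<in>{1..J}. l < j \<and> f j = v}"
    have B: "finite B1" "finite B2" "B1 \<inter> B2 = {}" "l \<in> B1" "Suc l \<in> B2" "B1 \<subseteq> {1..J}" "B2 \<subseteq> {1..J}"
      using l eq by (auto simp: B1_def B2_def v_def)
    have "(\<Sum>j\<in>{1..J}. (real (c j) - real n * real (w j) * f j) * (if j \<in> B1 then 1 else 0)) \<le> 0"
      by (rule mle_variational) (auto simp: B1_def)
    also have "(\<Sum>j\<in>{1..J}. (real (c j) - real n * real (w j) * f j) * (if j \<in> B1 then 1 else 0))
       = (\<Sum>j\<in>B1. real n * real (w j) * (?g j - v))"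
      by (rule sum.mono_neutral_cong_right) (auto simp: B1_def c_eq)
    finally have s1: "(\<Sum>j\<in>B1. real n * real (w j) * (?g j - v)) \<le> 0" .
    have "(\<Sum>j\<in>{1..J}. (real (c j) - real n * real (w j) * f j) * (if j \<in> B1 \<union> B2 then -1 else 0)) \<le> 0"
      by (rule mle_variational) (auto simp: B1_def B2_def)
    also have "(\<Sum>j\<in>{1..J}. (real (c j) - real n * real (w j) * f j) * (if j \<in> B1 \<union> B2 then -1 else 0))
       = (\<Sum>j\<in>B1 \<union> B2. - (real n * real (w j) * (?g j - v)))"
    proof (rule sum.mono_neutral_cong_right)
      fix x assume "x \<in> B1 \<union> B2"
      moreover from this have "x \<in> {1..J}" "f x = v" by (auto simp: B1_def B2_def)
      ultimately show "(real (c x) - real n * real (w x) * f x) * (if x \<in> B1 \<union> B2 then -1 else 0)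
          = - (real n * real (w x) * (?g x - v))"
        using c_eq[of x] by (simp only: if_True mult_minus1_right)
    qed (auto simp: B1_def B2_def)
    finally have s2: "0 \<le> (\<Sum>j\<in>B1. real n * real (w j) * (?g j - v)) + (\<Sum>j\<in>B2. real n * real (w j) * (?g j - v))"
      using B by (simp add: sum_negf sum.union_disjoint)
    have gl: "?g l \<le> v"
    proof (rule ccontr)
      assume "\<not> ?g l \<le> v"
      have "0 < (\<Sum>j\<in>B1. real n * real (w j) * (?g j - v))"
      proof (rule sum_pos)
        fix j assume j: "j \<in> B1"
        then have "?g l \<le> ?g j" using g[of j l] l D_idx[of l] by (cases "j = l") (auto simp: B1_def)
        then have "v < ?g j" using \<open>\<not> ?g l \<le> v\<close> by simp
        then show "0 < real n * real (w j) * (?g j - v)" using n_pos w_pos_D[of j] j B by auto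
      qed (use B in auto)
      then show False using s1 by simp
    qed
    have "(\<Sum>j\<in>B2. real n * real (w j) * (?g j - v)) < (\<Sum>j\<in>B2. 0)"
    proof (rule sum_strict_mono)
      fix j assume j: "j \<in> B2"
      then have "?g j < ?g l" using g[of l j] l D_idx[of j] by (auto simp: B2_def)
      then show "real n * real (w j) * (?g j - v) < 0"
        using gl n_pos w_pos_D[of j] j B by (auto intro!: mult_pos_neg)
    qed (use B in auto)
    then show False using s1 s2 by simp
  qed
  have iJ: "i \<in> {1..J}" using i True by (auto simp: idx_def)
  have ne: "f (Suc i) \<noteq> f i" if "i < J" using strict[of i] that i(2) iJ by auto
  have ne': "f (Suc j) \<noteq> f j" if "Suc j = i" "1 \<le> j" for j using strict[of j] that i(2) iJ by auto
  \<comment> \<open>The values of \<open>f\<close> next to \<open>i\<close> differ from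
    \<open>f i\<close>, so changing coordinate \<open>i\<close> alone is admissible with either sign
    of \<open>s\<close>.\<close>
  have "(\<Sum>j\<in>{1..J}. (real (c j) - real n * real (w j) * f j) * (if j = i then s else 0)) \<le> 0" for s
    by (rule mle_variational) (use ne ne' in auto)
  then have "(real (c i) - real n * real (w i) * f i) * s \<le> 0" for s
    using iJ by (simp add: if_distrib[where f="\<lambda>x. _ * x"] cong: if_cong)
  from this[of 1] this[of "-1"] have "real (c i) = real n * real (w i) * f i" by simp
  then show ?thesis using n_pos w_pos_D[OF iJ] by simp
qed

end
end

section \<open>Flat regions and the Gaussian limit\<close>

text \<open>A Cholesky factorisation of \<open>S\<close> into a lower triangular factor and its
  transpose. Triangularity makes each coordinate a finite combination of independent standard
  normals, so the characteristic functions are finite products. The free bound \<open>L\<close>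
  allows two coordinates to be written over the same index range.\<close>

lemma gaussian_ell2_from_factor:
  fixes \<gamma> :: "nat \<Rightarrow> nat \<Rightarrow> real"
  assumes tri: "\<And>i l. i < l \<Longrightarrow> \<gamma> i l = 0"
    and S: "\<And>i i' L. i \<le> L \<Longrightarrow> i' \<le> L \<Longrightarrow> S i i' = (\<Sum>l\<le>L. \<gamma> i l * \<gamma> i' l)"
    and summ: "summable (\<lambda>i. S i i)"
  obtains N where "centred_gaussian N S"
    "\<And>h T b. (\<integral>x. cos ((\<Sum>i<T. h i * coord x i) + b) \<partial>N) =
       cos b * exp (- ((\<Sum>i<T. \<Sum>i'<T. h i * h i' * S i i') / 2))"
proof -
  let ?P = "PiM UNIV (\<lambda>_::nat. std_normal_distribution)"
  interpret std: real_distribution std_normal_distribution by (rule real_dist_normal_dist)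
  interpret P: prob_space ?P by (intro prob_space_PiM std.prob_space_axioms)
  have comp: "distr ?P std_normal_distribution (\<lambda>\<omega>. \<omega> l) = std_normal_distribution" for l
    by (rule distr_PiM_component) (auto intro: std.prob_space_axioms)
  have [measurable]: "(\<lambda>\<omega>. \<omega> l) \<in> borel_measurable ?P" for l
    using measurable_component_singleton[of l UNIV "\<lambda>_. std_normal_distribution"] by simp
  have dcomp: "distr ?P borel (\<lambda>\<omega>. \<omega> l) = std_normal_distribution" for l
    using comp[of l] by (simp cong: distr_cong)
  have ind: "P.indep_vars (\<lambda>_. borel) (\<lambda>l \<omega>. \<omega> l) UNIV"
  proof (subst P.indep_vars_iff_distr_eq_PiM')
    have "sets (PiM UNIV (\<lambda>_::nat. borel :: real measure)) = sets ?P"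
      by (rule sets_PiM_cong) auto
    then have "distr ?P (PiM UNIV (\<lambda>_::nat. borel)) (\<lambda>x. x) = ?P"
      by (simp add: distr_id2)
    then show "distr ?P (PiM UNIV (\<lambda>_. borel)) (\<lambda>x. \<lambda>l\<in>UNIV. x l) = PiM UNIV (\<lambda>l. distr ?P borel (\<lambda>\<omega>. \<omega> l))"
      by (simp add: dcomp restrict_UNIV)
  qed auto
  have m1: "(\<integral>\<omega>. \<omega> l \<partial>?P) = 0" "integrable ?P (\<lambda>\<omega>. \<omega> l)"
     and m2: "(\<integral>\<omega>. (\<omega> l)\<^sup>2 \<partial>?P) = 1" "integrable ?P (\<lambda>\<omega>. (\<omega> l)\<^sup>2)" for l
  proof -
    have i: "(\<integral>\<omega>. f (\<omega> l) \<partial>?P) = (\<integral>x. f x \<partial>std_normal_distribution)"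
      "integrable ?P (\<lambda>\<omega>. f (\<omega> l)) \<longleftrightarrow> integrable std_normal_distribution f" if "f \<in> borel_measurable borel" for f :: "real \<Rightarrow> real"
      by (subst dcomp[of l, symmetric], subst integral_distr, use that in simp_all)
         (subst dcomp[of l, symmetric], subst integrable_distr_eq, use that in simp_all)
    show "(\<integral>\<omega>. \<omega> l \<partial>?P) = 0" "integrable ?P (\<lambda>\<omega>. \<omega> l)"
      using i[of "\<lambda>x. x"] integral_std_normal_distribution_moment_odd[of 1] integrable_std_normal_distribution_moment[of 1]
      by simp_all
    show "(\<integral>\<omega>. (\<omega> l)\<^sup>2 \<partial>?P) = 1" "integrable ?P (\<lambda>\<omega>. (\<omega> l)\<^sup>2)"
      using i[of "\<lambda>x. x\<^sup>2"] std_normal_distribution_even_moments[of 1] by (simp_all add: fact_2)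
  qed
  have cross: "has_bochner_integral ?P (\<lambda>\<omega>. \<omega> l * \<omega> l') (of_bool (l = l'))" for l l'
  proof (cases "l = l'")
    case True
    then show ?thesis using m2[of l] by (simp add: has_bochner_integral_iff power2_eq_square)
  next
    case False
    have "P.indep_vars (\<lambda>_. borel) (\<lambda>l \<omega>. \<omega> l) {l, l'}" using P.indep_vars_subset[OF ind] by simp
    then show ?thesis
      using P.indep_vars_lebesgue_integral[of "{l, l'}" "\<lambda>l \<omega>. \<omega> l"] P.indep_vars_integrable[of "{l, l'}" "\<lambda>l \<omega>. \<omega> l"] m1 False
      by (simp add: has_bochner_integral_iff)
  qed
  define G where "G i \<omega> = (\<Sum>l\<le>i. \<gamma> i l * \<omega> l)" for i and \<omega> :: "nat \<Rightarrow> real"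
  have G_eq: "G i \<omega> = (\<Sum>l\<le>L. \<gamma> i l * \<omega> l)" if "i \<le> L" for i L \<omega>
    unfolding G_def by (rule sum.mono_neutral_left) (use that tri in auto)
  have [measurable]: "G i \<in> borel_measurable ?P" for i unfolding G_def by measurable
  have cov: "has_bochner_integral ?P (\<lambda>\<omega>. G i \<omega> * G i' \<omega>) (S i i')" for i i'
  proof -
    let ?L = "max i i'"
    have "has_bochner_integral ?P (\<lambda>\<omega>. \<Sum>l\<le>?L. \<Sum>l'\<le>?L. \<gamma> i l * \<gamma> i' l' * (\<omega> l * \<omega> l'))
       (\<Sum>l\<le>?L. \<Sum>l'\<le>?L. \<gamma> i l * \<gamma> i' l' * of_bool (l = l'))"
      by (intro has_bochner_integral_sum has_bochner_integral_mult_right cross)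
    moreover have "(\<Sum>l\<le>?L. \<Sum>l'\<le>?L. \<gamma> i l * \<gamma> i' l' * of_bool (l = l')) = S i i'"
      by (subst S[of _ ?L]) (auto simp: of_bool_def if_distrib[where f = "\<lambda>x. _ * x"] cong: if_cong)
    moreover have "(\<Sum>l\<le>?L. \<Sum>l'\<le>?L. \<gamma> i l * \<gamma> i' l' * (\<omega> l * \<omega> l')) = G i \<omega> * G i' \<omega>" for \<omega>
      by (simp only: G_eq[of i ?L, OF max.cobounded1] G_eq[of i' ?L, OF max.cobounded2] sum_product) (simp add: mult_ac)
    ultimately show ?thesis by simp
  qed
  have chr: "(\<integral>\<omega>. iexp (\<Sum>i<T. h i * G i \<omega>) \<partial>?P) =
      complex_of_real (exp (- ((\<Sum>i<T. \<Sum>i'<T. h i * h i' * S i i') / 2)))" for h T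
  proof -
    define c where "c l = (\<Sum>i<T. h i * \<gamma> i l)" for l
    have lin: "(\<Sum>i<T. h i * G i \<omega>) = (\<Sum>l\<le>T. c l * \<omega> l)" for \<omega>
    proof -
      have "(\<Sum>i<T. h i * G i \<omega>) = (\<Sum>i<T. \<Sum>l\<le>T. h i * \<gamma> i l * \<omega> l)"
        by (rule sum.cong) (auto simp: G_eq[of _ T] sum_distrib_left mult.assoc)
      also have "\<dots> = (\<Sum>l\<le>T. c l * \<omega> l)" unfolding c_def sum_distrib_right by (rule sum.swap)
      finally show ?thesis .
    qed
    have V: "(\<Sum>i<T. \<Sum>i'<T. h i * h i' * S i i') = (\<Sum>l\<le>T. (c l)\<^sup>2)"
    proof -
      have "(\<Sum>i<T. \<Sum>i'<T. h i * h i' * S i i') = (\<Sum>i<T. \<Sum>i'<T. \<Sum>l\<le>T. (h i * \<gamma> i l) * (h i' * \<gamma> i' l))"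
        by (intro sum.cong refl) (subst S[of _ T], auto simp: sum_distrib_left mult_ac)
      also have "\<dots> = (\<Sum>i<T. \<Sum>l\<le>T. \<Sum>i'<T. (h i * \<gamma> i l) * (h i' * \<gamma> i' l))"
        by (rule sum.cong[OF refl], rule sum.swap)
      also have "\<dots> = (\<Sum>l\<le>T. \<Sum>i<T. \<Sum>i'<T. (h i * \<gamma> i l) * (h i' * \<gamma> i' l))" by (rule sum.swap)
      also have "\<dots> = (\<Sum>l\<le>T. (c l)\<^sup>2)" by (simp add: c_def power2_eq_square sum_product)
      finally show ?thesis .
    qed
    have "P.indep_vars (\<lambda>_. borel) (\<lambda>l \<omega>. c l * \<omega> l) {..T}"
      by (rule P.indep_vars_compose2[OF P.indep_vars_subset[OF ind]]) auto
    from P.char_distr_sum[OF this, of 1]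
    have "(\<integral>\<omega>. iexp (\<Sum>l\<le>T. c l * \<omega> l) \<partial>?P) = (\<Prod>l\<le>T. \<integral>\<omega>. iexp (c l * \<omega> l) \<partial>?P)"
      by (simp add: char_def integral_distr)
    also have "\<dots> = (\<Prod>l\<le>T. char std_normal_distribution (c l))"
    proof (rule prod.cong[OF refl])
      fix l
      have "char (distr ?P borel (\<lambda>\<omega>. \<omega> l)) (c l) = (\<integral>\<omega>. iexp (c l * \<omega> l) \<partial>?P)"
        by (simp add: char_def integral_distr)
      then show "(\<integral>\<omega>. iexp (c l * \<omega> l) \<partial>?P) = char std_normal_distribution (c l)" by (simp only: dcomp)
    qed
    finally show ?thesis
      by (simp add: lin V char_std_normal_distribution exp_sum sum_divide_distrib sum_negf[symmetric] del: of_real_exp flip: of_real_prod)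
  qed
  show ?thesis
    by (rule gaussian_ell2_exists[OF P.prob_space_axioms _ cov summ chr]) (use that in auto)
qed

section \<open>Covariance of the Brownian bridge and of its increments\<close>

text \<open>Brownian bridge \<open>B\<^sub>j\<close> at the times \<open>1 - q j\<close>, written as a Gaussian martingale times \<open>q j\<close>.
  At \<open>q j = 0\<close> the junk value of \<open>1 / q j\<close> is multiplied by 0.\<close>

definition bridge :: "(nat \<Rightarrow> real) \<Rightarrow> nat \<Rightarrow> nat \<Rightarrow> real" where
  "bridge q j l = (if 1 \<le> l \<and> l \<le> j then q j * sqrt (1 / q l - 1 / q (l - 1)) else 0)"

text \<open>The increments of \<open>1 / q\<close> are the variances of the martingale increments;
  they telescope to \<open>1 / q i - 1 / q 0\<close>. If \<open>q i = 0\<close>, as after the last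
  region of a finite \<open>m\<close>, then \<open>q j = 0\<close> by monotonicity and both sides
  vanish.\<close>

lemma bridge_covariance:
  assumes q: "q 0 = 1" "\<And>l. l < j \<Longrightarrow> q (Suc l) \<le> q l" "\<And>l. l \<le> j \<Longrightarrow> 0 \<le> q l"
    and "i \<le> j" "i \<le> L"
  shows "(\<Sum>l\<le>L. bridge q i l * bridge q j l) = q j * (1 - q i)"
proof -
  have anti: "q j' \<le> q i'" if "i' \<le> j'" "j' \<le> j" for i' j'
    using that by (induction rule: dec_induct) (auto intro: order_trans[OF q(2)])
  show ?thesis
  proof (cases "q i = 0")
    case True
    then have "q j = 0" using anti[of i j] q(3)[of j] assms(4) by simp
    moreover have "bridge q i l = 0" for l unfolding bridge_def True by simp
    ultimately show ?thesis by simp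
  next
    case False
    then have qi: "0 < q i" using q(3)[OF assms(4)] by simp
    have "(\<Sum>l\<le>L. bridge q i l * bridge q j l) = (\<Sum>l\<in>{Suc 0..i}. q i * q j * (1 / q l - 1 / q (l - 1)))"
    proof (rule sum.mono_neutral_cong_right)
      fix l assume l: "l \<in> {Suc 0..i}"
      have "0 < q l" "q l \<le> q (l - 1)"
        using anti[of l i] anti[of "l - 1" l] l assms(4) qi by auto
      then have "0 \<le> 1 / q l - 1 / q (l - 1)" by (simp add: frac_le)
      then show "bridge q i l * bridge q j l = q i * q j * (1 / q l - 1 / q (l - 1))"
        using l assms(4) by (simp add: bridge_def mult_ac)
    qed (use assms(5) in \<open>auto simp: bridge_def\<close>)
    also have "\<dots> = q i * q j * (1 / q i - 1 / q 0)"
      unfolding sum_distrib_left[symmetric] by (subst sum_telescope'') auto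
    also have "\<dots> = q j * (1 - q i)" using qi q(1) by (simp add: field_simps)
    finally show ?thesis .
  qed
qed

lemma bridge_increment_covariance:
  assumes q: "q 0 = 1" "\<And>l. l < J \<Longrightarrow> q (Suc l) \<le> q l" "\<And>l. l \<le> J \<Longrightarrow> 0 \<le> q l"
    and j: "1 \<le> j" "1 \<le> j'" "j \<le> J" "j' \<le> J" "j \<le> L" "j' \<le> L"
  defines "a \<equiv> \<lambda>j. q (j - 1) - q j"
  shows "(\<Sum>l\<le>L. (bridge q j l - bridge q (j - 1) l) * (bridge q j' l - bridge q (j' - 1) l)) =
    of_bool (j = j') * a j - a j * a j'"
proof -
  have main: "(\<Sum>l\<le>L. (bridge q j l - bridge q (j - 1) l) * (bridge q j' l - bridge q (j' - 1) l)) =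
    of_bool (j = j') * a j - a j * a j'" if j: "1 \<le> j" "j \<le> j'" "j' \<le> J" "j' \<le> L" for j j'
  proof -
    have K: "(\<Sum>l\<le>L. bridge q i l * bridge q i' l) = q i' * (1 - q i)" if "i \<le> i'" "i' \<le> j'" for i i'
      using that j by (intro bridge_covariance q) auto
    have "(\<Sum>l\<le>L. (bridge q j l - bridge q (j - 1) l) * (bridge q j' l - bridge q (j' - 1) l)) =
       (\<Sum>l\<le>L. bridge q j l * bridge q j' l) - (\<Sum>l\<le>L. bridge q j l * bridge q (j' - 1) l)
       - (\<Sum>l\<le>L. bridge q (j - 1) l * bridge q j' l) + (\<Sum>l\<le>L. bridge q (j - 1) l * bridge q (j' - 1) l)"
      by (simp add: algebra_simps sum.distrib sum_subtractf)
    \<comment> \<open>For \<open>j = j'\<close> the two indices of this term are in the reverse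
      order; the extra contribution is what produces the diagonal term \<open>a j\<close>.\<close>
    also have "(\<Sum>l\<le>L. bridge q j l * bridge q (j' - 1) l) =
        (if j = j' then q j * (1 - q (j - 1)) else q (j' - 1) * (1 - q j))"
    proof (cases "j = j'")
      case True
      then show ?thesis using K[of "j - 1" j] by (simp add: mult.commute)
    next
      case False
      then show ?thesis using K[of j "j' - 1"] j by simp
    qed
    also have "(\<Sum>l\<le>L. bridge q j l * bridge q j' l) = q j' * (1 - q j)" using K j by simp
    also have "(\<Sum>l\<le>L. bridge q (j - 1) l * bridge q j' l) = q j' * (1 - q (j - 1))" using K j by simp
    also have "(\<Sum>l\<le>L. bridge q (j - 1) l * bridge q (j' - 1) l) = q (j' - 1) * (1 - q (j - 1))" using K j by simp
    finally show ?thesis by (auto simp: a_def algebra_simps)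
  qed
  show ?thesis
  proof (cases "j \<le> j'")
    case True
    then show ?thesis using main[of j j'] j by simp
  next
    case False
    then show ?thesis using main[of j' j] j by (auto simp: mult.commute)
  qed
qed

lemma infsum_single_term:
  fixes f :: "'b \<Rightarrow> real"
  assumes "i \<in> A" "\<And>j. j \<in> A \<Longrightarrow> j \<noteq> i \<Longrightarrow> f j = 0"
  shows "infsum f A = f i"
proof -
  have "infsum f A = infsum f {i}" by (rule infsum_cong_neutral) (use assms in auto)
  then show ?thesis by simp
qed

section \<open>Bookkeeping between indices and regions\<close>

locale flat_regions =
  fixes p :: "nat pmf" and k m :: enat and w :: "nat \<Rightarrow> nat"
  assumes dec: "decreasing_with_flat_regions p k m w"
begin

lemma w_pos: "j \<in> idx m \<Longrightarrow> 1 \<le> w j"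
  using dec by (simp add: decreasing_with_flat_regions_def)

lemma start_Suc: "1 \<le> j \<Longrightarrow> region_start w (Suc j) = region_start w j + w j"
  by (simp add: region_start_def)

lemma start_1: "region_start w (Suc 0) = 1" by (simp add: region_start_def)

lemma start_mono: "i \<le> j \<Longrightarrow> region_start w i \<le> region_start w j"
  unfolding region_start_def by (intro add_left_mono sum_mono2) auto

lemma in_region_iff: "j \<in> idx m \<Longrightarrow> in_region w j i \<longleftrightarrow> i \<in> {region_start w j..<region_start w (Suc j)}"
  using w_pos[of j] by (auto simp: in_region_def start_Suc idx_def)

lemma start_ge: "J \<in> idx m \<Longrightarrow> J < region_start w (Suc J)"
proof (induction J)
  case 0 then show ?case by (simp add: idx_def)
next
  case (Suc J)
  show ?case
  proof (cases "J = 0")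
    case True
    then show ?thesis using w_pos[OF Suc.prems] by (simp add: start_Suc start_1)
  next
    case False
    then have "J \<in> idx m" using idx_downward[OF Suc.prems] by simp
    then show ?thesis using Suc.IH w_pos[OF Suc.prems] by (simp add: start_Suc)
  qed
qed

text \<open>Describes the support through the regions. Finite and infinite \<open>m\<close> are told
  apart here, so that later arguments treat them uniformly.\<close>

lemma idx_k_iff: "i \<in> idx k \<longleftrightarrow> 1 \<le> i \<and> (\<exists>J\<in>idx m. i < region_start w (Suc J))"
proof (cases m)
  case infinity
  then have "k = \<infinity>" "i \<in> idx m \<longleftrightarrow> 1 \<le> i" using dec by (auto simp: decreasing_with_flat_regions_def idx_def)
  then show ?thesis using start_ge[of i] by (auto simp: idx_def)
next
  case (enat m')
  have "set_pmf p = idx k" using dec by (simp add: decreasing_with_flat_regions_def)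
  then have "idx k \<noteq> {}" using set_pmf_not_empty[of p] by simp
  moreover have k: "k = enat (\<Sum>j\<in>{1..m'}. w j)" using dec enat by (simp add: decreasing_with_flat_regions_def)
  ultimately have "1 \<le> m'" by (cases m') (auto simp: idx_def)
  then have m': "m' \<in> idx m" using enat by (simp add: idx_def)
  have "region_start w (Suc m') = 1 + (\<Sum>j\<in>{1..m'}. w j)"
    by (simp add: region_start_def atLeastLessThanSuc_atLeastAtMost)
  then have "i \<in> idx k \<longleftrightarrow> 1 \<le> i \<and> i < region_start w (Suc m')" by (auto simp: idx_def k)
  moreover have "region_start w (Suc J) \<le> region_start w (Suc m')" if "J \<in> idx m" for J
    using that enat by (intro start_mono) (simp add: idx_def)
  ultimately show ?thesis using m' by (meson less_le_trans)
qed

lemma region_exists: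
  assumes "J \<in> idx m" "1 \<le> i" "i < region_start w (Suc J)"
  shows "\<exists>j\<in>idx m. in_region w j i"
  using assms
proof (induction J)
  case 0 then show ?case by (simp add: idx_def)
next
  case (Suc J)
  show ?case
  proof (cases "i < region_start w (Suc J)")
    case True
    then have "J \<noteq> 0" using Suc.prems by (cases J) (auto simp: start_1)
    then show ?thesis using Suc.IH idx_downward[OF Suc.prems(1), of J] Suc.prems True by simp
  next
    case False
    then show ?thesis using Suc.prems in_region_iff[OF Suc.prems(1)] by (intro bexI[of _ "Suc J"]) auto
  qed
qed

lemma region_unique:
  assumes "j \<in> idx m" "j' \<in> idx m" "in_region w j i" "in_region w j' i"
  shows "j = j'"
proof (rule ccontr)
  assume "j \<noteq> j'"
  then consider "Suc j \<le> j'" | "Suc j' \<le> j" by linarith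
  then show False
    using start_mono[of "Suc j" j'] start_mono[of "Suc j'" j] assms by cases (auto simp: in_region_iff)
qed

text \<open>Unspecified outside \<open>idx k\<close>, which is why the formulas below guard it by
  \<open>i \<in> idx k\<close>.\<close>

definition reg :: "nat \<Rightarrow> nat" where
  "reg i = (THE j. j \<in> idx m \<and> in_region w j i)"

lemma reg_eqI: "j \<in> idx m \<Longrightarrow> in_region w j i \<Longrightarrow> reg i = j"
  unfolding reg_def using region_unique by (intro the_equality) auto

lemma reg_in: "i \<in> idx k \<Longrightarrow> reg i \<in> idx m" "i \<in> idx k \<Longrightarrow> in_region w (reg i) i"
  using region_exists idx_k_iff reg_eqI by metis+

lemma in_region_idx: "j \<in> idx m \<Longrightarrow> in_region w j i \<Longrightarrow> i \<in> idx k"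
  unfolding idx_k_iff using in_region_iff[of j i] start_mono[of "Suc 0" j]
  by (auto simp: start_1 idx_def intro!: bexI[of _ j])

lemma in_region_iff_reg: "j \<in> idx m \<Longrightarrow> in_region w j i \<longleftrightarrow> i \<in> idx k \<and> reg i = j"
  using in_region_idx reg_eqI reg_in by metis

lemma region_matrix_eq: "j \<in> idx m \<Longrightarrow> region_matrix w i j = of_bool (i \<in> idx k \<and> reg i = j)"
  by (simp add: region_matrix_def in_region_iff_reg)

lemma reg_le: "i \<in> idx k \<Longrightarrow> reg i \<le> i"
proof -
  assume i: "i \<in> idx k"
  have le: "j \<le> region_start w j" if "j \<in> idx m" for j
  proof (cases "j \<le> 1")
    case False
    then show ?thesis using start_ge[of "j - 1"] idx_downward[OF that, of "j - 1"] by simp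
  qed (auto simp: region_start_def)
  show ?thesis using le[OF reg_in(1)[OF i]] reg_in(2)[OF i] by (simp add: in_region_def)
qed

lemma reg_start: "j \<in> idx m \<Longrightarrow> region_start w j \<in> idx k \<and> reg (region_start w j) = j"
  using w_pos[of j] in_region_iff_reg[of j "region_start w j"] by (auto simp: in_region_def)

lemma set_p: "set_pmf p = idx k"
  using dec by (simp add: decreasing_with_flat_regions_def)

lemma pmf_eq: "pmf p i = (if i \<in> idx k then grouped_param p w (reg i) else 0)"
  using dec reg_in[of i] set_p by (auto simp: decreasing_with_flat_regions_def set_pmf_iff)

lemma param_dec: "j \<in> idx m \<Longrightarrow> Suc j \<in> idx m \<Longrightarrow> grouped_param p w (Suc j) < grouped_param p w j"
  using dec by (simp add: decreasing_with_flat_regions_def)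

text \<open>Region \<open>j\<close> contributes \<open>w j\<close> equal summands. This turns the
  weighted sums of squares of the grouped problem into sums over the coordinates of
  \<open>ell2\<close>.\<close>

lemma sum_regions:
  "J \<in> idx m \<Longrightarrow> (\<Sum>i\<in>{1..<region_start w (Suc J)}. d (reg i)) = (\<Sum>j\<in>{1..J}. real (w j) * d j)"
proof (induction J)
  case 0 then show ?case by (simp add: idx_def)
next
  case (Suc J)
  let ?s = "region_start w"
  have le: "1 \<le> ?s (Suc J)" "?s (Suc J) \<le> ?s (Suc (Suc J))" by (auto simp: region_start_def)
  have "(\<Sum>i\<in>{1..<?s (Suc (Suc J))}. d (reg i)) =
      (\<Sum>i\<in>{1..<?s (Suc J)}. d (reg i)) + (\<Sum>i\<in>{?s (Suc J)..<?s (Suc (Suc J))}. d (reg i))"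
    using le by (simp add: sum.atLeastLessThan_concat)
  also have "(\<Sum>i\<in>{?s (Suc J)..<?s (Suc (Suc J))}. d (reg i)) = (\<Sum>i\<in>{?s (Suc J)..<?s (Suc (Suc J))}. d (Suc J))"
    by (rule sum.cong) (use reg_eqI[OF Suc.prems] in_region_iff[OF Suc.prems] in auto)
  also have "\<dots> = real (w (Suc J)) * d (Suc J)" by (simp add: start_Suc)
  also have "(\<Sum>i\<in>{1..<?s (Suc J)}. d (reg i)) = (\<Sum>j\<in>{1..J}. real (w j) * d j)"
  proof (cases "J = 0")
    case True then show ?thesis by (simp add: start_1)
  next
    case False
    then show ?thesis using Suc.IH idx_downward[OF Suc.prems, of J] by simp
  qed
  finally show ?case by simp
qed

section \<open>The asymptotic covariance and its Gaussian law\<close>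

lemma restricted_cov_eq:
  "restricted_cov p m w i i' = (if i \<in> idx k \<and> i' \<in> idx k then grouped_cov p w (reg i) (reg i') else 0)"
proof -
  have inner: "(\<Sum>\<^sub>\<infinity>j'\<in>idx m. region_matrix w i j * grouped_cov p w j j' * region_matrix w i' j') =
      (if i' \<in> idx k then region_matrix w i j * grouped_cov p w j (reg i') else 0)" for j
  proof (cases "i' \<in> idx k")
    case True
    then show ?thesis
      by (subst infsum_single_term[of "reg i'"]) (auto simp: region_matrix_eq reg_in)
  next
    case False
    then have "(\<Sum>\<^sub>\<infinity>j'\<in>idx m. region_matrix w i j * grouped_cov p w j j' * region_matrix w i' j') = 0"
      by (intro infsum_0) (auto simp: region_matrix_eq)
    then show ?thesis using False by simp
  qed
  show ?thesis
  proof (cases "i \<in> idx k")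
    case True
    then show ?thesis unfolding restricted_cov_def inner
      by (subst infsum_single_term[of "reg i"]) (auto simp: region_matrix_eq reg_in)
  next
    case False
    then have "restricted_cov p m w i i' = 0"
      unfolding restricted_cov_def inner by (intro infsum_0) (auto simp: region_matrix_eq)
    then show ?thesis using False by simp
  qed
qed

text \<open>The probability of the regions after \<open>J\<close>. It plays the part of
  \<open>q\<close> in the bridge, whose time after region \<open>J\<close> is the cumulative mass
  \<open>1 - tail_mass J\<close>.\<close>

definition tail_mass where "tail_mass J = 1 - (\<Sum>j\<in>{1..J}. real (w j) * grouped_param p w j)"

lemma tail_mass_nonneg: "J \<in> idx m \<Longrightarrow> 0 \<le> tail_mass J"
proof -
  assume J: "J \<in> idx m"
  have "(\<Sum>j\<in>{1..J}. real (w j) * grouped_param p w j) = (\<Sum>i\<in>{1..<region_start w (Suc J)}. pmf p i)"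
    unfolding sum_regions[OF J, symmetric]
    by (rule sum.cong) (use J idx_k_iff pmf_eq in auto)
  also have "\<dots> = measure p {1..<region_start w (Suc J)}" by (rule measure_measure_pmf_finite[symmetric]) simp
  also have "\<dots> \<le> 1" by simp
  finally show ?thesis by (simp add: tail_mass_def)
qed

lemma pmf_summable: "summable (pmf p)"
  by (rule summableI_nonneg_bounded[of _ 1]) (auto simp flip: measure_measure_pmf_finite)

text \<open>The upper bound holds because \<open>w j \<ge> 1\<close>, the lower one because a region
  has mass at most 1. Summability of \<open>pmf p\<close> then gives finite trace and, later, tail
  bounds that do not depend on \<open>n\<close>.\<close>

lemma restricted_cov_diag_le: "restricted_cov p m w i i \<le> pmf p i" "0 \<le> restricted_cov p m w i i"
proof -
  have main: "grouped_cov p w (reg i) (reg i) \<le> pmf p i \<and> 0 \<le> grouped_cov p w (reg i) (reg i)" if i: "i \<in> idx k"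
  proof
    let ?j = "reg i" let ?q = "grouped_param p w ?j"
    have q: "0 \<le> ?q" by (simp add: grouped_param_def)
    have w: "1 \<le> real (w ?j)" using w_pos[OF reg_in(1)[OF i]] by simp
    have "?q / real (w ?j) \<le> ?q / 1" using q w by (intro divide_left_mono) auto
    then show "grouped_cov p w ?j ?j \<le> pmf p i" using i q by (simp add: pmf_eq grouped_cov_def) (smt (verit) zero_le_square)
    have j: "?j \<in> {1..?j}" using reg_in(1)[OF i] by (simp add: idx_def)
    have "real (w ?j) * ?q \<le> (\<Sum>j\<in>{1..?j}. real (w j) * grouped_param p w j)"
      by (rule member_le_sum[OF j]) (auto simp: grouped_param_def)
    also have "\<dots> \<le> 1" using tail_mass_nonneg[OF reg_in(1)[OF i]] by (simp add: tail_mass_def)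
    finally have "?q \<le> 1 / real (w ?j)" using w by (simp add: field_simps)
    then have "?q * ?q \<le> ?q * (1 / real (w ?j))" using q by (rule mult_left_mono)
    then show "0 \<le> grouped_cov p w ?j ?j" by (simp add: grouped_cov_def)
  qed
  then show "restricted_cov p m w i i \<le> pmf p i" "0 \<le> restricted_cov p m w i i"
    by (auto simp: restricted_cov_eq)
qed

lemma gaussian_limit_exists:
  obtains N where "centred_gaussian N (restricted_cov p m w)"
    "\<And>h T b. (\<integral>x. cos ((\<Sum>i<T. h i * coord x i) + b) \<partial>N) =
       cos b * exp (- ((\<Sum>i<T. \<Sum>i'<T. h i * h i' * restricted_cov p m w i i') / 2))"
proof (rule gaussian_ell2_from_factor)
  \<comment> \<open>The bridge increment over a region, spread evenly over its coordinates. With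
    region masses \<open>w j * p' j\<close>, dividing the multinomial covariance by the two lengths
    gives \<open>grouped_cov\<close>. The factor is triangular because
    \<open>reg i \<le> i\<close>.\<close>
  let ?\<gamma> = "\<lambda>i l. if i \<in> idx k then
     (bridge tail_mass (reg i) l - bridge tail_mass (reg i - 1) l) / real (w (reg i)) else 0"
  show "?\<gamma> i l = 0" if "i < l" for i l
    using reg_le[of i] that by (auto simp: bridge_def)
  show "restricted_cov p m w i i' = (\<Sum>l\<le>L. ?\<gamma> i l * ?\<gamma> i' l)" if L: "i \<le> L" "i' \<le> L" for i i' L
  proof (cases "i \<in> idx k \<and> i' \<in> idx k")
    case True
    let ?j = "reg i" let ?j' = "reg i'"
    have j: "?j \<in> idx m" "?j' \<in> idx m" "1 \<le> ?j" "1 \<le> ?j'" using True reg_in(1) by (auto simp: idx_def)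
    then have J: "max ?j ?j' \<in> idx m" by (simp add: max_def)
    have tm: "tail_mass (Suc l) = tail_mass l - real (w (Suc l)) * grouped_param p w (Suc l)" for l
      by (simp add: tail_mass_def)
    have inc: "tail_mass (j - 1) - tail_mass j = real (w j) * grouped_param p w j" if "1 \<le> j" for j
      using tm[of "j - 1"] that by simp
    have w0: "real (w ?j) > 0" "real (w ?j') > 0" using w_pos j by (metis of_nat_0_less_iff less_le_trans zero_less_one)+
    have "(\<Sum>l\<le>L. (bridge tail_mass ?j l - bridge tail_mass (?j - 1) l) * (bridge tail_mass ?j' l - bridge tail_mass (?j' - 1) l)) =
      of_bool (?j = ?j') * (tail_mass (?j - 1) - tail_mass ?j) - (tail_mass (?j - 1) - tail_mass ?j) * (tail_mass (?j' - 1) - tail_mass ?j')"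
    proof (rule bridge_increment_covariance[of _ "max ?j ?j'"])
      show "tail_mass 0 = 1" by (simp add: tail_mass_def)
      show "tail_mass (Suc l) \<le> tail_mass l" for l unfolding tm by (simp add: grouped_param_def)
      show "0 \<le> tail_mass l" if "l \<le> max ?j ?j'" for l
        using tail_mass_nonneg[of l] idx_downward[OF J, of l] that by (cases "l = 0") (auto simp: tail_mass_def)
      show "?j \<le> L" "?j' \<le> L" using reg_le[of i] reg_le[of i'] True L by auto
    qed (use j in auto)
    then have "(\<Sum>l\<le>L. ?\<gamma> i l * ?\<gamma> i' l) = (of_bool (?j = ?j') * (real (w ?j) * grouped_param p w ?j)
        - (real (w ?j) * grouped_param p w ?j) * (real (w ?j') * grouped_param p w ?j')) / (real (w ?j) * real (w ?j'))"
      unfolding inc[OF j(3)] inc[OF j(4)] using True by (simp flip: sum_divide_distrib)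
    also have "\<dots> = grouped_cov p w ?j ?j'" using w0 by (auto simp: grouped_cov_def field_simps)
    finally show ?thesis using True by (simp add: restricted_cov_eq)
  qed (auto simp: restricted_cov_eq)
  show "summable (\<lambda>i. restricted_cov p m w i i)"
    by (rule summable_comparison_test'[OF pmf_summable, of 0]) (use restricted_cov_diag_le in auto)
qed (rule that)

end

section \<open>Sampling\<close>

text \<open>Observations are numbered from 1, the summands of the central limit theorem from
  0.\<close>

lemma (in prob_space) indep_vars_Suc:
  assumes "indep_vars (\<lambda>_. N) X {1..}"
  shows "indep_vars (\<lambda>_. N) (\<lambda>i. X (Suc i)) UNIV"
  unfolding indep_vars_def2
proof (intro conjI ballI)
  show "random_variable N (X (Suc i))" for i using assms by (simp add: indep_vars_def2)
  have ind: "indep_sets (\<lambda>i. {X i -` A \<inter> space M |A. A \<in> sets N}) {1..}"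
    using assms by (simp add: indep_vars_def2)
  show "indep_sets (\<lambda>i. {X (Suc i) -` A \<inter> space M |A. A \<in> sets N}) UNIV"
  proof (rule indep_setsI)
    show "{X (Suc i) -` A \<inter> space M |A. A \<in> sets N} \<subseteq> events" for i
      using ind by (simp add: indep_sets_def)
    fix A and J :: "nat set"
    assume J: "J \<noteq> {}" "finite J" and A: "\<forall>j\<in>J. A j \<in> {X (Suc j) -` A \<inter> space M |A. A \<in> sets N}"
    have "prob (\<Inter>j\<in>Suc ` J. A (j - 1)) = (\<Prod>j\<in>Suc ` J. prob (A (j - 1)))"
      by (rule indep_setsD[OF ind]) (use J A in auto)
    then show "prob (\<Inter>j\<in>J. A j) = (\<Prod>j\<in>J. prob (A j))"
      by (simp add: prod.reindex)
  qed
qed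

locale iid_sample = prob_space M for M :: "'a measure" +
  fixes X :: "nat \<Rightarrow> 'a \<Rightarrow> nat" and p :: "nat pmf"
  assumes indep: "indep_vars (\<lambda>_. count_space UNIV) X {1..}"
    and dist: "\<And>l. 1 \<le> l \<Longrightarrow> distr M (count_space UNIV) (X l) = measure_pmf p"
begin

lemma X_measurable [measurable]: "1 \<le> l \<Longrightarrow> X l \<in> measurable M (count_space UNIV)"
  using indep by (simp add: indep_vars_def2)

lemma measurable_phi_X: "1 \<le> l \<Longrightarrow> (\<lambda>\<omega>. (\<phi> :: nat \<Rightarrow> real) (X l \<omega>)) \<in> borel_measurable M"
  by (rule measurable_compose[OF X_measurable]) auto

lemma expectation_X:
  fixes \<phi> :: "nat \<Rightarrow> real"
  shows "1 \<le> l \<Longrightarrow> (\<integral>\<omega>. \<phi> (X l \<omega>) \<partial>M) = measure_pmf.expectation p \<phi>"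
  by (subst dist[of l, symmetric], simp, subst integral_distr) auto

lemma integrable_pmf_bounded:
  fixes \<phi> :: "nat \<Rightarrow> real"
  shows "(\<And>x. \<bar>\<phi> x\<bar> \<le> B) \<Longrightarrow> integrable p \<phi>"
  by (rule measure_pmf.integrable_bounded) auto

lemma integrable_X:
  fixes \<phi> :: "nat \<Rightarrow> real"
  shows "1 \<le> l \<Longrightarrow> (\<And>x. \<bar>\<phi> x\<bar> \<le> B) \<Longrightarrow> integrable M (\<lambda>\<omega>. \<phi> (X l \<omega>))"
  by (rule integrable_bounded[OF measurable_phi_X])

lemma AE_X_support: "AE \<omega> in M. \<forall>l\<ge>1. X l \<omega> \<in> set_pmf p"
proof -
  have "AE \<omega> in M. 1 \<le> l \<longrightarrow> X l \<omega> \<in> set_pmf p" for l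
  proof (cases "1 \<le> l")
    case True
    have "AE x in distr M (count_space UNIV) (X l). x \<in> set_pmf p"
      unfolding dist[OF True] by (simp add: AE_measure_pmf)
    then show ?thesis using True by (subst (asm) AE_distr_iff) auto
  qed simp
  then show ?thesis by (subst AE_all_countable) blast
qed

lemma sum_second_moment:
  fixes \<phi> :: "nat \<Rightarrow> real"
  assumes B: "\<And>x. \<bar>\<phi> x\<bar> \<le> B" and mean: "measure_pmf.expectation p \<phi> = 0"
  shows "has_bochner_integral M (\<lambda>\<omega>. (\<Sum>l\<in>{1..n}. \<phi> (X l \<omega>))\<^sup>2)
    (real n * measure_pmf.expectation p (\<lambda>x. (\<phi> x)\<^sup>2))"
proof -
  have B2: "\<bar>\<phi> x * \<phi> y\<bar> \<le> B * B" for x y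
    using mult_mono[OF B B] B[of 0] by (auto simp: abs_mult)
  have cross: "has_bochner_integral M (\<lambda>\<omega>. \<phi> (X l \<omega>) * \<phi> (X l' \<omega>))
      (of_bool (l = l') * measure_pmf.expectation p (\<lambda>x. (\<phi> x)\<^sup>2))" if l: "1 \<le> l" "1 \<le> l'" for l l'
  proof (cases "l = l'")
    case True
    then show ?thesis
      using integrable_X[of l "\<lambda>x. \<phi> x * \<phi> x", OF l(1) B2] expectation_X[of l "\<lambda>x. \<phi> x * \<phi> x"] l
      by (simp add: has_bochner_integral_iff power2_eq_square)
  next
    case False
    have "indep_vars (\<lambda>_. borel) (\<lambda>l \<omega>. \<phi> (X l \<omega>)) {l, l'}"
      by (rule indep_vars_compose2[OF indep_vars_subset[OF indep]]) (use l in auto)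
    moreover have "integrable M (\<lambda>\<omega>. \<phi> (X i \<omega>))" if "i \<in> {l, l'}" for i
      by (rule integrable_X[OF _ B]) (use that l in auto)
    ultimately show ?thesis
      using indep_vars_lebesgue_integral[of "{l, l'}" "\<lambda>l \<omega>. \<phi> (X l \<omega>)"]
        indep_vars_integrable[of "{l, l'}" "\<lambda>l \<omega>. \<phi> (X l \<omega>)"] l mean expectation_X[of l \<phi>] False
      by (simp add: has_bochner_integral_iff)
  qed
  have "has_bochner_integral M (\<lambda>\<omega>. \<Sum>l\<in>{1..n}. \<Sum>l'\<in>{1..n}. \<phi> (X l \<omega>) * \<phi> (X l' \<omega>))
     (\<Sum>l\<in>{1..n}. \<Sum>l'\<in>{1..n}. of_bool (l = l') * measure_pmf.expectation p (\<lambda>x. (\<phi> x)\<^sup>2))"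
    by (intro has_bochner_integral_sum cross) auto
  moreover have "(\<Sum>l\<in>{1..n}. \<Sum>l'\<in>{1..n}. of_bool (l = l') * measure_pmf.expectation p (\<lambda>x. (\<phi> x)\<^sup>2)) =
      real n * measure_pmf.expectation p (\<lambda>x. (\<phi> x)\<^sup>2)"
    by (simp add: of_bool_def if_distrib[where f = "\<lambda>x. x * _"] cong: if_cong)
  ultimately show ?thesis by (simp only: power2_eq_square sum_product)
qed

text \<open>The characteristic function of the normalised sum converges; multiplying by
  \<open>iexp b\<close> and taking real parts turns this into a statement about cosines with a
  phase, the generators of \<open>trig\<close>.\<close>

lemma cos_clt:
  fixes \<phi> :: "nat \<Rightarrow> real"
  assumes B: "\<And>x. \<bar>\<phi> x\<bar> \<le> B" and mean: "measure_pmf.expectation p \<phi> = 0"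
  shows "(\<lambda>n. \<integral>\<omega>. cos ((\<Sum>l\<in>{1..n}. \<phi> (X l \<omega>)) / sqrt (real n) + b) \<partial>M) \<longlonglongrightarrow>
    cos b * exp (- (measure_pmf.expectation p (\<lambda>x. (\<phi> x)\<^sup>2) / 2))"
proof -
  define V where "V = measure_pmf.expectation p (\<lambda>x. (\<phi> x)\<^sup>2)"
  define S where "S n \<omega> = (\<Sum>l\<in>{1..n}. \<phi> (X l \<omega>)) / sqrt (real n)" for n \<omega>
  have [measurable]: "S n \<in> borel_measurable M" for n
    unfolding S_def by (intro borel_measurable_divide borel_measurable_sum measurable_phi_X) auto
  have B2: "\<bar>(\<phi> x)\<^sup>2\<bar> \<le> B\<^sup>2" for x using B[of x] by (simp add: abs_le_square_iff[symmetric])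
  have V0: "0 \<le> V" unfolding V_def by simp
  have chr: "(\<lambda>n. \<integral>\<omega>. iexp (S n \<omega>) \<partial>M) \<longlonglongrightarrow> complex_of_real (exp (- (V / 2)))"
  \<comment> \<open>The central limit theorem requires positive variance. Degenerate combinations do
    occur: for instance the coordinates of the error add up to 0 for finite
    \<open>k\<close>.\<close>
  proof (cases "V = 0")
    case True
    have "AE x in p. \<phi> x = 0"
      using True integral_nonneg_eq_0_iff_AE[OF integrable_pmf_bounded[OF B2]] by (simp add: V_def)
    then have z: "\<phi> x = 0" if "x \<in> set_pmf p" for x using that by (simp add: AE_measure_pmf_iff)
    have "(\<integral>\<omega>. iexp (S n \<omega>) \<partial>M) = (\<integral>\<omega>. 1 \<partial>M)" for n
    proof (rule integral_cong_AE)
      show "AE \<omega> in M. iexp (S n \<omega>) = 1"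
        using AE_X_support by eventually_elim (simp add: S_def z)
    qed measurable
    then show ?thesis using True by (simp add: prob_space)
  next
    case False
    then have V: "0 < V" using V0 by simp
    define Y where "Y i \<omega> = \<phi> (X (Suc i) \<omega>)" for i \<omega>
    have Y_meas [measurable]: "Y i \<in> borel_measurable M" for i unfolding Y_def by (rule measurable_phi_X) simp
    have Y_distr: "distr M borel (Y i) = distr p borel \<phi>" for i
      by (subst dist[of "Suc i", symmetric], simp, subst distr_distr) (auto simp: Y_def[abs_def] comp_def)
    have "weak_conv_m (\<lambda>n. distr M borel (\<lambda>\<omega>. (\<Sum>i<n. Y i \<omega>) / sqrt (real n * (sqrt V)\<^sup>2))) std_normal_distribution"
    proof (rule central_limit_theorem_zero_mean)
      show "indep_vars (\<lambda>i. borel) Y UNIV"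
        unfolding Y_def by (rule indep_vars_compose2[OF indep_vars_Suc[OF indep]]) auto
      show "expectation (Y i) = 0" for i unfolding Y_def by (simp add: expectation_X mean)
      then show "variance (Y i) = (sqrt V)\<^sup>2" for i
        using V expectation_X[of "Suc i" "\<lambda>x. (\<phi> x)\<^sup>2"] by (simp add: Y_def V_def)
      show "integrable M (\<lambda>\<omega>. (Y i \<omega>)\<^sup>2)" for i
        unfolding Y_def by (rule integrable_X[OF _ B2]) simp
    qed (use V Y_distr in auto)
    \<comment> \<open>Evaluation at \<open>sqrt V\<close> undoes the normalisation to variance
      1.\<close>
    then have "(\<lambda>n. char (distr M borel (\<lambda>\<omega>. (\<Sum>i<n. Y i \<omega>) / sqrt (real n * (sqrt V)\<^sup>2))) (sqrt V)) \<longlonglongrightarrow>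
        char std_normal_distribution (sqrt V)"
      by (intro levy_continuity1 real_distribution_distr real_dist_normal_dist) measurable
    moreover have "char (distr M borel (\<lambda>\<omega>. (\<Sum>i<n. Y i \<omega>) / sqrt (real n * (sqrt V)\<^sup>2))) (sqrt V) =
       (\<integral>\<omega>. iexp (S n \<omega>) \<partial>M)" for n
    proof -
      have "(\<Sum>i<n. Y i \<omega>) = (\<Sum>l\<in>{1..n}. \<phi> (X l \<omega>))" for \<omega>
        unfolding Y_def using sum.shift_bounds_Suc_ivl[of "\<lambda>l. \<phi> (X l \<omega>)" 0 n]
        by (simp add: lessThan_atLeast0 atLeastLessThanSuc_atLeastAtMost)
      then have "sqrt V * ((\<Sum>i<n. Y i \<omega>) / sqrt (real n * (sqrt V)\<^sup>2)) = S n \<omega>" for \<omega>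
        using V by (simp add: S_def real_sqrt_mult)
      then show ?thesis by (simp add: char_def integral_distr flip: of_real_mult)
    qed
    ultimately show ?thesis using V by (simp add: char_std_normal_distribution)
  qed
  have "(\<lambda>n. Re (iexp b * (\<integral>\<omega>. iexp (S n \<omega>) \<partial>M))) \<longlonglongrightarrow> Re (iexp b * complex_of_real (exp (- (V / 2))))"
    by (intro tendsto_Re tendsto_mult_left chr)
  moreover have "Re (iexp b * (\<integral>\<omega>. iexp (S n \<omega>) \<partial>M)) = (\<integral>\<omega>. cos (S n \<omega> + b) \<partial>M)" for n
  proof -
    have "(\<integral>\<omega>. cos (S n \<omega> + b) \<partial>M) = (\<integral>\<omega>. Re (iexp b * iexp (S n \<omega>)) \<partial>M)"
      by (intro Bochner_Integration.integral_cong) (simp_all add: Re_exp cos_add flip: exp_add distrib_left)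
    also have "\<dots> = Re (\<integral>\<omega>. iexp b * iexp (S n \<omega>) \<partial>M)"
      by (intro integral_Re integrable_mult_right integrable_iexp) measurable
    finally show ?thesis by (simp only: integral_mult_right_zero)
  qed
  ultimately show ?thesis by (simp add: Re_exp S_def V_def)
qed

end

section \<open>The unrestricted estimator as a mean of i.i.d. vectors\<close>

locale flat_sample = flat_regions p k m w + iid_sample M X p
  for M :: "'a measure" and X p k m w
begin

text \<open>For \<open>x\<close> in the support, \<open>cell x\<close> is the uniform distribution
  on the region of \<open>x\<close>. Its average over the sample is \<open>A g\<close>.\<close>

definition cell :: "nat \<Rightarrow> nat \<Rightarrow> real" where
  "cell x i = of_bool (x \<in> idx k \<and> i \<in> idx k \<and> reg x = reg i) / real (w (reg i))"

lemma cell_bounds: "0 \<le> cell x i" "cell x i \<le> 1"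
proof -
  have "1 \<le> real (w (reg i))" if "i \<in> idx k" using w_pos[OF reg_in(1)[OF that]] by simp
  then show "0 \<le> cell x i" "cell x i \<le> 1" by (auto simp: cell_def)
qed

definition dev :: "nat \<Rightarrow> nat \<Rightarrow> real" where "dev i x = cell x i - pmf p i"

lemma dev_bound: "\<bar>dev i x\<bar> \<le> 1"
  using cell_bounds[of x i] pmf_le_1[of p i] pmf_nonneg[of p i] unfolding dev_def by linarith

lemma region_prob:
  assumes "j \<in> idx m"
  shows "measure_pmf.expectation p (\<lambda>x. of_bool (x \<in> idx k \<and> reg x = j)) = real (w j) * grouped_param p w j"
proof -
  let ?A = "{region_start w j..<region_start w (Suc j)}"
  have "(\<lambda>x. of_bool (x \<in> idx k \<and> reg x = j) :: real) = indicator ?A"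
    using in_region_iff_reg[OF assms] in_region_iff[OF assms] by (auto simp: indicator_def fun_eq_iff)
  then have "measure_pmf.expectation p (\<lambda>x. of_bool (x \<in> idx k \<and> reg x = j)) = (\<Sum>i\<in>?A. pmf p i)"
    by (simp add: measure_measure_pmf_finite)
  also have "\<dots> = (\<Sum>i\<in>?A. grouped_param p w j)"
    by (rule sum.cong) (use pmf_eq in_region_iff_reg[OF assms] in_region_iff[OF assms] in auto)
  also have "\<dots> = real (w j) * grouped_param p w j"
    using assms by (simp add: start_Suc idx_def)
  finally show ?thesis .
qed

lemma cell_eq: "i \<in> idx k \<Longrightarrow> cell x i = of_bool (x \<in> idx k \<and> reg x = reg i) / real (w (reg i))"
  by (auto simp: cell_def)

lemma expectation_cell: "measure_pmf.expectation p (\<lambda>x. cell x i) = pmf p i"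
proof (cases "i \<in> idx k")
  case True
  then show ?thesis using w_pos[OF reg_in(1)[OF True]]
    by (simp add: cell_eq region_prob reg_in pmf_eq)
next
  case False
  then show ?thesis by (simp add: cell_def pmf_eq)
qed

lemma expectation_dev: "measure_pmf.expectation p (dev i) = 0"
  unfolding dev_def using integrable_pmf_bounded[of "\<lambda>x. cell x i" 1] cell_bounds
  by (simp add: expectation_cell)

lemma expectation_cell_cell:
  "measure_pmf.expectation p (\<lambda>x. cell x i * cell x i') =
    (if i \<in> idx k \<and> i' \<in> idx k \<and> reg i = reg i' then grouped_param p w (reg i) / real (w (reg i)) else 0)"
proof (cases "i \<in> idx k \<and> i' \<in> idx k \<and> reg i = reg i'")
  case True
  then have "(\<lambda>x. cell x i * cell x i') = (\<lambda>x. of_bool (x \<in> idx k \<and> reg x = reg i) / (real (w (reg i)) * real (w (reg i))))"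
    by (auto simp: cell_eq fun_eq_iff)
  then show ?thesis using True w_pos[OF reg_in(1), of i]
    by (simp add: region_prob reg_in)
next
  case False
  then have "(\<lambda>x. cell x i * cell x i') = (\<lambda>x. 0)" by (auto simp: cell_def fun_eq_iff)
  then show ?thesis using False by auto
qed

text \<open>A single observation already has the limiting covariance: the diagonal block
  \<open>p' / w\<close> comes from two coordinates sharing a region, the product term from
  centring.\<close>

lemma expectation_dev_dev:
  "measure_pmf.expectation p (\<lambda>x. dev i x * dev i' x) = restricted_cov p m w i i'"
proof -
  have b: "\<bar>cell x i * cell x i'\<bar> \<le> 1" for x
    using mult_mono[OF cell_bounds(2) cell_bounds(2)[of x i']] cell_bounds by (simp add: abs_mult)
  have i: "integrable p (\<lambda>x. cell x i)" "integrable p (\<lambda>x. cell x i')" "integrable p (\<lambda>x. cell x i * cell x i')"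
    using cell_bounds by (auto intro!: integrable_pmf_bounded[OF b] integrable_pmf_bounded[of _ 1])
  have "measure_pmf.expectation p (\<lambda>x. dev i x * dev i' x) =
     measure_pmf.expectation p (\<lambda>x. (cell x i * cell x i' - pmf p i' * cell x i) - (pmf p i * cell x i' - pmf p i * pmf p i'))"
    by (intro Bochner_Integration.integral_cong) (auto simp: dev_def algebra_simps)
  also have "\<dots> = measure_pmf.expectation p (\<lambda>x. cell x i * cell x i') - pmf p i * pmf p i'"
    using i by (simp add: expectation_cell)
  finally show ?thesis
    unfolding expectation_cell_cell restricted_cov_eq by (auto simp: grouped_cov_def pmf_eq)
qed

end

context flat_sample
begin

definition cell_ell2 :: "nat \<Rightarrow> ell2" where "cell_ell2 x = Abs_ell2 (cell x)"

lemma coord_cell: "coord (cell_ell2 x) i = cell x i"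
proof -
  have "cell x i = 0" if "i \<notin> {region_start w (reg x)..<region_start w (Suc (reg x))}" for i
  proof (rule ccontr)
    assume "cell x i \<noteq> 0"
    then have "i \<in> idx k" "reg x = reg i" by (auto simp: cell_def)
    then show False using that in_region_iff[OF reg_in(1)] reg_in(2) by metis
  qed
  then have "summable (\<lambda>i. (cell x i)\<^sup>2)"
    by (intro summable_finite[of "{region_start w (reg x)..<region_start w (Suc (reg x))}"]) auto
  then show ?thesis by (simp add: cell_ell2_def coord_Abs)
qed

lemma coord_pmf: "coord (pmf_ell2 p) i = pmf p i"
proof -
  have "summable (\<lambda>i. (pmf p i)\<^sup>2)"
    by (rule summable_comparison_test'[OF pmf_summable, of 0])
      (use pmf_le_1[of p] in \<open>auto simp: power2_eq_square mult_left_le\<close>)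
  then show ?thesis by (simp add: pmf_ell2_def coord_Abs)
qed

definition mean_cell :: "nat \<Rightarrow> 'a \<Rightarrow> ell2" where
  "mean_cell n \<omega> = (\<Sum>l\<in>{1..n}. cell_ell2 (X l \<omega>)) /\<^sub>R real n"

lemma coord_sum: "coord (\<Sum>l\<in>A. f l) i = (\<Sum>l\<in>A. coord (f l) i)"
  by (induction A rule: infinite_finite_induct) (auto simp: coord_simps)

lemma coord_mean_cell: "coord (mean_cell n \<omega>) i = (\<Sum>l\<in>{1..n}. cell (X l \<omega>) i) / real n"
  by (simp add: mean_cell_def coord_simps coord_sum coord_cell divide_inverse mult.commute)

text \<open>The rescaled error of \<open>A g\<close>, against which the rescaled error
  \<open>W\<close> of the restricted estimator is compared.\<close>

definition Z :: "nat \<Rightarrow> 'a \<Rightarrow> ell2" where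
  "Z n \<omega> = sqrt (real n) *\<^sub>R (mean_cell n \<omega> - pmf_ell2 p)"

lemma coord_Z: "coord (Z n \<omega>) i = (\<Sum>l\<in>{1..n}. dev i (X l \<omega>)) / sqrt (real n)"
proof (cases "n = 0")
  case False
  have "(\<Sum>l\<in>{1..n}. dev i (X l \<omega>)) = real n * coord (mean_cell n \<omega> - pmf_ell2 p) i"
    using False by (simp add: coord_simps coord_mean_cell coord_pmf dev_def sum_subtractf field_simps)
  also have "real n = sqrt (real n) * sqrt (real n)" by simp
  finally show ?thesis using False by (simp add: Z_def coord_simps del: real_sqrt_mult_self)
qed (simp add: Z_def coord_simps)

lemma Z_measurable [measurable]: "Z n \<in> borel_measurable M"
  by (rule measurable_ell2I) (simp only: coord_Z, intro borel_measurable_divide borel_measurable_sum measurable_phi_X, auto)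

text \<open>Independence cancels the factor \<open>n\<close>, and what remains is the diagonal of
  the covariance. The bound is summable and free of \<open>n\<close>, which controls the norm and
  the tails of \<open>Z n\<close> at the same time.\<close>

lemma Z_second_moment:
  "integrable M (\<lambda>\<omega>. (coord (Z n \<omega>) i)\<^sup>2)" "(\<integral>\<omega>. (coord (Z n \<omega>) i)\<^sup>2 \<partial>M) \<le> pmf p i"
proof -
  have h: "has_bochner_integral M (\<lambda>\<omega>. (\<Sum>l\<in>{1..n}. dev i (X l \<omega>))\<^sup>2) (real n * restricted_cov p m w i i)"
    using sum_second_moment[where \<phi> = "dev i", OF dev_bound expectation_dev, of n] expectation_dev_dev[of i i]
    by (simp add: power2_eq_square)
  then have "has_bochner_integral M (\<lambda>\<omega>. (\<Sum>l\<in>{1..n}. dev i (X l \<omega>))\<^sup>2 / real n) (real n * restricted_cov p m w i i / real n)"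
    by (rule has_bochner_integral_divide_zero)
  then have h: "has_bochner_integral M (\<lambda>\<omega>. (coord (Z n \<omega>) i)\<^sup>2) (real n * restricted_cov p m w i i / real n)"
    by (simp add: coord_Z power_divide)
  then show "integrable M (\<lambda>\<omega>. (coord (Z n \<omega>) i)\<^sup>2)" by (simp add: has_bochner_integral_iff)
  show "(\<integral>\<omega>. (coord (Z n \<omega>) i)\<^sup>2 \<partial>M) \<le> pmf p i"
    using h restricted_cov_diag_le[of i] by (cases "n = 0") (auto simp: has_bochner_integral_iff)
qed

definition pmf_tail :: "nat \<Rightarrow> real" where "pmf_tail T = (\<Sum>i. pmf p (i + T))"

lemma pmf_tail_tendsto: "pmf_tail \<longlonglongrightarrow> 0"
  unfolding pmf_tail_def using suminf_exist_split2[OF pmf_summable] by simp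

lemmas tail_Z = tail_sq_expectation[OF prob_space_axioms Z_measurable Z_second_moment pmf_summable, folded pmf_tail_def]

lemma norm_Z: "integrable M (\<lambda>\<omega>. (norm (Z n \<omega>))\<^sup>2)" "(\<integral>\<omega>. (norm (Z n \<omega>))\<^sup>2 \<partial>M) \<le> pmf_tail 0"
  using tail_Z[of 0 n] norm_sq_split[where T = 0] by simp_all

abbreviation est where "est \<equiv> restricted_estimator m w X"

section \<open>Pathwise comparison of the two estimators for a sample inside the support\<close>

context
  fixes n :: nat and \<omega> :: 'a
  assumes n: "1 \<le> n" and supp: "\<And>l. l \<in> {1..n} \<Longrightarrow> X l \<omega> \<in> idx k"
begin

lemma count_eq: "j \<in> idx m \<Longrightarrow> grouped_count w X n \<omega> j = (\<Sum>l\<in>{1..n}. of_bool (reg (X l \<omega>) = j))"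
  unfolding grouped_count_def by (rule sum.cong) (use supp in_region_iff_reg in auto)

lemma count_support: "{j \<in> idx m. grouped_count w X n \<omega> j \<noteq> 0} = (\<lambda>l. reg (X l \<omega>)) ` {1..n}"
proof -
  have "grouped_count w X n \<omega> j \<noteq> 0 \<longleftrightarrow> j \<in> (\<lambda>l. reg (X l \<omega>)) ` {1..n}" if "j \<in> idx m" for j
    by (auto simp: count_eq[OF that])
  moreover have "(\<lambda>l. reg (X l \<omega>)) ` {1..n} \<subseteq> idx m" using supp reg_in(1) by auto
  ultimately show ?thesis by blast
qed

interpretation C: counts m w "grouped_count w X n \<omega>"
proof
  show "1 \<le> w j" if "j \<in> idx m" for j using that by (rule w_pos)
  show "finite {j \<in> idx m. grouped_count w X n \<omega> j \<noteq> 0}" "{j \<in> idx m. grouped_count w X n \<omega> j \<noteq> 0} \<noteq> {}"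
    unfolding count_support using n by auto
qed

lemma C_n: "C.n = n"
proof -
  have "C.n = (\<Sum>j\<in>{1..C.J}. \<Sum>l\<in>{1..n}. of_bool (reg (X l \<omega>) = j))"
    unfolding C.n_def by (rule sum.cong) (use C.D_idx count_eq in auto)
  also have "\<dots> = (\<Sum>l\<in>{1..n}. \<Sum>j\<in>{1..C.J}. of_bool (reg (X l \<omega>) = j))" by (rule sum.swap)
  also have "\<dots> = (\<Sum>l\<in>{1..n}. 1)"
  proof (rule sum.cong[OF refl])
    fix l assume "l \<in> {1..n}"
    then have "reg (X l \<omega>) \<in> {j \<in> idx m. grouped_count w X n \<omega> j \<noteq> 0}" unfolding count_support by simp
    then have "reg (X l \<omega>) \<in> {1..C.J}" using C.supp_D by blast
    then show "(\<Sum>j\<in>{1..C.J}. of_bool (reg (X l \<omega>) = j)) = (1::nat)"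
      by (simp add: of_bool_def)
  qed
  finally show ?thesis by simp
qed

lemma mle: "C.is_mle (grouped_mle m w X n \<omega>)"
  unfolding grouped_mle_def by (rule C.is_mle_arg_max)

lemma mle_0: "C.J < j \<Longrightarrow> grouped_mle m w X n \<omega> j = 0"
  using C.mle_in_D[OF mle] by (simp add: C.D_simplex_def)

lemma idx_beyond: "i \<in> idx k \<Longrightarrow> region_start w (Suc C.J) \<le> i \<Longrightarrow> C.J < reg i"
proof (rule ccontr)
  assume i: "i \<in> idx k" "region_start w (Suc C.J) \<le> i" and "\<not> C.J < reg i"
  then have "region_start w (Suc (reg i)) \<le> i" using start_mono[of "Suc (reg i)" "Suc C.J"] by linarith
  then show False using reg_in(2)[OF i(1)] in_region_iff[OF reg_in(1)[OF i(1)]] by simp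
qed

text \<open>\<open>Abs_ell2\<close> is meaningful only on square-summable arguments; here the
  argument has finite support, because the maximiser vanishes beyond the last observed
  region.\<close>

lemma coord_est: "coord (est n \<omega>) i = (if i \<in> idx k then grouped_mle m w X n \<omega> (reg i) else 0)"
proof -
  let ?f = "grouped_mle m w X n \<omega>"
  have inf: "(\<Sum>\<^sub>\<infinity>j\<in>idx m. region_matrix w i j * ?f j) = (if i \<in> idx k then ?f (reg i) else 0)" for i
  proof (cases "i \<in> idx k")
    case True
    then show ?thesis by (subst infsum_single_term[of "reg i"]) (auto simp: region_matrix_eq reg_in)
  next
    case False
    then have "(\<Sum>\<^sub>\<infinity>j\<in>idx m. region_matrix w i j * ?f j) = 0"
      by (intro infsum_0) (auto simp: region_matrix_eq)
    then show ?thesis using False by simp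
  qed
  have "summable (\<lambda>i. (if i \<in> idx k then ?f (reg i) else 0)\<^sup>2)"
  proof (rule summable_finite[of "{..<region_start w (Suc C.J)}"])
    fix i assume "i \<notin> {..<region_start w (Suc C.J)}"
    then show "(if i \<in> idx k then ?f (reg i) else 0)\<^sup>2 = 0" using idx_beyond[of i] mle_0 by auto
  qed simp
  then show ?thesis by (simp add: restricted_estimator_def inf coord_Abs)
qed

lemma coord_mean_eq: "coord (mean_cell n \<omega>) i =
  (if i \<in> idx k then real (grouped_count w X n \<omega> (reg i)) / (real n * real (w (reg i))) else 0)"
proof (cases "i \<in> idx k")
  case True
  have "(\<Sum>l\<in>{1..n}. cell (X l \<omega>) i) = (\<Sum>l\<in>{1..n}. of_bool (reg (X l \<omega>) = reg i)) / real (w (reg i))"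
    unfolding sum_divide_distrib by (rule sum.cong) (use True supp in \<open>auto simp: cell_eq\<close>)
  then show ?thesis using True by (simp add: coord_mean_cell count_eq reg_in)
qed (simp add: coord_mean_cell cell_def)

text \<open>This is \<open>mle_contraction\<close> with \<open>q\<close> the true parameter: the
  weights \<open>w j\<close> count the coordinates of a region, so the weighted distance up to
  region \<open>C.J\<close> is a distance of \<open>ell2\<close> heads.\<close>

lemma est_contraction: "norm (est n \<omega> - pmf_ell2 p) \<le> norm (mean_cell n \<omega> - pmf_ell2 p)"
proof -
  let ?T = "region_start w (Suc C.J)" and ?f = "grouped_mle m w X n \<omega>"
  let ?g = "\<lambda>j. real (grouped_count w X n \<omega> j) / (real n * real (w j))"
  have 0: "(0::nat) \<notin> idx k" by (simp add: idx_def)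
  have T: "{..<?T} = insert 0 {1..<?T}" by (auto simp: region_start_def)
  have inT: "i \<in> idx k" if "i \<in> {1..<?T}" for i using that C.J_in(1) idx_k_iff by auto
  \<comment> \<open>Both estimators vanish beyond the last observed region, so both tails are that
    of \<open>p\<close>.\<close>
  have tail: "tail_sq ?T (est n \<omega> - pmf_ell2 p) = tail_sq ?T (mean_cell n \<omega> - pmf_ell2 p)"
    unfolding tail_sq_def
  proof (rule suminf_cong)
    fix i
    have "reg (i + ?T) \<in> idx m \<Longrightarrow> C.J < reg (i + ?T) \<Longrightarrow> grouped_count w X n \<omega> (reg (i + ?T)) = 0"
      using C.supp_D[of "reg (i + ?T)"] by fastforce
    then show "(coord (est n \<omega> - pmf_ell2 p) (i + ?T))\<^sup>2 = (coord (mean_cell n \<omega> - pmf_ell2 p) (i + ?T))\<^sup>2"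
      using idx_beyond[of "i + ?T"] mle_0[of "reg (i + ?T)"] reg_in(1)[of "i + ?T"]
      by (simp add: coord_simps coord_est coord_mean_eq)
  qed
  have head: "(\<Sum>i<?T. (coord (x - pmf_ell2 p) i)\<^sup>2) = (\<Sum>j\<in>{1..C.J}. real (w j) * (h j - grouped_param p w j)\<^sup>2)"
    if "\<And>i. coord x i = (if i \<in> idx k then h (reg i) else 0)" for x h
  proof -
    have "(\<Sum>i<?T. (coord (x - pmf_ell2 p) i)\<^sup>2) = (\<Sum>i\<in>{1..<?T}. (coord (x - pmf_ell2 p) i)\<^sup>2)"
      unfolding T using 0 by (subst sum.insert) (auto simp: coord_simps that coord_pmf pmf_eq)
    also have "\<dots> = (\<Sum>i\<in>{1..<?T}. (h (reg i) - grouped_param p w (reg i))\<^sup>2)"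
      by (rule sum.cong[OF refl], drule inT) (simp add: coord_simps that coord_pmf pmf_eq)
    also have "\<dots> = (\<Sum>j\<in>{1..C.J}. real (w j) * (h j - grouped_param p w j)\<^sup>2)"
      by (rule sum_regions[OF C.J_in(1)])
    finally show ?thesis .
  qed
  have "(\<Sum>j\<in>{1..C.J}. real (w j) * (?f j - grouped_param p w j)\<^sup>2) \<le>
        (\<Sum>j\<in>{1..C.J}. real (w j) * (?g j - grouped_param p w j)\<^sup>2)"
    by (rule C.mle_contraction[OF mle, unfolded C_n]) (use param_dec C.D_idx in \<open>auto intro!: less_imp_le\<close>)
  then have "(norm (est n \<omega> - pmf_ell2 p))\<^sup>2 \<le> (norm (mean_cell n \<omega> - pmf_ell2 p))\<^sup>2"
    unfolding norm_sq_split[where T = ?T] tail head[OF coord_est] head[of _ ?g, OF coord_mean_eq] by simp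
  then show ?thesis by (rule power2_le_imp_le) simp
qed

text \<open>For \<open>j > i\<close>, \<open>g j\<close> is less than \<open>p' j + \<eta>\<close>,
  which is at most \<open>p' (Suc i) + \<eta>\<close>, which is at most
  \<open>p' i - \<eta>\<close>, which is less than \<open>g i\<close>. Thus the gap to the next
  region separates \<open>i\<close> from all later ones. The cut-off \<open>T\<close> on coordinates
  also bounds regions, because \<open>reg i \<le> i\<close>.\<close>

lemma est_local:
  assumes gap: "\<And>i. i \<in> idx m \<Longrightarrow> Suc i \<in> idx m \<Longrightarrow> i \<le> T \<Longrightarrow>
     2 * \<eta> \<le> grouped_param p w i - grouped_param p w (Suc i)"
    and small: "norm (mean_cell n \<omega> - pmf_ell2 p) < \<eta>" and "i < T"
  shows "coord (est n \<omega>) i = coord (mean_cell n \<omega>) i"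
proof (cases "i \<in> idx k")
  case True
  let ?g = "\<lambda>j. real (grouped_count w X n \<omega> j) / (real n * real (w j))"
  have dev: "\<bar>?g j - grouped_param p w j\<bar> < \<eta>" if "j \<in> idx m" for j
    using abs_coord_le_norm[of "mean_cell n \<omega> - pmf_ell2 p" "region_start w j"] small reg_start[OF that]
    by (simp add: coord_simps coord_mean_eq coord_pmf pmf_eq)
  have "?g j < ?g i" if i: "1 \<le> i" "i \<le> T" "i < j" "j \<in> idx m" for i j
  proof -
    have Si: "Suc i \<in> idx m" "i \<in> idx m" using idx_downward[OF i(4)] i by auto
    have "grouped_param p w j \<le> grouped_param p w (Suc i)"
      using Suc_leI[OF i(3)] i(4)
    proof (induction rule: dec_induct)
      case (step l)
      then have "l \<in> idx m" using idx_downward[OF step.prems, of l] by simp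
      then show ?case using step param_dec[of l] by simp
    qed simp
    moreover have "x < y" if "\<bar>x - a\<bar> < \<eta>" "\<bar>y - b\<bar> < \<eta>" "2 * \<eta> \<le> b - c" "a \<le> c" for x y a b c :: real
      using that by linarith
    ultimately show ?thesis using gap[OF Si(2,1) i(2)] dev[OF i(4)] dev[OF Si(2)] by blast
  qed
  then have "grouped_mle m w X n \<omega> (reg i) = ?g (reg i)"
    by (rule C.mle_local[OF mle, unfolded C_n, of T]) (use reg_in(1)[OF True] reg_le[OF True] \<open>i < T\<close> in auto)
  then show ?thesis by (simp add: coord_est coord_mean_eq)
qed (simp add: coord_est coord_mean_eq)

end

lemma gap_exists:
  obtains \<eta> where "0 < \<eta>" "\<And>i. i \<in> idx m \<Longrightarrow> Suc i \<in> idx m \<Longrightarrow> i \<le> T \<Longrightarrow>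
     2 * \<eta> \<le> grouped_param p w i - grouped_param p w (Suc i)"
proof -
  define I where "I = {i. i \<in> idx m \<and> Suc i \<in> idx m \<and> i \<le> T}"
  \<comment> \<open>The element 1 keeps the minimum defined when there is no gap to consider, as for
    a single region.\<close>
  define A where "A = insert 1 ((\<lambda>i. grouped_param p w i - grouped_param p w (Suc i)) ` I)"
  have "finite I" unfolding I_def by simp
  then have fin: "finite A" by (simp add: A_def)
  have "0 < Min A" using fin param_dec by (subst Min_gr_iff) (auto simp: A_def I_def)
  moreover have "Min A \<le> grouped_param p w i - grouped_param p w (Suc i)"
    if "i \<in> idx m" "Suc i \<in> idx m" "i \<le> T" for i
    by (rule Min_le[OF fin]) (use that in \<open>auto simp: A_def I_def\<close>)
  ultimately show ?thesis by (intro that[of "Min A / 2"]) auto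
qed

section \<open>Measurability and consistency of the estimator\<close>

lemma AE_support: "AE \<omega> in M. \<forall>l\<in>{1..n}. X l \<omega> \<in> idx k"
  using AE_X_support by eventually_elim (auto simp: set_p)

text \<open>The estimator depends on \<open>\<omega>\<close> only through a list of naturals, a countable type.\<close>

lemma est_measurable [measurable]: "est n \<in> borel_measurable M"
proof -
  define xs where "xs \<omega> = map (\<lambda>l. X l \<omega>) [1..<Suc n]" for \<omega>
  define cnt where "cnt xs j = sum_list (map (\<lambda>x. of_bool (in_region w j x)) xs :: nat list)" for xs :: "nat list" and j
  define \<Psi> where "\<Psi> c = Abs_ell2 (\<lambda>i. \<Sum>\<^sub>\<infinity>j\<in>idx m. region_matrix w i j *
      arg_max_on (grouped_likelihood m c) (grouped_simplex m w) j)" for c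
  have "grouped_count w X n \<omega> = cnt (xs \<omega>)" for \<omega>
    by (rule ext) (simp add: grouped_count_def cnt_def xs_def comp_def interv_sum_list_conv_sum_set_nat
        atLeastLessThanSuc_atLeastAtMost del: upt_Suc)
  then have eq: "est n = (\<lambda>\<omega>. \<Psi> (cnt (xs \<omega>)))"
    by (intro ext) (simp add: restricted_estimator_def grouped_mle_def \<Psi>_def)
  have "xs \<in> measurable M (count_space UNIV)"
  proof (subst measurable_count_space_eq2_countable, intro conjI ballI)
    show "xs \<in> space M \<rightarrow> UNIV" by simp
    fix ys :: "nat list"
    have "xs \<omega> = ys \<longleftrightarrow> length ys = n \<and> (\<forall>i\<in>{..<n}. X (Suc i) \<omega> = ys ! i)" for \<omega>
      unfolding list_eq_iff_nth_eq by (auto simp: xs_def simp del: upt_Suc)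
    then have "xs -` {ys} \<inter> space M = {\<omega> \<in> space M. length ys = n \<and> (\<forall>i\<in>{..<n}. X (Suc i) \<omega> = ys ! i)}"
      by auto
    also have "\<dots> \<in> sets M"
    proof (intro sets.sets_Collect_conj sets.sets_Collect_const sets.sets_Collect_finite_All)
      show "{\<omega> \<in> space M. X (Suc i) \<omega> = ys ! i} \<in> sets M" if "i \<in> {..<n}" for i
        using measurable_sets[OF X_measurable[of "Suc i"], of "{ys ! i}"] by (simp add: vimage_def Int_def conj_commute)
    qed simp
    finally show "xs -` {ys} \<inter> space M \<in> sets M" .
  qed
  then show ?thesis unfolding eq by (rule measurable_compose) simp
qed

text \<open>At \<open>n = 0\<close> the estimator is an arbitrary feasible vector, so the comparison
  starts at 1.\<close>

lemma AE_est_le: "AE \<omega> in M. 1 \<le> n \<longrightarrow> norm (est n \<omega> - pmf_ell2 p) \<le> norm (Z n \<omega>) / sqrt (real n)"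
  using AE_support[of n]
proof eventually_elim
  case (elim \<omega>)
  then show ?case using est_contraction[of n \<omega>] by (auto simp: Z_def)
qed

lemma consistency: "tendsto_in_prob M est (pmf_ell2 p)"
  unfolding tendsto_in_prob_def
proof (intro conjI allI impI)
  show "est n \<in> borel_measurable M" for n by measurable
  fix \<epsilon> :: real assume \<epsilon>: "0 < \<epsilon>"
  have bound: "measure M {\<omega> \<in> space M. dist (est n \<omega>) (pmf_ell2 p) > \<epsilon>} \<le> pmf_tail 0 / \<epsilon>\<^sup>2 * inverse (real n)" if n: "1 \<le> n" for n
  proof -
    have [measurable]: "(\<lambda>\<omega>. dist (est n \<omega>) (pmf_ell2 p)) \<in> borel_measurable M"
      by (rule measurable_compose[OF est_measurable]) (intro borel_measurable_continuous_onI continuous_intros)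
    have "measure M {\<omega> \<in> space M. dist (est n \<omega>) (pmf_ell2 p) > \<epsilon>} =
        (\<integral>\<omega>. indicator {\<omega> \<in> space M. dist (est n \<omega>) (pmf_ell2 p) > \<epsilon>} \<omega> \<partial>M)" by simp
    also have "\<dots> \<le> (\<integral>\<omega>. (norm (Z n \<omega>))\<^sup>2 / (real n * \<epsilon>\<^sup>2) \<partial>M)"
    proof (rule integral_mono_AE)
      show "AE \<omega> in M. indicator {\<omega> \<in> space M. dist (est n \<omega>) (pmf_ell2 p) > \<epsilon>} \<omega> \<le> (norm (Z n \<omega>))\<^sup>2 / (real n * \<epsilon>\<^sup>2)"
        using AE_est_le[of n]
      proof eventually_elim
        case (elim \<omega>)
        show ?case
        proof (cases "dist (est n \<omega>) (pmf_ell2 p) > \<epsilon>")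
          case True
          then have "\<epsilon> \<le> norm (Z n \<omega>) / sqrt (real n)" using elim n by (simp add: dist_norm)
          then have "\<epsilon>\<^sup>2 \<le> (norm (Z n \<omega>) / sqrt (real n))\<^sup>2" using \<epsilon> by (intro power_mono) auto
          then have "1 \<le> (norm (Z n \<omega>))\<^sup>2 / (real n * \<epsilon>\<^sup>2)" using \<epsilon> n by (simp add: power_divide field_simps)
          then show ?thesis using True by (simp add: indicator_def)
        qed (simp add: indicator_def)
      qed
    next
      show "integrable M (indicat_real {\<omega> \<in> space M. dist (est n \<omega>) (pmf_ell2 p) > \<epsilon>})"
        by (rule integrable_bounded[of _ 1]) (auto simp: indicator_def)
    qed (use norm_Z(1)[of n] in simp)
    also have "\<dots> = (\<integral>\<omega>. (norm (Z n \<omega>))\<^sup>2 \<partial>M) / (real n * \<epsilon>\<^sup>2)" by simp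
    also have "\<dots> \<le> pmf_tail 0 / (real n * \<epsilon>\<^sup>2)" by (intro divide_right_mono norm_Z) simp
    finally show ?thesis by (simp add: divide_inverse mult_ac)
  qed
  have "(\<lambda>n. pmf_tail 0 / \<epsilon>\<^sup>2 * inverse (real n)) \<longlonglongrightarrow> pmf_tail 0 / \<epsilon>\<^sup>2 * 0"
    by (intro tendsto_mult_left lim_inverse_n)
  then have lim: "(\<lambda>n. pmf_tail 0 / \<epsilon>\<^sup>2 * inverse (real n)) \<longlonglongrightarrow> 0" by simp
  show "(\<lambda>n. measure M {\<omega> \<in> space M. dist (est n \<omega>) (pmf_ell2 p) > \<epsilon>}) \<longlonglongrightarrow> 0"
  proof (rule tendsto_sandwich[OF _ _ tendsto_const lim])
    show "\<forall>\<^sub>F n in sequentially. measure M {\<omega> \<in> space M. dist (est n \<omega>) (pmf_ell2 p) > \<epsilon>}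
        \<le> pmf_tail 0 / \<epsilon>\<^sup>2 * inverse (real n)"
      using bound by (rule eventually_sequentiallyI)
  qed simp
qed

section \<open>Limit law of the rescaled restricted estimator\<close>

definition W :: "nat \<Rightarrow> 'a \<Rightarrow> ell2" where
  "W n \<omega> = sqrt (real n) *\<^sub>R (est n \<omega> - pmf_ell2 p)"

lemma W_measurable [measurable]: "W n \<in> borel_measurable M"
  unfolding W_def
  by (rule measurable_compose[OF est_measurable, of "\<lambda>x. sqrt (real n) *\<^sub>R (x - pmf_ell2 p)"])
    (intro borel_measurable_continuous_onI continuous_intros)

text \<open>Makes a distance linear in its square, so that a bound on the expected squared tail
  suffices; \<open>\<delta>\<close> is balanced against that bound later.\<close>

lemma sqrt_le_split:
  assumes "0 \<le> t" "0 < \<delta>"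
  shows "sqrt t \<le> t / \<delta> + \<delta>"
proof (cases "sqrt t \<le> \<delta>")
  case True
  moreover have "0 \<le> t / \<delta>" using assms by simp
  ultimately show ?thesis by linarith
next
  case False
  then have "\<delta> * sqrt t \<le> sqrt t * sqrt t" using assms by (intro mult_right_mono) auto
  then have "sqrt t \<le> t / \<delta>" using assms by (simp add: le_divide_eq mult.commute)
  then show ?thesis using assms by linarith
qed

context
  fixes f :: "ell2 \<Rightarrow> real" and L B :: real
  assumes L: "0 \<le> L" "\<And>x y. \<bar>f x - f y\<bar> \<le> L * dist x y" and B: "\<And>x. \<bar>f x\<bar> \<le> B"
    and cont: "continuous_on UNIV f"
begin

lemma B0: "0 \<le> B" using B[of 0] by linarith

lemma f_measurable: "f \<in> borel_measurable borel"
  using cont by (rule borel_measurable_continuous_onI)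

lemma head_measurable: "(\<lambda>x. head_ell2 T (coord x)) \<in> borel_measurable borel"
  by (rule measurable_ell2I) (simp add: coord_head)

lemma f_head_diff:
  assumes "0 < \<delta>"
  shows "\<bar>f x - f (head_ell2 T (coord x))\<bar> \<le> L * (tail_sq T x / \<delta> + \<delta>)"
proof -
  have "dist x (head_ell2 T (coord x)) = sqrt (tail_sq T x)"
    unfolding dist_norm norm_diff_head[symmetric] by simp
  also have "\<dots> \<le> tail_sq T x / \<delta> + \<delta>" by (rule sqrt_le_split[OF tail_sq_nonneg assms])
  finally show ?thesis using L by (meson mult_left_mono order_trans)
qed

text \<open>If \<open>A g\<close> is within \<open>\<eta>\<close> of \<open>p\<close>, only a
  truncation error remains, controlled by the tail of \<open>Z n\<close>. Otherwise
  \<open>norm (Z n \<omega>)\<close> is at least \<open>\<eta> * sqrt (real n)\<close>, and the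
  trivial bound \<open>2 * B\<close> is charged to the second moment as in Chebyshev's
  inequality.\<close>

lemma W_head_estimate:
  assumes \<delta>: "0 < \<delta>" and \<eta>: "0 < \<eta>" and n: "1 \<le> n"
    and gap: "\<And>i. i \<in> idx m \<Longrightarrow> Suc i \<in> idx m \<Longrightarrow> i \<le> T \<Longrightarrow>
     2 * \<eta> \<le> grouped_param p w i - grouped_param p w (Suc i)"
  shows "\<bar>(\<integral>\<omega>. f (W n \<omega>) \<partial>M) - (\<integral>\<omega>. f (head_ell2 T (coord (Z n \<omega>))) \<partial>M)\<bar> \<le>
    L * (pmf_tail T / \<delta> + \<delta>) + 2 * B * (pmf_tail 0 / (real n * \<eta>\<^sup>2))"
proof -
  have i1: "integrable M (\<lambda>\<omega>. f (W n \<omega>))"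
    by (rule integrable_bounded[OF measurable_compose[OF W_measurable f_measurable] B])
  have i2: "integrable M (\<lambda>\<omega>. f (head_ell2 T (coord (Z n \<omega>))))"
    by (rule integrable_bounded[OF measurable_compose[OF measurable_compose[OF Z_measurable head_measurable] f_measurable] B])
  have i3: "integrable M (\<lambda>\<omega>. L * (tail_sq T (Z n \<omega>) / \<delta> + \<delta>) + 2 * B * ((norm (Z n \<omega>))\<^sup>2 / (real n * \<eta>\<^sup>2)))"
    using tail_Z(1)[of T n] norm_Z(1)[of n] by simp
  have ae: "AE \<omega> in M. \<bar>f (W n \<omega>) - f (head_ell2 T (coord (Z n \<omega>)))\<bar> \<le>
     L * (tail_sq T (Z n \<omega>) / \<delta> + \<delta>) + 2 * B * ((norm (Z n \<omega>))\<^sup>2 / (real n * \<eta>\<^sup>2))"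
    using AE_support[of n]
  proof eventually_elim
    case (elim \<omega>)
    have s: "sqrt (real n) > 0" using n by simp
    have normW: "norm (W n \<omega>) \<le> norm (Z n \<omega>)"
      unfolding W_def Z_def using est_contraction[OF n] elim s by (simp add: mult_left_mono)
    have nn1: "0 \<le> L * (tail_sq T (Z n \<omega>) / \<delta> + \<delta>)"
      using L \<delta> tail_sq_nonneg[of T "Z n \<omega>"] by simp
    have nn2: "0 \<le> 2 * B * ((norm (Z n \<omega>))\<^sup>2 / (real n * \<eta>\<^sup>2))" using B0 by simp
    show ?case
    proof (cases "norm (mean_cell n \<omega> - pmf_ell2 p) < \<eta>")
      case True
      have eq: "coord (W n \<omega>) i = coord (Z n \<omega>) i" if "i < T" for i
        using est_local[OF n _ gap True that] elim by (simp add: W_def Z_def coord_simps)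
      then have h: "head_ell2 T (coord (W n \<omega>)) = head_ell2 T (coord (Z n \<omega>))"
        by (intro ell2_eqI) (simp add: coord_head)
      \<comment> \<open>The heads agree and the whole norm is no larger, so the tail is no larger
        either.\<close>
      have "(norm (W n \<omega>))\<^sup>2 \<le> (norm (Z n \<omega>))\<^sup>2" using normW by (intro power_mono) auto
      then have "tail_sq T (W n \<omega>) \<le> tail_sq T (Z n \<omega>)"
        unfolding norm_sq_split[where T = T] using eq by simp
      then have "L * (tail_sq T (W n \<omega>) / \<delta> + \<delta>) \<le> L * (tail_sq T (Z n \<omega>) / \<delta> + \<delta>)"
        using L \<delta> by (intro mult_left_mono add_right_mono divide_right_mono) auto
      then show ?thesis using f_head_diff[OF \<delta>, of "W n \<omega>" T] nn2 unfolding h by linarith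
    next
      case False
      then have "\<eta> * sqrt (real n) \<le> norm (Z n \<omega>)" using s by (simp add: Z_def mult.commute)
      then have "(\<eta> * sqrt (real n))\<^sup>2 \<le> (norm (Z n \<omega>))\<^sup>2" using \<eta> by (intro power_mono) auto
      then have "1 \<le> (norm (Z n \<omega>))\<^sup>2 / (real n * \<eta>\<^sup>2)" using \<eta> n by (simp add: power_mult_distrib field_simps)
      then have "2 * B * 1 \<le> 2 * B * ((norm (Z n \<omega>))\<^sup>2 / (real n * \<eta>\<^sup>2))" using B0 by (intro mult_left_mono) auto
      then show ?thesis
        using abs_triangle_ineq4[of "f (W n \<omega>)" "f (head_ell2 T (coord (Z n \<omega>)))"] B[of "W n \<omega>"]
          B[of "head_ell2 T (coord (Z n \<omega>))"] nn1 by linarith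
    qed
  qed
  have "\<bar>(\<integral>\<omega>. f (W n \<omega>) \<partial>M) - (\<integral>\<omega>. f (head_ell2 T (coord (Z n \<omega>))) \<partial>M)\<bar> =
      \<bar>\<integral>\<omega>. f (W n \<omega>) - f (head_ell2 T (coord (Z n \<omega>))) \<partial>M\<bar>" using i1 i2 by simp
  also have "\<dots> \<le> (\<integral>\<omega>. \<bar>f (W n \<omega>) - f (head_ell2 T (coord (Z n \<omega>)))\<bar> \<partial>M)" by (rule integral_abs_bound)
  also have "\<dots> \<le> (\<integral>\<omega>. L * (tail_sq T (Z n \<omega>) / \<delta> + \<delta>) + 2 * B * ((norm (Z n \<omega>))\<^sup>2 / (real n * \<eta>\<^sup>2)) \<partial>M)"
    by (rule integral_mono_AE[OF _ i3 ae]) (use i1 i2 in simp)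
  also have "\<dots> = L * ((\<integral>\<omega>. tail_sq T (Z n \<omega>) \<partial>M) / \<delta> + \<delta>) + 2 * B * ((\<integral>\<omega>. (norm (Z n \<omega>))\<^sup>2 \<partial>M) / (real n * \<eta>\<^sup>2))"
    using tail_Z(1)[of T n] norm_Z(1)[of n] by (simp add: prob_space)
  also have "\<dots> \<le> L * (pmf_tail T / \<delta> + \<delta>) + 2 * B * (pmf_tail 0 / (real n * \<eta>\<^sup>2))"
    using L \<delta> B0 tail_Z(2)[of T n] norm_Z(2)[of n] by (intro add_mono mult_left_mono divide_right_mono) auto
  finally show ?thesis .
qed

lemma lipschitz_convergence:
  assumes N: "centred_gaussian N (restricted_cov p m w)"
    and chr: "\<And>h T b. (\<integral>x. cos ((\<Sum>i<T. h i * coord x i) + b) \<partial>N) =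
       cos b * exp (- ((\<Sum>i<T. \<Sum>i'<T. h i * h i' * restricted_cov p m w i i') / 2))"
  shows "(\<lambda>n. \<integral>\<omega>. f (W n \<omega>) \<partial>M) \<longlonglongrightarrow> (\<integral>x. f x \<partial>N)"
proof (rule LIMSEQ_I)
  fix r :: real assume r: "0 < r"
  interpret N: prob_space N using N by (simp add: centred_gaussian_def)
  have sN [measurable_cong]: "sets N = sets borel" using N by (simp add: centred_gaussian_def)
  have int2: "integrable N (\<lambda>x. (coord x i)\<^sup>2)" "(\<integral>x. (coord x i)\<^sup>2 \<partial>N) \<le> pmf p i" for i
    using N restricted_cov_diag_le[of i] unfolding centred_gaussian_def
    by (auto simp: power2_eq_square has_bochner_integral_iff)
  have idN: "(\<lambda>x. x) \<in> borel_measurable N" by measurable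
  note tailN = tail_sq_expectation[where Z = "\<lambda>x. x", OF N.prob_space_axioms idN int2 pmf_summable, folded pmf_tail_def]
  \<comment> \<open>With \<open>pmf_tail T < \<delta>\<^sup>2\<close> the truncation error is at
    most \<open>2 * L * \<delta>\<close>, which is at most \<open>r / 4\<close>;
    \<open>L + 1\<close> avoids division by 0.\<close>
  define \<delta> where "\<delta> = r / (8 * (L + 1))"
  have \<delta>: "0 < \<delta>" using r L by (simp add: \<delta>_def)
  have "\<forall>\<^sub>F T in sequentially. pmf_tail T < \<delta>\<^sup>2"
    using pmf_tail_tendsto by (rule order_tendstoD(2)) (use \<delta> in simp)
  then obtain T where T: "pmf_tail T < \<delta>\<^sup>2" by (auto dest: eventually_happens)
  have "pmf_tail T / \<delta> + \<delta> \<le> 2 * \<delta>" using T \<delta> by (simp add: field_simps power2_eq_square)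
  then have "L * (pmf_tail T / \<delta> + \<delta>) \<le> L * (2 * \<delta>)" using L by (intro mult_left_mono) auto
  also have "\<dots> \<le> (L + 1) * (2 * \<delta>)" using \<delta> by (intro mult_right_mono) auto
  also have "\<dots> = r / 4" using L by (simp add: \<delta>_def field_simps)
  finally have small: "L * (pmf_tail T / \<delta> + \<delta>) \<le> r / 4" .
  \<comment> \<open>The order of choice matters: \<open>T\<close> is fixed from tail bounds that
    hold for all \<open>n\<close>, \<open>\<eta>\<close> depends on \<open>T\<close>, and only then
    is \<open>n\<close> taken large compared with \<open>\<eta>\<close>.\<close>
  obtain \<eta> where \<eta>: "0 < \<eta>" and gap: "\<And>i. i \<in> idx m \<Longrightarrow> Suc i \<in> idx m \<Longrightarrow> i \<le> T \<Longrightarrow>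
     2 * \<eta> \<le> grouped_param p w i - grouped_param p w (Suc i)" using gap_exists by blast

  have "\<bar>(\<integral>x. f x \<partial>N) - (\<integral>x. f (head_ell2 T (coord x)) \<partial>N)\<bar> \<le> r / 4"
  proof -
    have i1: "integrable N f" by (rule N.integrable_bounded[OF _ B]) (use f_measurable in measurable)
    have i2: "integrable N (\<lambda>x. f (head_ell2 T (coord x)))"
      by (rule N.integrable_bounded[OF measurable_compose[OF measurable_compose[OF idN head_measurable] f_measurable] B])
    have i3: "integrable N (\<lambda>x. L * (tail_sq T x / \<delta> + \<delta>))" using tailN(1)[of T] by simp
    have "\<bar>(\<integral>x. f x \<partial>N) - (\<integral>x. f (head_ell2 T (coord x)) \<partial>N)\<bar> = \<bar>\<integral>x. f x - f (head_ell2 T (coord x)) \<partial>N\<bar>"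
      using i1 i2 by simp
    also have "\<dots> \<le> (\<integral>x. \<bar>f x - f (head_ell2 T (coord x))\<bar> \<partial>N)" by (rule integral_abs_bound)
    also have "\<dots> \<le> (\<integral>x. L * (tail_sq T x / \<delta> + \<delta>) \<partial>N)"
      by (rule integral_mono[OF _ i3 f_head_diff[OF \<delta>]]) (use i1 i2 in simp)
    also have "\<dots> = L * ((\<integral>x. tail_sq T x \<partial>N) / \<delta> + \<delta>)" using tailN(1)[of T] by (simp add: N.prob_space)
    also have "\<dots> \<le> L * (pmf_tail T / \<delta> + \<delta>)"
      using L \<delta> tailN(2)[of T] by (intro mult_left_mono add_right_mono divide_right_mono) auto
    finally show ?thesis using small by linarith
  qed
  note estN = this

  have head_if: "head_ell2 T (\<lambda>i. if i < T then y i else 0) = head_ell2 T y" for y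
    by (intro ell2_eqI) (simp add: coord_head)
  have "(\<lambda>n. \<integral>\<omega>. f (head_ell2 T (\<lambda>i. if i < T then coord (Z n \<omega>) i else 0)) \<partial>M) \<longlonglongrightarrow>
      (\<integral>x. f (head_ell2 T (\<lambda>i. if i < T then coord x i else 0)) \<partial>N)"
  proof (rule fdd_convergence[where C = "pmf_tail 0"])
    show "prob_space M" "prob_space N" by (rule prob_space_axioms N.prob_space_axioms)+
    show "(\<lambda>\<omega>. coord (Z n \<omega>)) \<in> borel_measurable M" for n
      by (rule measurable_coordinatewise_then_product) measurable
    show "coord \<in> borel_measurable N"
      by (rule measurable_coordinatewise_then_product) measurable
    show "(\<lambda>n. \<integral>\<omega>. cos ((\<Sum>i<T. h i * coord (Z n \<omega>) i) + b) \<partial>M) \<longlonglongrightarrow>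
        (\<integral>x. cos ((\<Sum>i<T. h i * coord x i) + b) \<partial>N)" for h b
    proof -
      \<comment> \<open>A linear combination of coordinates of \<open>Z n\<close> is a normalised
        sum of the bounded centred variables \<open>\<phi> (X l \<omega>)\<close>, and their
        variance is the quadratic form of the limit covariance.\<close>
      define \<phi> where "\<phi> x = (\<Sum>i<T. h i * dev i x)" for x
      have bd: "\<bar>\<phi> x\<bar> \<le> (\<Sum>i<T. \<bar>h i\<bar>)" for x
        unfolding \<phi>_def by (rule order_trans[OF sum_abs sum_mono]) (simp add: abs_mult dev_bound mult_left_le)
      have id: "integrable p (dev i)" for i by (rule integrable_pmf_bounded[OF dev_bound])
      have mean: "measure_pmf.expectation p \<phi> = 0"
        unfolding \<phi>_def using id by (simp add: expectation_dev)
      have idd: "integrable p (\<lambda>x. dev i x * dev i' x)" for i i'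
        by (rule integrable_pmf_bounded[of _ "1 * 1"]) (simp only: abs_mult, intro mult_mono dev_bound, auto)
      have "(\<phi> x)\<^sup>2 = (\<Sum>i<T. \<Sum>i'<T. h i * h i' * (dev i x * dev i' x))" for x
        unfolding \<phi>_def power2_eq_square sum_product by (simp add: mult_ac)
      then have var: "measure_pmf.expectation p (\<lambda>x. (\<phi> x)\<^sup>2) = (\<Sum>i<T. \<Sum>i'<T. h i * h i' * restricted_cov p m w i i')"
        using idd by (simp add: expectation_dev_dev)
      have "(\<Sum>i<T. h i * coord (Z n \<omega>) i) = (\<Sum>l\<in>{1..n}. \<phi> (X l \<omega>)) / sqrt (real n)" for n \<omega>
      proof -
        have "(\<Sum>i<T. h i * coord (Z n \<omega>) i) = (\<Sum>i<T. \<Sum>l\<in>{1..n}. h i * dev i (X l \<omega>)) / sqrt (real n)"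
          by (simp add: coord_Z sum_divide_distrib sum_distrib_left)
        also have "(\<Sum>i<T. \<Sum>l\<in>{1..n}. h i * dev i (X l \<omega>)) = (\<Sum>l\<in>{1..n}. \<phi> (X l \<omega>))"
          unfolding \<phi>_def by (rule sum.swap)
        finally show ?thesis .
      qed
      then show ?thesis using cos_clt[OF bd mean, of b] unfolding chr var by simp
    qed
    show "integrable M (\<lambda>\<omega>. \<Sum>i<T. (coord (Z n \<omega>) i)\<^sup>2)" for n
      using Z_second_moment(1) by simp
    show "(\<integral>\<omega>. (\<Sum>i<T. (coord (Z n \<omega>) i)\<^sup>2) \<partial>M) \<le> pmf_tail 0" for n
    proof -
      have "(\<integral>\<omega>. (\<Sum>i<T. (coord (Z n \<omega>) i)\<^sup>2) \<partial>M) \<le> (\<Sum>i<T. pmf p i)"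
        using Z_second_moment by (simp add: sum_mono)
      also have "\<dots> \<le> pmf_tail 0" unfolding pmf_tail_def using sum_le_suminf[OF pmf_summable, of "{..<T}"] by simp
      finally show ?thesis .
    qed
    show "integrable N (\<lambda>x. \<Sum>i<T. (coord x i)\<^sup>2)" using int2 by simp
    have "(\<integral>x. (\<Sum>i<T. (coord x i)\<^sup>2) \<partial>N) \<le> (\<Sum>i<T. pmf p i)" using int2 by (simp add: sum_mono)
    also have "\<dots> \<le> pmf_tail 0" unfolding pmf_tail_def using sum_le_suminf[OF pmf_summable, of "{..<T}"] by simp
    finally show "(\<integral>x. (\<Sum>i<T. (coord x i)\<^sup>2) \<partial>N) \<le> pmf_tail 0" .
    show "continuous_on UNIV (\<lambda>y. f (head_ell2 T y))"
      by (rule continuous_on_compose2[OF cont continuous_on_head]) simp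
    show "\<bar>f (head_ell2 T y)\<bar> \<le> B" for y by (rule B)
  qed
  then have "(\<lambda>n. \<integral>\<omega>. f (head_ell2 T (coord (Z n \<omega>))) \<partial>M) \<longlonglongrightarrow> (\<integral>x. f (head_ell2 T (coord x)) \<partial>N)"
    by (simp only: head_if)
  then have ev1: "\<forall>\<^sub>F n in sequentially. \<bar>(\<integral>\<omega>. f (head_ell2 T (coord (Z n \<omega>))) \<partial>M) - (\<integral>x. f (head_ell2 T (coord x)) \<partial>N)\<bar> < r / 8"
    using r unfolding tendsto_iff dist_real_def by (meson divide_pos_pos zero_less_numeral)
  have "(\<lambda>n. 2 * B * (pmf_tail 0 / \<eta>\<^sup>2) * inverse (real n)) \<longlonglongrightarrow> 2 * B * (pmf_tail 0 / \<eta>\<^sup>2) * 0"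
    by (intro tendsto_mult_left lim_inverse_n)
  then have ev2: "\<forall>\<^sub>F n in sequentially. 2 * B * (pmf_tail 0 / \<eta>\<^sup>2) * inverse (real n) < r / 8"
    by (rule order_tendstoD(2)) (use r in simp)
  have "\<forall>\<^sub>F n in sequentially. norm ((\<integral>\<omega>. f (W n \<omega>) \<partial>M) - (\<integral>x. f x \<partial>N)) < r"
    using ev1 ev2 eventually_ge_at_top[of 1]
  proof eventually_elim
    case (elim n)
    have v: "2 * B * (pmf_tail 0 / (real n * \<eta>\<^sup>2)) = 2 * B * (pmf_tail 0 / \<eta>\<^sup>2) * inverse (real n)"
      by (simp add: divide_inverse)
    have combine: "\<bar>a - d\<bar> < r" if "\<bar>a - b\<bar> \<le> u + v" "u \<le> r / 4" "v < r / 8" "\<bar>b - c\<bar> < r / 8" "\<bar>d - c\<bar> \<le> r / 4"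
      for a b c d u v :: real
      using that r by linarith
    show ?case
      unfolding real_norm_def
    proof (rule combine[OF _ small _ elim(1) estN])
      show "2 * B * (pmf_tail 0 / (real n * \<eta>\<^sup>2)) < r / 8" unfolding v by (rule elim(2))
    qed (rule W_head_estimate[OF \<delta> \<eta> elim(3) gap])
  qed
  then show "\<exists>n0. \<forall>n\<ge>n0. norm ((\<integral>\<omega>. f (W n \<omega>) \<partial>M) - (\<integral>x. f x \<partial>N)) < r"
    by (simp add: eventually_sequentially)
qed

end

lemma asymptotic_normality:
  "\<exists>N. centred_gaussian N (restricted_cov p m w) \<and> tendsto_in_distr M W N"
proof -
  obtain N where N: "centred_gaussian N (restricted_cov p m w)"
    "\<And>h T b. (\<integral>x. cos ((\<Sum>i<T. h i * coord x i) + b) \<partial>N) =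
       cos b * exp (- ((\<Sum>i<T. \<Sum>i'<T. h i * h i' * restricted_cov p m w i i') / 2))"
    using gaussian_limit_exists by blast
  have "tendsto_in_distr M W N"
    using N(1) by (intro tendsto_in_distr_lipschitzI prob_space_axioms W_measurable lipschitz_convergence[OF _ _ _ _ N])
      (auto simp: centred_gaussian_def)
  then show ?thesis using N(1) by blast
qed

end

theorem theorem1:
  fixes M :: "'a measure" and X :: "nat \<Rightarrow> 'a \<Rightarrow> nat"
    and p :: "nat pmf" and k m :: enat and w :: "nat \<Rightarrow> nat"
  assumes "decreasing_with_flat_regions p k m w"
    and "prob_space M"
    and "prob_space.indep_vars M (\<lambda>_. count_space UNIV) X {1..}"
    and "\<forall>l\<ge>1. distr M (count_space UNIV) (X l) = measure_pmf p"
  shows "tendsto_in_prob M (restricted_estimator m w X) (pmf_ell2 p) \<and>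
    (\<exists>N. centred_gaussian N (restricted_cov p m w) \<and>
      tendsto_in_distr M
        (\<lambda>n \<omega>. sqrt (real n) *\<^sub>R (restricted_estimator m w X n \<omega> - pmf_ell2 p)) N)"
proof -
  interpret prob_space M by fact
  interpret flat_sample M X p k m w
    by unfold_locales (use assms in auto)
  show ?thesis using consistency asymptotic_normality by (simp add: W_def[abs_def])
qed

end
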